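(* The category of boolean inverse semigroups and their callitic morphisms is dual to (i.e. dually equivalent to) the category of boolean groupoids and their proper continuous covering functors.
   Context: Inverse semigroups carry their natural partial order. Elements $s,t$ are compatible if $s^{-1}t$ and $st^{-1}$ are idempotents. An inverse semigroup is distributive if every finite compatible subset has a join (in particular it has a zero) and multiplication distributes over these finite joins. Boolean algebras are not required to have a top element (they are "generalized boolean algebras": distributive lattices with $0$ in which every principal order ideal $e^{\downarrow}$ is a unital boolean algebra). A boolean inverse semigroup is a distributive inverse semigroup whose semilattice of idempotents is a boolean algebra and in which all binary meets exist. A morphism of boolean inverse semigroups is a semigroup homomorphism preserving binary meets and binary compatible joins. A filter is a non-empty, upward closed, downward directed subset not containing $0$; an ultrafilter is a maximal such filter. A morphism of boolean inverse semigroups is callitic if the inverse image of every ultrafilter is an ultrafilter. A groupoid $G$ is identified with its set of arrows, $G_o$ is its set of identities, $\mathbf{d}(x)=x^{-1}x$. An étale groupoid is a topological groupoid whose domain map $\mathbf{d}\colon G\to G_o$ is a local homeomorphism. A bisection is a subset $A\subseteq G$ with $A^{-1}A, AA^{-1}\subseteq G_o$. A boolean space is a Hausdorff space with a basis of compact-open subsets. A boolean groupoid is a Hausdorff étale topological groupoid with a basis of compact-open bisections whose space of identities is a boolean space. A functor $\alpha\colon G\to H$ of groupoids is a covering functor if (i) $\mathbf{d}(g)=\mathbf{d}(g')$ and $\alpha(g)=\alpha(g')$ imply $g=g'$, and (ii) if $e$ is an identity with $\alpha(e)=\mathbf{d}(h)$ then there is $g\in G$ with $\mathbf{d}(g)=e$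 and $\alpha(g)=h$. A continuous map is proper if the inverse image of every compact set is compact. *)

theory Defs
  imports "HOL-Analysis.Analysis" "HOL-Algebra.Lattice"
begin

section \<open>Inverse semigroups and their natural partial order\<close>

record 'a sgrp = "'a partial_object" +
  sg_mult :: "'a \<Rightarrow> 'a \<Rightarrow> 'a" (infixl \<open>\<cdot>\<index>\<close> 70)

definition inverse_semigroup :: "'a sgrp \<Rightarrow> bool" where
  "inverse_semigroup S \<longleftrightarrow>
     (\<forall>s\<in>carrier S. \<forall>t\<in>carrier S. s \<cdot>\<^bsub>S\<^esub> t \<in> carrier S) \<and>
     (\<forall>s\<in>carrier S. \<forall>t\<in>carrier S. \<forall>u\<in>carrier S.
        (s \<cdot>\<^bsub>S\<^esub> t) \<cdot>\<^bsub>S\<^esub> u = s \<cdot>\<^bsub>S\<^esub> (t \<cdot>\<^bsub>S\<^esub> u)) \<and>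
     (\<forall>s\<in>carrier S. \<exists>!t. t \<in> carrier S \<and>
        s \<cdot>\<^bsub>S\<^esub> t \<cdot>\<^bsub>S\<^esub> s = s \<and> t \<cdot>\<^bsub>S\<^esub> s \<cdot>\<^bsub>S\<^esub> t = t)"

definition sg_inv :: "'a sgrp \<Rightarrow> 'a \<Rightarrow> 'a" where
  "sg_inv S s = (THE t. t \<in> carrier S \<and>
     s \<cdot>\<^bsub>S\<^esub> t \<cdot>\<^bsub>S\<^esub> s = s \<and> t \<cdot>\<^bsub>S\<^esub> s \<cdot>\<^bsub>S\<^esub> t = t)"

definition idems :: "'a sgrp \<Rightarrow> 'a set" where
  "idems S = {e \<in> carrier S. e \<cdot>\<^bsub>S\<^esub> e = e}"

definition nat_order :: "'a sgrp \<Rightarrow> 'a gorder" where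
  "nat_order S = \<lparr>carrier = carrier S, eq = (=), le = (\<lambda>s t. \<exists>e\<in>idems S. s = t \<cdot>\<^bsub>S\<^esub> e)\<rparr>"

definition sg_zero :: "'a sgrp \<Rightarrow> 'a" where
  "sg_zero S = (THE z. z \<in> carrier S \<and>
     (\<forall>s\<in>carrier S. z \<cdot>\<^bsub>S\<^esub> s = z \<and> s \<cdot>\<^bsub>S\<^esub> z = z))"

definition compatible :: "'a sgrp \<Rightarrow> 'a \<Rightarrow> 'a \<Rightarrow> bool" where
  "compatible S s t \<longleftrightarrow> sg_inv S s \<cdot>\<^bsub>S\<^esub> t \<in> idems S \<and> s \<cdot>\<^bsub>S\<^esub> sg_inv S t \<in> idems S"

definition compatible_subset :: "'a sgrp \<Rightarrow> 'a set \<Rightarrow> bool" where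
  "compatible_subset S A \<longleftrightarrow> A \<subseteq> carrier S \<and> (\<forall>s\<in>A. \<forall>t\<in>A. compatible S s t)"

text \<open>The empty set counts as a finite compatible subset; its join is the zero.\<close>

definition distributive_inverse_semigroup :: "'a sgrp \<Rightarrow> bool" where
  "distributive_inverse_semigroup S \<longleftrightarrow> inverse_semigroup S \<and>
     (\<forall>A. finite A \<and> compatible_subset S A \<longrightarrow> (\<exists>j. is_lub (nat_order S) j A)) \<and>
     (\<forall>A j. finite A \<and> compatible_subset S A \<and> is_lub (nat_order S) j A \<longrightarrow>
        (\<forall>s\<in>carrier S.
           is_lub (nat_order S) (s \<cdot>\<^bsub>S\<^esub> j) ((\<lambda>a. s \<cdot>\<^bsub>S\<^esub> a) ` A) \<and>
           is_lub (nat_order S) (j \<cdot>\<^bsub>S\<^esub> s) ((\<lambda>a. a \<cdot>\<^bsub>S\<^esub> s) ` A)))"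

section \<open>Boolean algebras and boolean inverse semigroups\<close>

definition distributive_lattice :: "'a gorder \<Rightarrow> bool" where
  "distributive_lattice L \<longleftrightarrow> lattice L \<and>
     (\<forall>x\<in>carrier L. \<forall>y\<in>carrier L. \<forall>z\<in>carrier L.
        x \<sqinter>\<^bsub>L\<^esub> (y \<squnion>\<^bsub>L\<^esub> z) = (x \<sqinter>\<^bsub>L\<^esub> y) \<squnion>\<^bsub>L\<^esub> (x \<sqinter>\<^bsub>L\<^esub> z))"

definition unital_boolean_algebra :: "'a gorder \<Rightarrow> bool" where
  "unital_boolean_algebra L \<longleftrightarrow> bounded_lattice L \<and> distributive_lattice L \<and>
     (\<forall>x\<in>carrier L. \<exists>y\<in>carrier L. x \<sqinter>\<^bsub>L\<^esub> y = \<bottom>\<^bsub>L\<^esub> \<and> x \<squnion>\<^bsub>L\<^esub> y = \<top>\<^bsub>L\<^esub>)"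

definition generalized_boolean_algebra :: "'a gorder \<Rightarrow> bool" where
  "generalized_boolean_algebra L \<longleftrightarrow> distributive_lattice L \<and> weak_partial_order_bottom L \<and>
     (\<forall>e\<in>carrier L. unital_boolean_algebra (L\<lparr>carrier := {x \<in> carrier L. x \<sqsubseteq>\<^bsub>L\<^esub> e}\<rparr>))"

definition boolean_inverse_semigroup :: "'a sgrp \<Rightarrow> bool" where
  "boolean_inverse_semigroup S \<longleftrightarrow> distributive_inverse_semigroup S \<and>
     generalized_boolean_algebra ((nat_order S)\<lparr>carrier := idems S\<rparr>) \<and>
     (\<forall>s\<in>carrier S. \<forall>t\<in>carrier S. \<exists>m. is_glb (nat_order S) m {s, t})"

definition proper_filter :: "'a sgrp \<Rightarrow> 'a set \<Rightarrow> bool" where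
  "proper_filter S F \<longleftrightarrow> F \<subseteq> carrier S \<and> F \<noteq> {} \<and>
     (\<forall>s\<in>F. \<forall>t\<in>carrier S. s \<sqsubseteq>\<^bsub>nat_order S\<^esub> t \<longrightarrow> t \<in> F) \<and>
     (\<forall>s\<in>F. \<forall>t\<in>F. \<exists>u\<in>F. u \<sqsubseteq>\<^bsub>nat_order S\<^esub> s \<and> u \<sqsubseteq>\<^bsub>nat_order S\<^esub> t) \<and>
     sg_zero S \<notin> F"

definition ultrafilters :: "'a sgrp \<Rightarrow> 'a set set" where
  "ultrafilters S = {F. proper_filter S F \<and> (\<forall>F'. proper_filter S F' \<and> F \<subseteq> F' \<longrightarrow> F' = F)}"

text \<open>
  Morphisms are extensional functions (undefined outside the carrier), so that equality of
  morphisms is equality of functions and composition is \<^const>\<open>compose\<close>.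
\<close>

definition bis_hom :: "'a sgrp \<Rightarrow> 'b sgrp \<Rightarrow> ('a \<Rightarrow> 'b) set" where
  "bis_hom S T = {\<theta> \<in> carrier S \<rightarrow>\<^sub>E carrier T.
     (\<forall>s\<in>carrier S. \<forall>t\<in>carrier S. \<theta> (s \<cdot>\<^bsub>S\<^esub> t) = \<theta> s \<cdot>\<^bsub>T\<^esub> \<theta> t) \<and>
     (\<forall>s\<in>carrier S. \<forall>t\<in>carrier S. \<forall>m. is_glb (nat_order S) m {s, t} \<longrightarrow>
        is_glb (nat_order T) (\<theta> m) {\<theta> s, \<theta> t}) \<and>
     (\<forall>s\<in>carrier S. \<forall>t\<in>carrier S. \<forall>j. compatible S s t \<and> is_lub (nat_order S) j {s, t} \<longrightarrow>
        is_lub (nat_order T) (\<theta> j) {\<theta> s, \<theta> t})}"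

definition callitic_hom :: "'a sgrp \<Rightarrow> 'b sgrp \<Rightarrow> ('a \<Rightarrow> 'b) set" where
  "callitic_hom S T = {\<theta> \<in> bis_hom S T.
     \<forall>F\<in>ultrafilters T. {s \<in> carrier S. \<theta> s \<in> F} \<in> ultrafilters S}"

definition callitic_iso :: "'a sgrp \<Rightarrow> 'b sgrp \<Rightarrow> ('a \<Rightarrow> 'b) set" where
  "callitic_iso S T = {\<theta> \<in> callitic_hom S T. \<exists>\<phi>\<in>callitic_hom T S.
     compose (carrier S) \<phi> \<theta> = (\<lambda>s\<in>carrier S. s) \<and>
     compose (carrier T) \<theta> \<phi> = (\<lambda>t\<in>carrier T. t)}"

section \<open>Boolean groupoids\<close>

text \<open>
  The arrows are the points of the topology. The multiplication is represented by a total
  function which is only meaningful on composable pairs, i.e. pairs \<open>(x, y)\<close> with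
  \<open>dom_of x = cod_of y\<close>.
\<close>

record 'a tgpd =
  gp_top :: "'a topology"
  gp_mult :: "'a \<Rightarrow> 'a \<Rightarrow> 'a"
  gp_inv :: "'a \<Rightarrow> 'a"

definition arrows :: "'a tgpd \<Rightarrow> 'a set" where
  "arrows G = topspace (gp_top G)"

definition dom_of :: "'a tgpd \<Rightarrow> 'a \<Rightarrow> 'a" where
  "dom_of G x = gp_mult G (gp_inv G x) x"

definition cod_of :: "'a tgpd \<Rightarrow> 'a \<Rightarrow> 'a" where
  "cod_of G x = gp_mult G x (gp_inv G x)"

definition identities :: "'a tgpd \<Rightarrow> 'a set" where
  "identities G = dom_of G ` arrows G"

definition composable :: "'a tgpd \<Rightarrow> ('a \<times> 'a) set" where
  "composable G = {(x, y). x \<in> arrows G \<and> y \<in> arrows G \<and> dom_of G x = cod_of G y}"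

definition groupoid :: "'a tgpd \<Rightarrow> bool" where
  "groupoid G \<longleftrightarrow>
     (\<forall>x\<in>arrows G. gp_inv G x \<in> arrows G \<and> gp_inv G (gp_inv G x) = x \<and>
        gp_mult G x (dom_of G x) = x \<and> gp_mult G (cod_of G x) x = x) \<and>
     (\<forall>(x, y)\<in>composable G. gp_mult G x y \<in> arrows G \<and>
        dom_of G (gp_mult G x y) = dom_of G y \<and> cod_of G (gp_mult G x y) = cod_of G x) \<and>
     (\<forall>x y z. (x, y) \<in> composable G \<and> (y, z) \<in> composable G \<longrightarrow>
        gp_mult G (gp_mult G x y) z = gp_mult G x (gp_mult G y z))"

definition topological_groupoid :: "'a tgpd \<Rightarrow> bool" where
  "topological_groupoid G \<longleftrightarrow> groupoid G \<and>
     continuous_map (gp_top G) (gp_top G) (gp_inv G) \<and>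
     continuous_map (subtopology (prod_topology (gp_top G) (gp_top G)) (composable G)) (gp_top G)
       (\<lambda>(x, y). gp_mult G x y)"

definition local_homeomorphism :: "'a topology \<Rightarrow> 'b topology \<Rightarrow> ('a \<Rightarrow> 'b) \<Rightarrow> bool" where
  "local_homeomorphism X Y f \<longleftrightarrow>
     (\<forall>x\<in>topspace X. \<exists>U. openin X U \<and> x \<in> U \<and> openin Y (f ` U) \<and>
        homeomorphic_map (subtopology X U) (subtopology Y (f ` U)) f)"

definition identity_space :: "'a tgpd \<Rightarrow> 'a topology" where
  "identity_space G = subtopology (gp_top G) (identities G)"

definition etale_groupoid :: "'a tgpd \<Rightarrow> bool" where
  "etale_groupoid G \<longleftrightarrow> topological_groupoid G \<and>
     local_homeomorphism (gp_top G) (identity_space G) (dom_of G)"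

definition gp_setmult :: "'a tgpd \<Rightarrow> 'a set \<Rightarrow> 'a set \<Rightarrow> 'a set" where
  "gp_setmult G A B = {gp_mult G x y |x y. x \<in> A \<and> y \<in> B \<and> (x, y) \<in> composable G}"

definition bisection :: "'a tgpd \<Rightarrow> 'a set \<Rightarrow> bool" where
  "bisection G A \<longleftrightarrow> A \<subseteq> arrows G \<and>
     gp_setmult G (gp_inv G ` A) A \<subseteq> identities G \<and> gp_setmult G A (gp_inv G ` A) \<subseteq> identities G"

definition compact_open :: "'a topology \<Rightarrow> 'a set \<Rightarrow> bool" where
  "compact_open X K \<longleftrightarrow> compactin X K \<and> openin X K"

definition boolean_space :: "'a topology \<Rightarrow> bool" where
  "boolean_space X \<longleftrightarrow> Hausdorff_space X \<and> openin X = arbitrary union_of compact_open X"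

definition boolean_groupoid :: "'a tgpd \<Rightarrow> bool" where
  "boolean_groupoid G \<longleftrightarrow> etale_groupoid G \<and> Hausdorff_space (gp_top G) \<and>
     openin (gp_top G) = arbitrary union_of (\<lambda>B. compact_open (gp_top G) B \<and> bisection G B) \<and>
     boolean_space (identity_space G)"

definition gp_functor :: "'a tgpd \<Rightarrow> 'b tgpd \<Rightarrow> ('a \<Rightarrow> 'b) \<Rightarrow> bool" where
  "gp_functor G H \<alpha> \<longleftrightarrow> \<alpha> \<in> arrows G \<rightarrow> arrows H \<and>
     (\<forall>x\<in>arrows G. \<alpha> (dom_of G x) = dom_of H (\<alpha> x) \<and> \<alpha> (cod_of G x) = cod_of H (\<alpha> x)) \<and>
     (\<forall>(x, y)\<in>composable G. \<alpha> (gp_mult G x y) = gp_mult H (\<alpha> x) (\<alpha> y))"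

definition covering_functor :: "'a tgpd \<Rightarrow> 'b tgpd \<Rightarrow> ('a \<Rightarrow> 'b) \<Rightarrow> bool" where
  "covering_functor G H \<alpha> \<longleftrightarrow> gp_functor G H \<alpha> \<and>
     (\<forall>g\<in>arrows G. \<forall>g'\<in>arrows G. dom_of G g = dom_of G g' \<and> \<alpha> g = \<alpha> g' \<longrightarrow> g = g') \<and>
     (\<forall>e\<in>identities G. \<forall>h\<in>arrows H. \<alpha> e = dom_of H h \<longrightarrow>
        (\<exists>g\<in>arrows G. dom_of G g = e \<and> \<alpha> g = h))"

text \<open>
  The properness condition is spelled out, because the library's \<^const>\<open>proper_map\<close> is
  defined differently (closed with compact fibres).
\<close>

definition covering_hom :: "'a tgpd \<Rightarrow> 'b tgpd \<Rightarrow> ('a \<Rightarrow> 'b) set" where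
  "covering_hom G H = {\<alpha> \<in> arrows G \<rightarrow>\<^sub>E arrows H. covering_functor G H \<alpha> \<and>
     continuous_map (gp_top G) (gp_top H) \<alpha> \<and>
     (\<forall>C. compactin (gp_top H) C \<longrightarrow> compactin (gp_top G) {x \<in> arrows G. \<alpha> x \<in> C})}"

definition covering_iso :: "'a tgpd \<Rightarrow> 'b tgpd \<Rightarrow> ('a \<Rightarrow> 'b) set" where
  "covering_iso G H = {\<alpha> \<in> covering_hom G H. \<exists>\<beta>\<in>covering_hom H G.
     compose (arrows G) \<beta> \<alpha> = (\<lambda>g\<in>arrows G. g) \<and>
     compose (arrows H) \<alpha> \<beta> = (\<lambda>h\<in>arrows H. h)}"

section \<open>The two contravariant functors\<close>

text \<open>
  Both functors change the type of the underlying set, and HOL has no single type that is closed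
  under both. Hence the two categories range over carriers in all types: the functors are
  polymorphic constants, and hom-sets are defined between objects over different types.
\<close>

text \<open>
  The groupoid of ultrafilters: the product of composable \<open>A\<close> and \<open>B\<close> is the upward closure of
  \<open>AB\<close>, and the sets of all ultrafilters containing a given element generate the topology.
\<close>

definition ultra_nhd :: "'a sgrp \<Rightarrow> 'a \<Rightarrow> 'a set set" where
  "ultra_nhd S s = {A \<in> ultrafilters S. s \<in> A}"

definition ultra_gpd :: "'a sgrp \<Rightarrow> 'a set tgpd" where
  "ultra_gpd S =
    \<lparr>gp_top = topology_generated_by (ultra_nhd S ` carrier S),
     gp_mult = (\<lambda>A B. {u \<in> carrier S. \<exists>a\<in>A. \<exists>b\<in>B. a \<cdot>\<^bsub>S\<^esub> b \<sqsubseteq>\<^bsub>nat_order S\<^esub> u}),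
     gp_inv = (\<lambda>A. sg_inv S ` A)\<rparr>"

definition ultra_map :: "'a sgrp \<Rightarrow> 'b sgrp \<Rightarrow> ('a \<Rightarrow> 'b) \<Rightarrow> 'b set \<Rightarrow> 'a set" where
  "ultra_map S T \<theta> = (\<lambda>F\<in>ultrafilters T. {s \<in> carrier S. \<theta> s \<in> F})"

definition bisection_sgrp :: "'a tgpd \<Rightarrow> 'a set sgrp" where
  "bisection_sgrp G =
    \<lparr>carrier = {B. compact_open (gp_top G) B \<and> bisection G B}, sg_mult = gp_setmult G\<rparr>"

definition bisection_map :: "'a tgpd \<Rightarrow> 'b tgpd \<Rightarrow> ('a \<Rightarrow> 'b) \<Rightarrow> 'b set \<Rightarrow> 'a set" where
  "bisection_map G H \<alpha> = (\<lambda>B\<in>carrier (bisection_sgrp H). {g \<in> arrows G. \<alpha> g \<in> B})"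

text \<open>The components of the natural isomorphisms from the identity functors to the composites.\<close>

definition bis_unit :: "'a sgrp \<Rightarrow> 'a \<Rightarrow> 'a set set" where
  "bis_unit S = (\<lambda>s\<in>carrier S. ultra_nhd S s)"

definition gpd_unit :: "'a tgpd \<Rightarrow> 'a \<Rightarrow> 'a set set" where
  "gpd_unit G = (\<lambda>g\<in>arrows G. {B \<in> carrier (bisection_sgrp G). g \<in> B})"

end

theory Submission
  imports Defs
begin

text \<open>
  Stone duality, non-commutatively. In a boolean inverse semigroup \<open>S\<close> every ultrafilter is of the
  form \<open>A = (s A\<^sup>-\<^sup>1 A)\<^sup>\<up>\<close> for any \<open>s \<in> A\<close>, so on the set \<open>U\<^sub>s\<close> of ultrafilters containing \<open>s\<close> the
  domain map is a bijection onto \<open>U\<^sub>e\<close> with \<open>e = s\<^sup>-\<^sup>1 s\<close>; this makes the ultrafilters an etale groupoid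
  with basis the bisections \<open>U\<^sub>s\<close>. Relative complements make the \<open>U\<^sub>s\<close> compact, ultrafilters are prime
  and separate elements, and hence \<open>s \<mapsto> U\<^sub>s\<close> is an isomorphism onto the compact-open bisections.
  Conversely, compactness forces every ultrafilter of compact-open bisections of a boolean
  groupoid to consist of the bisections through one arrow. Callitic morphisms and proper covering
  functors correspond because both act by taking inverse images.
\<close>

text \<open>Two facts carry the algebraic side. An element outside an ultrafilter has zero meet with
  some member of it; from this come primeness, Hausdorffness of the whole arrow space, and, with
  relative complements, the fact that ultrafilters detect the order. This is where binary meets
  enter. Secondly, a product of composable ultrafilters \<open>A\<close>, \<open>B\<close> is the
  translate of \<open>B\<close> by any single element of \<open>A\<close>, so closure of the
  ultrafilters under the product reduces to translation.

  Joins exist only for compatible elements; on the groupoid side compatibility of two bisections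
  means that their union is again a bisection.

  The clauses of a covering functor are matched to inverse images: uniqueness of lifts makes the
  preimage of a bisection a bisection, existence of lifts makes preimages commute with products,
  properness keeps them compact. In the other direction the preimage of an ultrafilter under a
  morphism may even be empty, and the callitic condition is what makes the dual map well defined. It
  respects products because inclusion between ultrafilters is equality.\<close>

lemma le_nat_order: "s \<sqsubseteq>\<^bsub>nat_order S\<^esub> t \<longleftrightarrow> (\<exists>e\<in>idems S. s = t \<cdot>\<^bsub>S\<^esub> e)"
  by (simp add: nat_order_def)

lemma carrier_nat_order [simp]: "carrier (nat_order S) = carrier S"
  by (simp add: nat_order_def)

lemma eq_nat_order [simp]: "eq (nat_order S) = (=)"
  by (simp add: nat_order_def)

lemma is_lub_iff:
  assumes "A \<subseteq> carrier L"
  shows "is_lub L j A \<longleftrightarrow> j \<in> carrier L \<and> (\<forall>a\<in>A. a \<sqsubseteq>\<^bsub>L\<^esub> j) \<and>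
    (\<forall>u\<in>carrier L. (\<forall>a\<in>A. a \<sqsubseteq>\<^bsub>L\<^esub> u) \<longrightarrow> j \<sqsubseteq>\<^bsub>L\<^esub> u)"
  using assms unfolding least_def Upper_def by blast

lemma is_glb_iff:
  assumes "A \<subseteq> carrier L"
  shows "is_glb L m A \<longleftrightarrow> m \<in> carrier L \<and> (\<forall>a\<in>A. m \<sqsubseteq>\<^bsub>L\<^esub> a) \<and>
    (\<forall>u\<in>carrier L. (\<forall>a\<in>A. u \<sqsubseteq>\<^bsub>L\<^esub> a) \<longrightarrow> u \<sqsubseteq>\<^bsub>L\<^esub> m)"
  using assms unfolding greatest_def Lower_def by blast

section \<open>Inverse semigroups\<close>

locale inv_sgrp =
  fixes S :: "'a sgrp" (structure)
  assumes inverse_semigroup: "inverse_semigroup S"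
begin

abbreviation star :: "'a \<Rightarrow> 'a" (\<open>_\<dagger>\<close> [1000] 1000) where
  "s\<dagger> \<equiv> sg_inv S s"

abbreviation ord :: "'a \<Rightarrow> 'a \<Rightarrow> bool" (infix \<open>\<preceq>\<close> 50) where
  "s \<preceq> t \<equiv> s \<sqsubseteq>\<^bsub>nat_order S\<^esub> t"

lemma mult_closed [simp, intro]: "s \<in> carrier S \<Longrightarrow> t \<in> carrier S \<Longrightarrow> s \<cdot> t \<in> carrier S"
  using inverse_semigroup unfolding inverse_semigroup_def by blast

lemma assoc:
  "s \<in> carrier S \<Longrightarrow> t \<in> carrier S \<Longrightarrow> u \<in> carrier S \<Longrightarrow> (s \<cdot> t) \<cdot> u = s \<cdot> (t \<cdot> u)"
  using inverse_semigroup unfolding inverse_semigroup_def by blast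

lemma ex1_inv: "s \<in> carrier S \<Longrightarrow> \<exists>!t. t \<in> carrier S \<and> s \<cdot> t \<cdot> s = s \<and> t \<cdot> s \<cdot> t = t"
  using inverse_semigroup unfolding inverse_semigroup_def by (elim conjE) (rule bspec)

lemma sg_inv_props:
  "s \<in> carrier S \<Longrightarrow> s\<dagger> \<in> carrier S \<and> s \<cdot> s\<dagger> \<cdot> s = s \<and> s\<dagger> \<cdot> s \<cdot> s\<dagger> = s\<dagger>"
  unfolding sg_inv_def by (rule theI'[OF ex1_inv])

lemma inv_closed [simp, intro]: "s \<in> carrier S \<Longrightarrow> s\<dagger> \<in> carrier S"
  using sg_inv_props by blast

lemma inv_unique:
  "s \<in> carrier S \<Longrightarrow> t \<in> carrier S \<Longrightarrow> s \<cdot> t \<cdot> s = s \<Longrightarrow> t \<cdot> s \<cdot> t = t \<Longrightarrow> s\<dagger> = t"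
  unfolding sg_inv_def by (rule the1_equality[OF ex1_inv]) auto

lemma mult_inv_mult [simp]: "s \<in> carrier S \<Longrightarrow> s \<cdot> (s\<dagger> \<cdot> s) = s"
  and inv_mult_inv [simp]: "s \<in> carrier S \<Longrightarrow> s\<dagger> \<cdot> (s \<cdot> s\<dagger>) = s\<dagger>"
  using sg_inv_props[of s] by (auto simp: assoc)

lemma mult_inv_mult_left [simp]:
    "s \<in> carrier S \<Longrightarrow> t \<in> carrier S \<Longrightarrow> s \<cdot> (s\<dagger> \<cdot> (s \<cdot> t)) = s \<cdot> t"
  and inv_mult_inv_left [simp]:
    "s \<in> carrier S \<Longrightarrow> t \<in> carrier S \<Longrightarrow> s\<dagger> \<cdot> (s \<cdot> (s\<dagger> \<cdot> t)) = s\<dagger> \<cdot> t"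
  using mult_inv_mult[of s] inv_mult_inv[of s] by (simp_all flip: assoc)

lemma inv_inv [simp]: "s \<in> carrier S \<Longrightarrow> s\<dagger>\<dagger> = s"
  by (rule inv_unique) (auto simp: assoc)

lemma idemI: "e \<in> carrier S \<Longrightarrow> e \<cdot> e = e \<Longrightarrow> e \<in> idems S"
  by (simp add: idems_def)

lemma idem_carrier [simp]: "e \<in> idems S \<Longrightarrow> e \<in> carrier S"
  and idem_mult [simp]: "e \<in> idems S \<Longrightarrow> e \<cdot> e = e"
  by (auto simp: idems_def)

lemma idem_mult_left [simp]: "e \<in> idems S \<Longrightarrow> t \<in> carrier S \<Longrightarrow> e \<cdot> (e \<cdot> t) = e \<cdot> t"
  by (metis assoc idem_carrier idem_mult)

lemma idem_inv [simp]: "e \<in> idems S \<Longrightarrow> e\<dagger> = e"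
  by (rule inv_unique) auto

text \<open>With \<open>x\<close> the inverse of \<open>e \<cdot> f\<close>, the element
  \<open>f \<cdot> (x \<cdot> e)\<close> is an inverse of \<open>e \<cdot> f\<close> as well.
  Uniqueness gives \<open>x = f \<cdot> (x \<cdot> e)\<close>, which forces \<open>x\<close> to be
  idempotent. An idempotent is its own inverse, so \<open>e \<cdot> f\<close> equals
  \<open>x\<close>.\<close>

lemma idem_mult_idem:
  assumes e: "e \<in> idems S" and f: "f \<in> idems S"
  shows "e \<cdot> f \<in> idems S"
proof -
  define x where "x = (e \<cdot> f)\<dagger>"
  have [simp]: "e \<in> carrier S" "f \<in> carrier S" "x \<in> carrier S"
    using e f by (auto simp: x_def)
  have x1: "e \<cdot> (f \<cdot> (x \<cdot> (e \<cdot> f))) = e \<cdot> f" and x2: "x \<cdot> (e \<cdot> (f \<cdot> x)) = x"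
    using sg_inv_props[of "e \<cdot> f"] by (auto simp: x_def[symmetric] assoc)
  have x3: "x \<cdot> (e \<cdot> (f \<cdot> (x \<cdot> u))) = x \<cdot> u" if "u \<in> carrier S" for u
  proof -
    have "x \<cdot> (e \<cdot> (f \<cdot> x)) \<cdot> u = x \<cdot> u" by (simp only: x2)
    then show ?thesis using that by (simp add: assoc)
  qed
  have "(e \<cdot> f)\<dagger> = f \<cdot> (x \<cdot> e)"
    using e f by (intro inv_unique) (auto simp: assoc x1 x3)
  then have fxe: "x = f \<cdot> (x \<cdot> e)" by (simp add: x_def)
  have "x \<cdot> x = (f \<cdot> (x \<cdot> e)) \<cdot> (f \<cdot> (x \<cdot> e))" by (simp only: fxe[symmetric])
  also have "\<dots> = f \<cdot> (x \<cdot> e)" by (simp add: assoc x3)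
  finally have "x \<cdot> x = x" by (simp only: fxe[symmetric])
  then have "x \<in> idems S" by (intro idemI) simp_all
  then have "x\<dagger> = x" by simp
  then have "e \<cdot> f = x" by (simp add: x_def)
  then show ?thesis using \<open>x \<in> idems S\<close> by simp
qed

text \<open>Since both products are idempotent, \<open>f \<cdot> e\<close> is an inverse of
  \<open>e \<cdot> f\<close>; but the idempotent \<open>e \<cdot> f\<close> is also its own
  inverse.\<close>

lemma idem_commute:
  assumes e: "e \<in> idems S" and f: "f \<in> idems S"
  shows "e \<cdot> f = f \<cdot> e"
proof -
  have ef: "e \<cdot> f \<in> idems S" and fe: "f \<cdot> e \<in> idems S" using e f idem_mult_idem by auto
  have [simp]: "e \<in> carrier S" "f \<in> carrier S" using e f by auto
  have ef': "e \<cdot> (f \<cdot> (e \<cdot> f)) = e \<cdot> f" and fe': "f \<cdot> (e \<cdot> (f \<cdot> e)) = f \<cdot> e"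
    using idem_mult[OF ef] idem_mult[OF fe] by (auto simp: assoc)
  have "(e \<cdot> f)\<dagger> = f \<cdot> e"
    using e f ef' fe' by (intro inv_unique) (auto simp: assoc)
  then show ?thesis using ef by simp
qed

lemma inv_mult_idem [simp]: "s \<in> carrier S \<Longrightarrow> s\<dagger> \<cdot> s \<in> idems S"
  and mult_inv_idem [simp]: "s \<in> carrier S \<Longrightarrow> s \<cdot> s\<dagger> \<in> idems S"
  by (rule idemI; simp add: assoc)+

text \<open>In both inverse equations the idempotents \<open>s\<dagger> \<cdot> s\<close> and
  \<open>t \<cdot> t\<dagger>\<close> meet in the middle in the wrong order; swapping them by
  \<open>c\<close> lets everything cancel.\<close>

lemma mult_inv:
  assumes s: "s \<in> carrier S" and t: "t \<in> carrier S"
  shows "(s \<cdot> t)\<dagger> = t\<dagger> \<cdot> s\<dagger>"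
proof -
  have c: "t \<cdot> t\<dagger> \<cdot> (s\<dagger> \<cdot> s) = s\<dagger> \<cdot> s \<cdot> (t \<cdot> t\<dagger>)"
    by (rule idem_commute) (use s t in auto)
  have "s \<cdot> t \<cdot> (t\<dagger> \<cdot> s\<dagger>) \<cdot> (s \<cdot> t) = s \<cdot> (t \<cdot> t\<dagger> \<cdot> (s\<dagger> \<cdot> s)) \<cdot> t"
    using s t by (simp add: assoc)
  also have "\<dots> = s \<cdot> t" unfolding c using s t by (simp add: assoc)
  finally have 1: "s \<cdot> t \<cdot> (t\<dagger> \<cdot> s\<dagger>) \<cdot> (s \<cdot> t) = s \<cdot> t" .
  have "t\<dagger> \<cdot> s\<dagger> \<cdot> (s \<cdot> t) \<cdot> (t\<dagger> \<cdot> s\<dagger>) = t\<dagger> \<cdot> (s\<dagger> \<cdot> s \<cdot> (t \<cdot> t\<dagger>)) \<cdot> s\<dagger>"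
    using s t by (simp add: assoc)
  also have "\<dots> = t\<dagger> \<cdot> s\<dagger>" unfolding c[symmetric] using s t by (simp add: assoc)
  finally show ?thesis using s t 1 by (intro inv_unique) auto
qed

lemma conj_idem: "s \<in> carrier S \<Longrightarrow> e \<in> idems S \<Longrightarrow> s\<dagger> \<cdot> (e \<cdot> s) \<in> idems S"
proof -
  assume s: "s \<in> carrier S" and e: "e \<in> idems S"
  have c: "s \<cdot> s\<dagger> \<cdot> e = e \<cdot> (s \<cdot> s\<dagger>)" by (rule idem_commute) (use s e in auto)
  have "s\<dagger> \<cdot> (e \<cdot> s) \<cdot> (s\<dagger> \<cdot> (e \<cdot> s)) = s\<dagger> \<cdot> e \<cdot> (s \<cdot> s\<dagger> \<cdot> e) \<cdot> s"
    using s e by (simp add: assoc)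
  also have "\<dots> = s\<dagger> \<cdot> (e \<cdot> s)" unfolding c using s e by (simp add: assoc)
  finally show ?thesis using s e by (intro idemI) simp_all
qed

text \<open>The existential idempotent in the natural order can be replaced by the canonical one,
  the domain idempotent of the smaller element.\<close>

lemma ord_iff_right:
  assumes "s \<in> carrier S" "t \<in> carrier S"
  shows "s \<preceq> t \<longleftrightarrow> s = t \<cdot> (s\<dagger> \<cdot> s)"
proof
  assume "s \<preceq> t"
  then obtain e where e: "e \<in> idems S" and s: "s = t \<cdot> e" by (auto simp: le_nat_order)
  have c: "t\<dagger> \<cdot> t \<cdot> e = e \<cdot> (t\<dagger> \<cdot> t)" by (rule idem_commute) (use assms e in auto)
  have "t \<cdot> (s\<dagger> \<cdot> s) = t \<cdot> (e \<cdot> (t\<dagger> \<cdot> t) \<cdot> e)"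
    using assms e by (simp add: s mult_inv assoc)
  also have "\<dots> = s" unfolding c[symmetric] using assms e by (simp add: assoc s)
  finally show "s = t \<cdot> (s\<dagger> \<cdot> s)" by simp
next
  assume "s = t \<cdot> (s\<dagger> \<cdot> s)"
  then show "s \<preceq> t" unfolding le_nat_order using assms by (intro bexI[of _ "s\<dagger> \<cdot> s"]) simp_all
qed

lemma ordI_right: "t \<in> carrier S \<Longrightarrow> e \<in> idems S \<Longrightarrow> t \<cdot> e \<preceq> t"
  by (auto simp: le_nat_order)

text \<open>A left idempotent factor moves to the right after conjugation:
  \<open>e \<cdot> t = t \<cdot> (t\<dagger> \<cdot> e \<cdot> t)\<close>. This makes the natural
  order left-right symmetric.\<close>

lemma ordI_left:
  assumes t: "t \<in> carrier S" and e: "e \<in> idems S"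
  shows "e \<cdot> t \<preceq> t"
proof -
  have c: "t \<cdot> t\<dagger> \<cdot> e = e \<cdot> (t \<cdot> t\<dagger>)" by (rule idem_commute) (use assms e in auto)
  have "t \<cdot> (t\<dagger> \<cdot> (e \<cdot> t)) = (t \<cdot> t\<dagger> \<cdot> e) \<cdot> t" using t e by (simp add: assoc)
  also have "\<dots> = e \<cdot> t" unfolding c using t e by (simp add: assoc)
  finally show ?thesis using ordI_right[OF t conj_idem[OF t e]] by simp
qed

lemma ord_iff_left:
  assumes s: "s \<in> carrier S" and t: "t \<in> carrier S"
  shows "s \<preceq> t \<longleftrightarrow> s = s \<cdot> s\<dagger> \<cdot> t"
proof
  assume "s \<preceq> t"
  then obtain e where e: "e \<in> idems S" and s: "s = t \<cdot> e" by (auto simp: le_nat_order)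
  have c: "e \<cdot> (t\<dagger> \<cdot> t) = t\<dagger> \<cdot> t \<cdot> e" by (rule idem_commute) (use assms e in auto)
  have "s \<cdot> s\<dagger> \<cdot> t = t \<cdot> (e \<cdot> (t\<dagger> \<cdot> t))"
    using assms e by (simp add: s mult_inv assoc)
  also have "\<dots> = s" unfolding c using assms e by (simp add: assoc s)
  finally show "s = s \<cdot> s\<dagger> \<cdot> t" by simp
next
  assume eq: "s = s \<cdot> s\<dagger> \<cdot> t"
  have "s \<cdot> s\<dagger> \<cdot> t \<preceq> t" using ordI_left assms by simp
  then show "s \<preceq> t" by (simp only: eq[symmetric])
qed

lemma ord_refl [simp]: "s \<in> carrier S \<Longrightarrow> s \<preceq> s"
  by (simp add: ord_iff_right)

lemma ord_carrier: "s \<preceq> t \<Longrightarrow> t \<in> carrier S \<Longrightarrow> s \<in> carrier S"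
  by (auto simp: le_nat_order)

lemma ord_trans:
  assumes "s \<preceq> t" "t \<preceq> u" "u \<in> carrier S"
  shows "s \<preceq> u"
proof -
  obtain e f where ef: "e \<in> idems S" "f \<in> idems S" and "s = t \<cdot> e" "t = u \<cdot> f"
    using assms by (auto simp: le_nat_order)
  then have "s = u \<cdot> (f \<cdot> e)" using assms by (simp add: assoc)
  then show ?thesis using ef idem_mult_idem by (auto simp: le_nat_order)
qed

text \<open>Each element is the other one cut down by a domain idempotent. Since these idempotents
  commute, cutting \<open>t\<close> by the domain of \<open>s\<close> is the same as cutting
  \<open>s\<close> by the domain of \<open>t\<close>.\<close>

lemma ord_antisym:
  assumes "s \<preceq> t" "t \<preceq> s" "s \<in> carrier S" "t \<in> carrier S"
  shows "s = t"
proof -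
  have 1: "s = t \<cdot> (s\<dagger> \<cdot> s)" and 2: "t = s \<cdot> (t\<dagger> \<cdot> t)"
    using assms ord_iff_right by blast+
  have c: "t\<dagger> \<cdot> t \<cdot> (s\<dagger> \<cdot> s) = s\<dagger> \<cdot> s \<cdot> (t\<dagger> \<cdot> t)" by (rule idem_commute) (use assms in auto)
  have "t \<cdot> (s\<dagger> \<cdot> s) = t \<cdot> (t\<dagger> \<cdot> t \<cdot> (s\<dagger> \<cdot> s))" using assms by (simp add: assoc)
  also have "\<dots> = t \<cdot> (s\<dagger> \<cdot> s) \<cdot> (t\<dagger> \<cdot> t)" unfolding c using assms by (simp add: assoc)
  also have "\<dots> = t" by (simp only: 1[symmetric] 2[symmetric])
  finally show ?thesis by (simp only: 1[symmetric])
qed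

lemma inv_mono:
  assumes "s \<preceq> t" "t \<in> carrier S"
  shows "s\<dagger> \<preceq> t\<dagger>"
proof -
  obtain e where e: "e \<in> idems S" and s: "s = t \<cdot> e" using assms by (auto simp: le_nat_order)
  then have "s\<dagger> = e \<cdot> t\<dagger>" using assms by (simp add: mult_inv)
  then show ?thesis using ordI_left e assms by auto
qed

lemma mult_mono_ord:
  assumes "s \<preceq> s'" "t \<preceq> t'" "s' \<in> carrier S" "t' \<in> carrier S"
  shows "s \<cdot> t \<preceq> s' \<cdot> t'"
proof -
  have [simp]: "s \<in> carrier S" "t \<in> carrier S" using assms ord_carrier by auto
  obtain e where e: "e \<in> idems S" and t: "t = t' \<cdot> e" using assms by (auto simp: le_nat_order)
  \<comment> \<open>The two factors are written with their idempotents on opposite outer sides,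
    \<open>s\<close> as a left and \<open>t\<close> as a right restriction, so that no idempotent is
    caught in the middle of the product.\<close>
  have s: "s = s \<cdot> s\<dagger> \<cdot> s'" by (rule ord_iff_left[THEN iffD1]) (use assms in simp_all)
  have "s \<cdot> t = s \<cdot> s\<dagger> \<cdot> s' \<cdot> t" by (simp only: s[symmetric])
  also have "\<dots> = s \<cdot> s\<dagger> \<cdot> (s' \<cdot> t' \<cdot> e)" using assms e by (simp add: assoc t)
  finally have eq: "s \<cdot> t = s \<cdot> s\<dagger> \<cdot> (s' \<cdot> t' \<cdot> e)" .
  have "\<dots> \<preceq> s' \<cdot> t' \<cdot> e" using assms e by (intro ordI_left) auto
  moreover have "s' \<cdot> t' \<cdot> e \<preceq> s' \<cdot> t'" using assms e by (intro ordI_right) auto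
  ultimately have "s \<cdot> s\<dagger> \<cdot> (s' \<cdot> t' \<cdot> e) \<preceq> s' \<cdot> t'" using ord_trans assms by blast
  then show ?thesis by (simp only: eq)
qed

lemma ord_idem:
  assumes "s \<preceq> e" "e \<in> idems S"
  shows "s \<in> idems S"
  using assms idem_mult_idem by (auto simp: le_nat_order)

text \<open>Both test products lie below \<open>u\<dagger> \<cdot> u\<close> and
  \<open>u \<cdot> u\<dagger>\<close>, and whatever lies below an idempotent is idempotent. So any
  two elements with a common upper bound have a join.\<close>

lemma compatible_below:
  assumes "s \<preceq> u" "t \<preceq> u" "u \<in> carrier S"
  shows "compatible S s t"
proof -
  have [simp]: "s \<in> carrier S" "t \<in> carrier S" using assms ord_carrier by auto
  have "s\<dagger> \<cdot> t \<preceq> u\<dagger> \<cdot> u" "s \<cdot> t\<dagger> \<preceq> u \<cdot> u\<dagger>"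
    using assms by (auto intro!: mult_mono_ord inv_mono)
  then show ?thesis using ord_idem assms unfolding compatible_def by auto
qed

lemma compatible_sym:
  assumes "compatible S s t" "s \<in> carrier S" "t \<in> carrier S"
  shows "compatible S t s"
proof -
  have "t\<dagger> \<cdot> s = (s\<dagger> \<cdot> t)\<dagger>" "t \<cdot> s\<dagger> = (s \<cdot> t\<dagger>)\<dagger>"
    using assms by (simp_all add: mult_inv)
  then show ?thesis using assms idem_inv unfolding compatible_def by simp
qed

lemma compatible_refl: "s \<in> carrier S \<Longrightarrow> compatible S s s"
  by (simp add: compatible_def)

lemma compatible_pair:
  "compatible S s t \<Longrightarrow> s \<in> carrier S \<Longrightarrow> t \<in> carrier S \<Longrightarrow> compatible_subset S {s, t}"
  using compatible_sym compatible_refl by (auto simp: compatible_subset_def)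

lemma is_lub_unique:
  "is_lub (nat_order S) j A \<Longrightarrow> is_lub (nat_order S) j' A \<Longrightarrow> j = j'"
  unfolding least_def by (auto intro!: ord_antisym)

lemma is_glb_unique:
  "is_glb (nat_order S) j A \<Longrightarrow> is_glb (nat_order S) j' A \<Longrightarrow> j = j'"
  unfolding greatest_def by (auto intro!: ord_antisym)

end

section \<open>Boolean inverse semigroups and their ultrafilters\<close>

locale bis = inv_sgrp +
  assumes boolean_inverse_semigroup: "boolean_inverse_semigroup S"

lemma bisI: "boolean_inverse_semigroup S \<Longrightarrow> bis S"
  by unfold_locales
    (auto simp: boolean_inverse_semigroup_def distributive_inverse_semigroup_def)

context bis
begin

lemma distributive: "distributive_inverse_semigroup S"
  using boolean_inverse_semigroup by (simp add: boolean_inverse_semigroup_def)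

lemma join_exists:
  "finite A \<Longrightarrow> compatible_subset S A \<Longrightarrow> \<exists>j. is_lub (nat_order S) j A"
  using distributive by (simp add: distributive_inverse_semigroup_def)

lemma join_mult:
  assumes "finite A" "compatible_subset S A" "is_lub (nat_order S) j A" "s \<in> carrier S"
  shows "is_lub (nat_order S) (s \<cdot> j) ((\<lambda>a. s \<cdot> a) ` A)"
    and "is_lub (nat_order S) (j \<cdot> s) ((\<lambda>a. a \<cdot> s) ` A)"
  using distributive assms unfolding distributive_inverse_semigroup_def by blast+

lemma meet_exists:
  "s \<in> carrier S \<Longrightarrow> t \<in> carrier S \<Longrightarrow>
    \<exists>m\<in>carrier S. m \<preceq> s \<and> m \<preceq> t \<and> (\<forall>u\<in>carrier S. u \<preceq> s \<and> u \<preceq> t \<longrightarrow> u \<preceq> m)"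
  using boolean_inverse_semigroup is_glb_iff[of "{s, t}" "nat_order S"]
  by (simp add: boolean_inverse_semigroup_def) blast

abbreviation zero :: 'a (\<open>\<zero>\<close>) where "\<zero> \<equiv> sg_zero S"

text \<open>The witness is the join of the empty set. Distributivity applied to this empty join
  shows that every multiple of it is again the empty join, so the least element is
  absorbing.\<close>

lemma ex_zero: "\<exists>z\<in>carrier S. (\<forall>s\<in>carrier S. z \<preceq> s) \<and> (\<forall>s\<in>carrier S. z \<cdot> s = z \<and> s \<cdot> z = z)"
proof -
  have c: "compatible_subset S {}" by (simp add: compatible_subset_def)
  then obtain z where z: "is_lub (nat_order S) z {}" using join_exists by blast
  have "z \<cdot> s = z \<and> s \<cdot> z = z" if "s \<in> carrier S" for s
    using join_mult[OF finite.emptyI c z that] is_lub_unique[OF _ z] unfolding image_empty by blast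
  then show ?thesis using z by (intro bexI[of _ z]) (simp_all add: least_def)
qed

lemma sg_zero_eqI:
  assumes "z \<in> carrier S" "\<And>s. s \<in> carrier S \<Longrightarrow> z \<cdot> s = z" "\<And>s. s \<in> carrier S \<Longrightarrow> s \<cdot> z = z"
  shows "\<zero> = z"
  unfolding sg_zero_def
proof (rule the_equality)
  fix w assume "w \<in> carrier S \<and> (\<forall>s\<in>carrier S. w \<cdot> s = w \<and> s \<cdot> w = w)"
  then show "w = z" using assms(1) assms(3)[of w] by metis
qed (use assms in auto)

lemma zero_closed [simp, intro]: "\<zero> \<in> carrier S"
  and zero_least [simp]: "s \<in> carrier S \<Longrightarrow> \<zero> \<preceq> s"
  and zero_mult [simp]: "s \<in> carrier S \<Longrightarrow> \<zero> \<cdot> s = \<zero>"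
  and mult_zero [simp]: "s \<in> carrier S \<Longrightarrow> s \<cdot> \<zero> = \<zero>"
  using ex_zero sg_zero_eqI by auto

lemma below_zero: "s \<preceq> \<zero> \<Longrightarrow> s = \<zero>"
  by (meson ord_antisym ord_carrier zero_closed zero_least)

lemma zero_idem: "\<zero> \<in> idems S"
  by (rule idemI) auto

lemma zero_if_dom_zero: "s \<in> carrier S \<Longrightarrow> s\<dagger> \<cdot> s = \<zero> \<Longrightarrow> s = \<zero>"
  by (metis mult_inv_mult mult_zero)

text \<open>Translates the abstract complement in the principal ideal \<open>L\<close> into
  statements about \<open>S\<close>: the bottom of \<open>L\<close> is zero, its top is
  \<open>e\<close>, and the product \<open>f \<cdot> g\<close> is a lower bound of both
  factors.\<close>

lemma ex_idem_complement:
  assumes e: "e \<in> idems S" and f: "f \<in> idems S" and fe: "f \<preceq> e"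
  shows "\<exists>g\<in>idems S. g \<preceq> e \<and> f \<cdot> g = \<zero> \<and> is_lub (nat_order S) e {f, g}"
proof -
  define L where "L = (nat_order S)\<lparr>carrier := {x \<in> idems S. x \<preceq> e}\<rparr>"
  have [simp]: "carrier L = {x \<in> idems S. x \<preceq> e}" "le L = le (nat_order S)"
    by (simp_all add: L_def)
  have "unital_boolean_algebra L"
    using boolean_inverse_semigroup e
    unfolding boolean_inverse_semigroup_def generalized_boolean_algebra_def by (simp add: L_def)
  then interpret L: bounded_lattice L
    by (simp add: unital_boolean_algebra_def)
  obtain g where g: "g \<in> idems S" "g \<preceq> e" and fg: "f \<sqinter>\<^bsub>L\<^esub> g = \<bottom>\<^bsub>L\<^esub>" "f \<squnion>\<^bsub>L\<^esub> g = \<top>\<^bsub>L\<^esub>"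
    using \<open>unital_boolean_algebra L\<close> f fe by (auto simp: unital_boolean_algebra_def)
  have z: "\<zero> \<in> carrier L" using zero_idem e by auto
  have bot: "\<bottom>\<^bsub>L\<^esub> = \<zero>"
    using L.bottom_eq[of \<zero>] z by auto
  have top: "\<top>\<^bsub>L\<^esub> = e"
    using L.top_eq[of e] e by auto
  have "f \<cdot> g \<preceq> f" "f \<cdot> g \<preceq> g" using f g ordI_left ordI_right by auto
  moreover have "f \<cdot> g \<in> carrier L"
    using f g fe e idem_mult_idem ord_trans[OF \<open>f \<cdot> g \<preceq> f\<close> fe] by auto
  ultimately have "f \<cdot> g \<preceq> f \<sqinter>\<^bsub>L\<^esub> g"
    using f fe g L.meet_le[of "f \<cdot> g" f g] by simp
  then have 1: "f \<cdot> g = \<zero>" using fg bot below_zero by simp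
  \<comment> \<open>The join is now formed in \<open>S\<close>, since distributivity speaks of joins
    there. It stays below \<open>e\<close>, hence lies in \<open>L\<close>, and is therefore above
    the join of \<open>L\<close>, which is \<open>e\<close>.\<close>
  have comp: "compatible S f g" by (rule compatible_below[OF fe g(2)]) (use e in simp)
  then obtain j where j: "is_lub (nat_order S) j {f, g}"
    using join_exists[of "{f, g}"] compatible_pair f g by auto
  then have j': "j \<in> carrier S" "f \<preceq> j" "g \<preceq> j" "j \<preceq> e"
    using f g fe e by (auto simp: is_lub_iff)
  then have "j \<in> idems S" using ord_idem e by blast
  then have "f \<squnion>\<^bsub>L\<^esub> g \<preceq> j"
    using f fe g j' L.join_le[of f j g] by simp
  then have "j = e" using fg top j' e ord_antisym by auto
  then show ?thesis using 1 g j by blast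
qed

text \<open>Expresses that the meet is zero without naming a meet. For non-idempotents this is
  weaker than orthogonality, where the products \<open>s\<dagger> \<cdot> t\<close> and
  \<open>s \<cdot> t\<dagger>\<close> vanish.\<close>

definition disj :: "'a \<Rightarrow> 'a \<Rightarrow> bool" where
  "disj s t \<longleftrightarrow> (\<forall>u\<in>carrier S. u \<preceq> s \<and> u \<preceq> t \<longrightarrow> u = \<zero>)"

lemma disjD: "disj s t \<Longrightarrow> u \<preceq> s \<Longrightarrow> u \<preceq> t \<Longrightarrow> u \<in> carrier S \<Longrightarrow> u = \<zero>"
  by (auto simp: disj_def)

lemma disj_below: "disj s t \<Longrightarrow> s' \<preceq> s \<Longrightarrow> t' \<preceq> t \<Longrightarrow> s \<in> carrier S \<Longrightarrow> t \<in> carrier S \<Longrightarrow> disj s' t'"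
  unfolding disj_def by (meson ord_trans)

text \<open>Relative complements of arbitrary elements come from those of idempotents: let
  \<open>g\<close> be the complement of the domain of \<open>s\<close> in the domain of
  \<open>t\<close>, and take \<open>t \<cdot> g\<close>. Multiplying the join of idempotents by
  \<open>t\<close> gives the join of \<open>s\<close> and \<open>t \<cdot> g\<close>.\<close>

lemma ex_complement:
  assumes t: "t \<in> carrier S" and st: "s \<preceq> t"
  shows "\<exists>c\<in>carrier S. c \<preceq> t \<and> disj s c \<and> is_lub (nat_order S) t {s, c}"
proof -
  have s: "s \<in> carrier S" using assms ord_carrier by blast
  have "s\<dagger> \<cdot> s \<preceq> t\<dagger> \<cdot> t" using mult_mono_ord inv_mono assms by auto
  then obtain g where g: "g \<in> idems S" and fg: "s\<dagger> \<cdot> s \<cdot> g = \<zero>" and "g \<preceq> t\<dagger> \<cdot> t"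
    and lub: "is_lub (nat_order S) (t\<dagger> \<cdot> t) {s\<dagger> \<cdot> s, g}"
    using ex_idem_complement[of "t\<dagger> \<cdot> t" "s\<dagger> \<cdot> s"] s t by auto
  have tg: "t \<cdot> g \<preceq> t" using ordI_right t g by blast
  have "compatible S (s\<dagger> \<cdot> s) g"
    by (rule compatible_below[of _ "t\<dagger> \<cdot> t"]) (use \<open>s\<dagger> \<cdot> s \<preceq> t\<dagger> \<cdot> t\<close> \<open>g \<preceq> t\<dagger> \<cdot> t\<close> t in auto)
  then have "is_lub (nat_order S) (t \<cdot> (t\<dagger> \<cdot> t)) ((\<cdot>) t ` {s\<dagger> \<cdot> s, g})"
    using s t g lub by (intro join_mult compatible_pair) auto
  moreover have "t \<cdot> (s\<dagger> \<cdot> s) = s" using st s t ord_iff_right by metis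
  ultimately have 1: "is_lub (nat_order S) t {s, t \<cdot> g}" using t by simp
  \<comment> \<open>A common lower bound \<open>u\<close> has its domain idempotent below that of
    \<open>s\<close> and below \<open>g\<close>, hence below their product, which is zero.\<close>
  have "disj s (t \<cdot> g)"
    unfolding disj_def
  proof (intro ballI impI)
    fix u assume u: "u \<in> carrier S" and "u \<preceq> s \<and> u \<preceq> t \<cdot> g"
    then have us: "u \<preceq> s" and ug: "u \<preceq> t \<cdot> g" by auto
    have 1: "u\<dagger> \<cdot> u \<preceq> s\<dagger> \<cdot> s" by (intro mult_mono_ord inv_mono us) (use s in simp_all)
    have "u\<dagger> \<cdot> u \<preceq> (t \<cdot> g)\<dagger> \<cdot> (t \<cdot> g)" by (intro mult_mono_ord inv_mono ug) (use t g in simp_all)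
    also have "(t \<cdot> g)\<dagger> \<cdot> (t \<cdot> g) = g \<cdot> (t\<dagger> \<cdot> t \<cdot> g)" using t g by (simp add: mult_inv assoc)
    finally have "u\<dagger> \<cdot> u \<preceq> g \<cdot> (t\<dagger> \<cdot> t \<cdot> g)" .
    moreover have "g \<cdot> (t\<dagger> \<cdot> t \<cdot> g) \<preceq> g"
      by (intro ordI_right idem_mult_idem inv_mult_idem g t idem_carrier)
    ultimately have 2: "u\<dagger> \<cdot> u \<preceq> g" using ord_trans g by simp
    have "(u\<dagger> \<cdot> u) \<cdot> (u\<dagger> \<cdot> u) \<preceq> s\<dagger> \<cdot> s \<cdot> g" by (intro mult_mono_ord 1 2) (use s g in simp_all)
    then have "u\<dagger> \<cdot> u \<preceq> \<zero>" unfolding fg idem_mult[OF inv_mult_idem[OF u]] .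
    then have "u\<dagger> \<cdot> u = \<zero>" by (rule below_zero)
    then show "u = \<zero>" by (rule zero_if_dom_zero[OF u])
  qed
  then show ?thesis using 1 tg t g by (intro bexI[of _ "t \<cdot> g"]) simp_all
qed

section \<open>Filters, ultrafilters, separation and primeness\<close>

abbreviation "UF \<equiv> ultrafilters S"

lemma filter_carrier: "proper_filter S F \<Longrightarrow> F \<subseteq> carrier S"
  and filter_nonempty: "proper_filter S F \<Longrightarrow> F \<noteq> {}"
  and filter_up: "proper_filter S F \<Longrightarrow> s \<in> F \<Longrightarrow> s \<preceq> t \<Longrightarrow> t \<in> carrier S \<Longrightarrow> t \<in> F"
  and filter_directed: "proper_filter S F \<Longrightarrow> s \<in> F \<Longrightarrow> t \<in> F \<Longrightarrow> \<exists>u\<in>F. u \<preceq> s \<and> u \<preceq> t"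
  and filter_zero: "proper_filter S F \<Longrightarrow> \<zero> \<notin> F"
  by (auto simp: proper_filter_def)

lemma UF_filter: "F \<in> UF \<Longrightarrow> proper_filter S F"
  and UF_max: "F \<in> UF \<Longrightarrow> proper_filter S F' \<Longrightarrow> F \<subseteq> F' \<Longrightarrow> F' = F"
  by (auto simp: ultrafilters_def)

lemma UF_carrier: "F \<in> UF \<Longrightarrow> s \<in> F \<Longrightarrow> s \<in> carrier S"
  using UF_filter filter_carrier by blast

lemmas UF_nonempty = UF_filter[THEN filter_nonempty]
lemmas UF_up = UF_filter[THEN filter_up]
lemmas UF_directed = UF_filter[THEN filter_directed]
lemmas UF_zero = UF_filter[THEN filter_zero]

lemma proper_filterI:
  assumes "F \<subseteq> carrier S" "F \<noteq> {}" "\<And>s t. s \<in> F \<Longrightarrow> s \<preceq> t \<Longrightarrow> t \<in> carrier S \<Longrightarrow> t \<in> F"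
    "\<And>s t. s \<in> F \<Longrightarrow> t \<in> F \<Longrightarrow> \<exists>u\<in>F. u \<preceq> s \<and> u \<preceq> t" "\<zero> \<notin> F"
  shows "proper_filter S F"
  using assms by (auto simp: proper_filter_def)

lemma UF_I:
  assumes "proper_filter S F" "\<And>F'. proper_filter S F' \<Longrightarrow> F \<subseteq> F' \<Longrightarrow> F' \<subseteq> F"
  shows "F \<in> UF"
  using assms by (auto simp: ultrafilters_def)

text \<open>Zorn's lemma on the proper filters above \<open>F\<close>. Any two elements of the union
  of a chain already lie in one member of the chain, which gives directedness.\<close>

lemma ex_UF_extending:
  assumes F: "proper_filter S F"
  shows "\<exists>A\<in>UF. F \<subseteq> A"
proof -
  let ?P = "{F'. proper_filter S F' \<and> F \<subseteq> F'}"
  have "\<exists>M\<in>?P. \<forall>X\<in>?P. M \<subseteq> X \<longrightarrow> X = M"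
  proof (rule subset_Zorn_nonempty)
    show "?P \<noteq> {}" using F by auto
  next
    fix C assume C: "C \<noteq> {}" "subset.chain ?P C"
    have C1: "\<And>G. G \<in> C \<Longrightarrow> proper_filter S G \<and> F \<subseteq> G"
      and C2: "\<And>G H. G \<in> C \<Longrightarrow> H \<in> C \<Longrightarrow> G \<subseteq> H \<or> H \<subseteq> G"
      using C(2) by (auto simp: subset_chain_def)
    have "proper_filter S (\<Union>C)"
    proof (rule proper_filterI)
      show "\<Union>C \<subseteq> carrier S" using C1 filter_carrier by blast
      show "\<Union>C \<noteq> {}" using C C1 filter_nonempty by fastforce
      show "\<zero> \<notin> \<Union>C" using C1 filter_zero by blast
      show "t \<in> \<Union>C" if "s \<in> \<Union>C" "s \<preceq> t" "t \<in> carrier S" for s t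
        using that C1 filter_up by blast
      show "\<exists>u\<in>\<Union>C. u \<preceq> s \<and> u \<preceq> t" if st: "s \<in> \<Union>C" "t \<in> \<Union>C" for s t
      proof -
        obtain G H where "G \<in> C" "H \<in> C" "s \<in> G" "t \<in> H" using st by auto
        then obtain K where "K \<in> C" "s \<in> K" "t \<in> K" using C2 by blast
        then show ?thesis using C1 filter_directed by blast
      qed
    qed
    then show "\<Union>C \<in> ?P" using C C1 by auto
  qed
  then obtain M where M: "M \<in> ?P" and max: "\<forall>X\<in>?P. M \<subseteq> X \<longrightarrow> X = M" by (elim bexE)
  have "M \<in> UF"
  proof (rule UF_I)
    fix F' assume "proper_filter S F'" "M \<subseteq> F'"
    moreover from this have "F' \<in> ?P" using M by auto
    ultimately show "F' \<subseteq> M" using max by simp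
  qed (use M in simp)
  then show ?thesis using M by blast
qed

lemma up_filter:
  assumes P: "P \<subseteq> carrier S" "P \<noteq> {}" "\<zero> \<notin> P"
    and dir: "\<And>s t. s \<in> P \<Longrightarrow> t \<in> P \<Longrightarrow> \<exists>u\<in>P. u \<preceq> s \<and> u \<preceq> t"
  shows "proper_filter S {u \<in> carrier S. \<exists>p\<in>P. p \<preceq> u}"
proof (rule proper_filterI)
  let ?F = "{u \<in> carrier S. \<exists>p\<in>P. p \<preceq> u}"
  show "?F \<noteq> {}" using P ord_refl by blast
  show "\<exists>u\<in>?F. u \<preceq> s \<and> u \<preceq> t" if st: "s \<in> ?F" "t \<in> ?F" for s t
  proof -
    obtain p q where pq: "p \<in> P" "p \<preceq> s" "q \<in> P" "q \<preceq> t" using st by auto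
    then obtain u where u: "u \<in> P" "u \<preceq> p" "u \<preceq> q" using dir by blast
    then have "u \<preceq> s" "u \<preceq> t" using st pq ord_trans by blast+
    then show ?thesis using u P ord_refl by blast
  qed
  show "\<zero> \<notin> ?F" using P below_zero by auto
  show "t \<in> ?F" if "s \<in> ?F" "s \<preceq> t" "t \<in> carrier S" for s t
    using that ord_trans by blast
qed auto

lemma ex_UF_containing_base:
  assumes P: "P \<subseteq> carrier S" "P \<noteq> {}" "\<zero> \<notin> P"
    and dir: "\<And>s t. s \<in> P \<Longrightarrow> t \<in> P \<Longrightarrow> \<exists>u\<in>P. u \<preceq> s \<and> u \<preceq> t"
  shows "\<exists>A\<in>UF. P \<subseteq> A"
proof -
  have "P \<subseteq> {u \<in> carrier S. \<exists>p\<in>P. p \<preceq> u}" using P(1) by (blast intro: ord_refl)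
  then show ?thesis using ex_UF_extending[OF up_filter[OF assms]] by blast
qed

lemma ex_UF: "s \<in> carrier S \<Longrightarrow> s \<noteq> \<zero> \<Longrightarrow> \<exists>A\<in>UF. s \<in> A"
  using ex_UF_containing_base[of "{s}"] by auto

text \<open>Otherwise the meets of \<open>s\<close> with the members of \<open>F\<close> are all
  nonzero and form a filter base. The filter generated by it contains both \<open>F\<close> and
  \<open>s\<close>, against maximality.\<close>

lemma UF_separate:
  assumes F: "F \<in> UF" and s: "s \<in> carrier S" "s \<notin> F"
  shows "\<exists>f\<in>F. disj s f"
proof (rule ccontr)
  assume neg: "\<not> ?thesis"
  \<comment> \<open>A choice of the meet of \<open>s\<close> and \<open>f\<close> for each
    \<open>f\<close>; only \<open>f \<in> F\<close> will be used.\<close>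
  define m where "m f = (SOME m. m \<in> carrier S \<and> m \<preceq> s \<and> m \<preceq> f \<and>
    (\<forall>u\<in>carrier S. u \<preceq> s \<and> u \<preceq> f \<longrightarrow> u \<preceq> m))" for f
  have m: "m f \<in> carrier S \<and> m f \<preceq> s \<and> m f \<preceq> f \<and>
    (\<forall>u\<in>carrier S. u \<preceq> s \<and> u \<preceq> f \<longrightarrow> u \<preceq> m f)" if "f \<in> F" for f
    unfolding m_def by (rule someI_ex) (use meet_exists[of s f] that s UF_carrier[OF F] in blast)
  have nz: "m f \<noteq> \<zero>" if "f \<in> F" for f
    using m[OF that] neg that below_zero unfolding disj_def by auto
  have dir: "\<exists>u\<in>m ` F. u \<preceq> p \<and> u \<preceq> q" if pq: "p \<in> m ` F" "q \<in> m ` F" for p q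
  proof -
    obtain f g where fg: "f \<in> F" "g \<in> F" "p = m f" "q = m g" using pq by blast
    obtain h where h: "h \<in> F" "h \<preceq> f" "h \<preceq> g" using UF_directed[OF F] fg by blast
    have "m h \<preceq> f" "m h \<preceq> g" using m h fg UF_carrier[OF F] ord_trans by blast+
    then have "m h \<preceq> m f" "m h \<preceq> m g" using m[of f] m[of g] m[of h] h fg by auto
    then show ?thesis using fg h by auto
  qed
  have G: "proper_filter S {u \<in> carrier S. \<exists>p\<in>m ` F. p \<preceq> u}"
  proof (rule up_filter[OF _ _ _ dir])
    show "m ` F \<subseteq> carrier S" "m ` F \<noteq> {}" using m UF_nonempty[OF F] by auto
    show "\<zero> \<notin> m ` F" using nz by force
  qed
  have "F \<subseteq> {u \<in> carrier S. \<exists>p\<in>m ` F. p \<preceq> u}" using m UF_carrier[OF F] by blast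
  then have "{u \<in> carrier S. \<exists>p\<in>m ` F. p \<preceq> u} = F" using UF_max[OF F G] by simp
  moreover have "s \<in> {u \<in> carrier S. \<exists>p\<in>m ` F. p \<preceq> u}"
    using s m UF_nonempty[OF F] by blast
  ultimately show False using s by simp
qed

lemma UF_not_disj: "F \<in> UF \<Longrightarrow> s \<in> F \<Longrightarrow> t \<in> F \<Longrightarrow> \<not> disj s t"
  using UF_directed UF_zero UF_carrier disjD by metis

text \<open>If both \<open>s\<close> and \<open>t\<close> were missing, separation and directedness
  would give some \<open>h \<in> F\<close> below \<open>j\<close> that has zero meet with each of
  them. Restricting the join \<open>j\<close> to the domain of \<open>h\<close> turns
  \<open>j\<close> into \<open>h\<close> and both joinands into zero, so \<open>h\<close> would be
  zero.\<close>

lemma UF_prime: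
  assumes F: "F \<in> UF" and s: "s \<in> carrier S" and t: "t \<in> carrier S" and comp: "compatible S s t"
    and j: "is_lub (nat_order S) j {s, t}" and jF: "j \<in> F"
  shows "s \<in> F \<or> t \<in> F"
proof (rule ccontr)
  assume neg: "\<not> ?thesis"
  obtain f g where "f \<in> F" "disj s f" "g \<in> F" "disj t g"
    using UF_separate[OF F] s t neg by blast
  moreover obtain k where "k \<in> F" "k \<preceq> f" "k \<preceq> g" using UF_directed[OF F] calculation by blast
  moreover obtain h where h: "h \<in> F" "h \<preceq> k" "h \<preceq> j" using UF_directed[OF F] calculation jF by blast
  moreover have [simp]: "h \<in> carrier S" "f \<in> carrier S" "g \<in> carrier S" "k \<in> carrier S" "j \<in> carrier S"
    using calculation UF_carrier F jF by auto
  ultimately have d: "disj s h" "disj t h"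
    using disj_below[of s f s h] disj_below[of t g t h] ord_trans s t by (meson ord_refl)+
  have sj: "s \<preceq> j" "t \<preceq> j" using j s t by (auto simp: is_lub_iff)
  have hj: "h = j \<cdot> (h\<dagger> \<cdot> h)" by (rule ord_iff_right[THEN iffD1]) (use h in auto)
  have "x \<cdot> (h\<dagger> \<cdot> h) = \<zero>" if "x \<in> carrier S" "x \<preceq> j" "disj x h" for x
  proof -
    have "x \<cdot> (h\<dagger> \<cdot> h) \<preceq> x" using that by (intro ordI_right) auto
    moreover have "x \<cdot> (h\<dagger> \<cdot> h) \<preceq> j \<cdot> (h\<dagger> \<cdot> h)" using that by (intro mult_mono_ord) auto
    ultimately show ?thesis using disjD[OF that(3)] hj that by auto
  qed
  then have "(\<lambda>a. a \<cdot> (h\<dagger> \<cdot> h)) ` {s, t} = {\<zero>}" using s t sj d by auto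
  then have "is_lub (nat_order S) (j \<cdot> (h\<dagger> \<cdot> h)) {\<zero>}"
    using join_mult(2)[OF _ compatible_pair[OF comp s t] j, of "h\<dagger> \<cdot> h"] by simp
  then have "j \<cdot> (h\<dagger> \<cdot> h) = \<zero>" using below_zero by (auto simp: is_lub_iff)
  then show False using hj UF_zero[OF F] h by auto
qed

text \<open>Let \<open>c\<close> be the complement in \<open>s\<close> of the meet \<open>m\<close>
  of \<open>s\<close> and \<open>t\<close>. An ultrafilter through a nonzero \<open>c\<close> would
  contain \<open>s\<close>, hence \<open>t\<close>, hence an element below both \<open>m\<close> and
  \<open>c\<close>. So \<open>c\<close> is zero and \<open>s\<close> collapses to
  \<open>m\<close>.\<close>

lemma UF_subset_imp_ord:
  assumes s: "s \<in> carrier S" and t: "t \<in> carrier S" and sub: "\<And>A. A \<in> UF \<Longrightarrow> s \<in> A \<Longrightarrow> t \<in> A"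
  shows "s \<preceq> t"
proof -
  obtain m where m: "m \<in> carrier S" "m \<preceq> s" "m \<preceq> t"
    and mg: "\<forall>u\<in>carrier S. u \<preceq> s \<and> u \<preceq> t \<longrightarrow> u \<preceq> m" using meet_exists s t by blast
  obtain c where c: "c \<in> carrier S" "c \<preceq> s" "disj m c" and lub: "is_lub (nat_order S) s {m, c}"
    using ex_complement[OF s m(2)] by blast
  have "c = \<zero>"
  proof (rule ccontr)
    assume "c \<noteq> \<zero>"
    then obtain A where A: "A \<in> UF" "c \<in> A" using ex_UF c by blast
    then have "s \<in> A" "t \<in> A" using UF_up c s sub by blast+
    then obtain u v where "u \<in> A" "u \<preceq> s" "u \<preceq> t" "v \<in> A" "v \<preceq> u" "v \<preceq> c"
      using UF_directed A by metis
    then have "v \<preceq> m" "v \<in> carrier S" using mg UF_carrier A ord_trans m by blast+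
    then show False using disjD[OF c(3)] \<open>v \<preceq> c\<close> UF_zero A \<open>v \<in> A\<close> by blast
  qed
  then have "s \<preceq> m" using lub m by (auto simp: is_lub_iff)
  then show ?thesis using m ord_trans t by blast
qed

end

section \<open>The groupoid of ultrafilters\<close>

context bis
begin

text \<open>The multiplication of \<open>ultra_gpd\<close>, named separately so that its laws can be
  proved for arbitrary subsets of the carrier, including singletons, and regardless of
  composability.\<close>

definition up_mult :: "'a set \<Rightarrow> 'a set \<Rightarrow> 'a set" (infixl \<open>\<odot>\<close> 70) where
  "A \<odot> B = {u \<in> carrier S. \<exists>a\<in>A. \<exists>b\<in>B. a \<cdot> b \<preceq> u}"

abbreviation star_set :: "'a set \<Rightarrow> 'a set" (\<open>_\<ddagger>\<close> [1000] 1000) where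
  "A\<ddagger> \<equiv> sg_inv S ` A"

lemma up_multI:
  "a \<in> A \<Longrightarrow> b \<in> B \<Longrightarrow> a \<cdot> b \<preceq> u \<Longrightarrow> u \<in> carrier S \<Longrightarrow> u \<in> A \<odot> B"
  by (auto simp: up_mult_def)

lemma up_multE:
  assumes "u \<in> A \<odot> B"
  obtains a b where "a \<in> A" "b \<in> B" "a \<cdot> b \<preceq> u" "u \<in> carrier S"
  using assms by (auto simp: up_mult_def)

lemma up_multD: "u \<in> A \<odot> B \<Longrightarrow> u \<in> carrier S \<and> (\<exists>a\<in>A. \<exists>b\<in>B. a \<cdot> b \<preceq> u)"
  by (auto simp: up_mult_def)

lemma up_mult_mult: "a \<in> A \<Longrightarrow> b \<in> B \<Longrightarrow> A \<subseteq> carrier S \<Longrightarrow> B \<subseteq> carrier S \<Longrightarrow> a \<cdot> b \<in> A \<odot> B"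
  by (rule up_multI[of a _ b]) (auto intro!: ord_refl mult_closed)

lemma up_mult_carrier [simp]: "A \<odot> B \<subseteq> carrier S"
  by (auto simp: up_mult_def)

lemma up_mult_mono: "A \<subseteq> A' \<Longrightarrow> B \<subseteq> B' \<Longrightarrow> A \<odot> B \<subseteq> A' \<odot> B'"
  unfolding up_mult_def by blast

lemma star_set_carrier: "A \<subseteq> carrier S \<Longrightarrow> A\<ddagger> \<subseteq> carrier S"
  by auto

lemma star_set_star_set [simp]: "A \<subseteq> carrier S \<Longrightarrow> A\<ddagger>\<ddagger> = A"
  by (force simp: image_image)

lemma up_mult_assoc:
  assumes "A \<subseteq> carrier S" "B \<subseteq> carrier S" "C \<subseteq> carrier S"
  shows "A \<odot> B \<odot> C = A \<odot> (B \<odot> C)"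
proof (intro equalityI subsetI)
  fix u assume "u \<in> A \<odot> B \<odot> C"
  then obtain v c where v: "v \<in> A \<odot> B" and c: "c \<in> C" and u: "v \<cdot> c \<preceq> u" "u \<in> carrier S"
    using up_multD by blast
  from v obtain a b where ab: "a \<in> A" "b \<in> B" "a \<cdot> b \<preceq> v" "v \<in> carrier S" using up_multD by blast
  have M: "a \<in> carrier S" "b \<in> carrier S" "c \<in> carrier S" using ab c assms by auto
  have "a \<cdot> (b \<cdot> c) = a \<cdot> b \<cdot> c" using M by (simp add: assoc)
  also have "\<dots> \<preceq> v \<cdot> c" by (intro mult_mono_ord ab ord_refl M)
  finally have "a \<cdot> (b \<cdot> c) \<preceq> u" using u ord_trans by blast
  moreover have "b \<cdot> c \<in> B \<odot> C" using ab c assms by (intro up_mult_mult)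
  ultimately show "u \<in> A \<odot> (B \<odot> C)" using ab(1) u(2) up_multI by blast
next
  fix u assume "u \<in> A \<odot> (B \<odot> C)"
  then obtain a v where v: "v \<in> B \<odot> C" and a: "a \<in> A" and u: "a \<cdot> v \<preceq> u" "u \<in> carrier S"
    using up_multD by blast
  from v obtain b c where bc: "b \<in> B" "c \<in> C" "b \<cdot> c \<preceq> v" "v \<in> carrier S" using up_multD by blast
  have M: "a \<in> carrier S" "b \<in> carrier S" "c \<in> carrier S" using bc a assms by auto
  have "a \<cdot> b \<cdot> c = a \<cdot> (b \<cdot> c)" using M by (simp add: assoc)
  also have "\<dots> \<preceq> a \<cdot> v" by (intro mult_mono_ord bc ord_refl M)
  finally have "a \<cdot> b \<cdot> c \<preceq> u" using u ord_trans by blast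
  moreover have "a \<cdot> b \<in> A \<odot> B" using a bc assms by (intro up_mult_mult)
  ultimately show "u \<in> A \<odot> B \<odot> C" using bc(2) u(2) up_multI by blast
qed

lemma star_set_up_mult:
  assumes "A \<subseteq> carrier S" "B \<subseteq> carrier S"
  shows "(A \<odot> B)\<ddagger> = B\<ddagger> \<odot> A\<ddagger>"
proof -
  have sub: "(A \<odot> B)\<ddagger> \<subseteq> B\<ddagger> \<odot> A\<ddagger>" if "A \<subseteq> carrier S" "B \<subseteq> carrier S" for A B
  proof (rule image_subsetI)
    fix u assume "u \<in> A \<odot> B"
    then obtain a b where ab: "a \<in> A" "b \<in> B" "a \<cdot> b \<preceq> u" "u \<in> carrier S" using up_multD by blast
    then have "(a \<cdot> b)\<dagger> \<preceq> u\<dagger>" using inv_mono by blast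
    moreover have "(a \<cdot> b)\<dagger> = b\<dagger> \<cdot> a\<dagger>" using ab that by (intro mult_inv) auto
    ultimately show "u\<dagger> \<in> B\<ddagger> \<odot> A\<ddagger>" using ab by (intro up_multI) auto
  qed
  have "B\<ddagger> \<odot> A\<ddagger> = (B\<ddagger> \<odot> A\<ddagger>)\<ddagger>\<ddagger>" by simp
  also have "\<dots> \<subseteq> (A\<ddagger>\<ddagger> \<odot> B\<ddagger>\<ddagger>)\<ddagger>" by (intro image_mono sub star_set_carrier assms)
  finally show ?thesis using sub[OF assms] assms by simp
qed

text \<open>For \<open>a\<close>, \<open>b\<close>, \<open>c\<close> in the filter, a common lower
  bound \<open>d\<close> in it satisfies \<open>d = d \<cdot> (d\<dagger> \<cdot> d)\<close>, which
  lies below \<open>a \<cdot> (b\<dagger> \<cdot> c)\<close>. Directedness is thus what makes a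
  filter closed under the ternary product.\<close>

lemma filter_mult_dom:
  assumes F: "proper_filter S A"
  shows "A \<odot> (A\<ddagger> \<odot> A) = A"
proof (intro equalityI subsetI)
  note M = filter_carrier[OF F]
  fix u assume "u \<in> A \<odot> (A\<ddagger> \<odot> A)"
  then obtain a v where av: "a \<in> A" "v \<in> A\<ddagger> \<odot> A" "a \<cdot> v \<preceq> u" "u \<in> carrier S" using up_multD by blast
  then obtain b c where bc: "b \<in> A" "c \<in> A" "b\<dagger> \<cdot> c \<preceq> v" "v \<in> carrier S"
    using up_multD by blast
  obtain d' where "d' \<in> A" "d' \<preceq> a" "d' \<preceq> b" using filter_directed[OF F] av bc by blast
  moreover obtain d where d: "d \<in> A" "d \<preceq> d'" "d \<preceq> c"
    using filter_directed[OF F] calculation bc by blast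
  ultimately have d': "d \<preceq> a" "d \<preceq> b" using ord_trans M av bc by blast+
  have MM: "a \<in> carrier S" "b \<in> carrier S" "c \<in> carrier S" "d \<in> carrier S" using M av bc d by auto
  have "d = d \<cdot> (d\<dagger> \<cdot> d)" using MM by simp
  also have "\<dots> \<preceq> a \<cdot> (b\<dagger> \<cdot> c)" by (intro mult_mono_ord inv_mono d d' mult_closed inv_closed MM)
  also have "\<dots> \<preceq> a \<cdot> v" by (intro mult_mono_ord ord_refl bc MM)
  finally (ord_trans) have "d \<preceq> a \<cdot> v" using MM bc by simp
  then have "d \<preceq> u" using av ord_trans by blast
  then show "u \<in> A" using filter_up[OF F] d av by blast
next
  note M = filter_carrier[OF F]
  fix u assume u: "u \<in> A"
  have "u \<cdot> (u\<dagger> \<cdot> u) \<in> A \<odot> (A\<ddagger> \<odot> A)"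
    using u M by (intro up_mult_mult star_set_carrier) auto
  then show "u \<in> A \<odot> (A\<ddagger> \<odot> A)" using u M by auto
qed

lemma filter_star:
  assumes F: "proper_filter S A"
  shows "proper_filter S (A\<ddagger>)"
proof (rule proper_filterI)
  note M = filter_carrier[OF F]
  show "A\<ddagger> \<subseteq> carrier S" using M by auto
  show "A\<ddagger> \<noteq> {}" using filter_nonempty[OF F] by auto
  show "t \<in> A\<ddagger>" if st: "s \<in> A\<ddagger>" "s \<preceq> t" "t \<in> carrier S" for s t
  proof -
    obtain a where a: "a \<in> A" "s = a\<dagger>" using st by auto
    have "s\<dagger> \<preceq> t\<dagger>" using st by (intro inv_mono)
    then have "t\<dagger> \<in> A" using filter_up[OF F] a M st by auto
    then show ?thesis using st by (metis imageI inv_inv)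
  qed
  show "\<exists>u\<in>A\<ddagger>. u \<preceq> s \<and> u \<preceq> t" if st: "s \<in> A\<ddagger>" "t \<in> A\<ddagger>" for s t
  proof -
    obtain a b where "a \<in> A" "s = a\<dagger>" "b \<in> A" "t = b\<dagger>" using st by auto
    then show ?thesis using filter_directed[OF F, of a b] inv_mono M by blast
  qed
  show "\<zero> \<notin> A\<ddagger>"
  proof
    assume "\<zero> \<in> A\<ddagger>"
    then obtain a where a: "a \<in> A" "\<zero> = a\<dagger>" by auto
    then have "a = \<zero>" using inv_inv[of a] M idem_inv[OF zero_idem] by auto
    then show False using a filter_zero[OF F] by simp
  qed
qed

lemma UF_star:
  assumes A: "A \<in> UF"
  shows "A\<ddagger> \<in> UF"
proof (rule UF_I)
  show "proper_filter S (A\<ddagger>)" using filter_star UF_filter A by blast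
  fix F assume F: "proper_filter S F" "A\<ddagger> \<subseteq> F"
  then have "A \<subseteq> F\<ddagger>" using image_mono[OF F(2), of "sg_inv S"] filter_carrier UF_filter[OF A] by auto
  then have "F\<ddagger> = A" using UF_max[OF A filter_star[OF F(1)]] by blast
  then show "F \<subseteq> A\<ddagger>" using filter_carrier[OF F(1)] by auto
qed

lemma UF_subset: "A \<in> UF \<Longrightarrow> A \<subseteq> carrier S"
  using UF_carrier by blast

lemma cod_mult_filter:
  assumes F: "proper_filter S A"
  shows "A \<odot> A\<ddagger> \<odot> A = A"
  using filter_mult_dom[OF F] filter_carrier[OF F] by (simp add: up_mult_assoc star_set_carrier)

text \<open>Any \<open>a\<close> in the filter has a lower bound \<open>b\<close> in it that is also
  below \<open>s\<close>, and \<open>b\<close> is \<open>s\<close> restricted to the domain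
  idempotent of \<open>b\<close>. So one member together with the domain recovers the
  filter.\<close>

lemma filter_eq_translate:
  assumes F: "proper_filter S A" and s: "s \<in> A"
  shows "{s} \<odot> (A\<ddagger> \<odot> A) = A"
proof
  note M = filter_carrier[OF F]
  have "{s} \<odot> (A\<ddagger> \<odot> A) \<subseteq> A \<odot> (A\<ddagger> \<odot> A)" using s by (intro up_mult_mono) auto
  then show "{s} \<odot> (A\<ddagger> \<odot> A) \<subseteq> A" using filter_mult_dom[OF F] by simp
  show "A \<subseteq> {s} \<odot> (A\<ddagger> \<odot> A)"
  proof
    fix a assume a: "a \<in> A"
    obtain b where b: "b \<in> A" "b \<preceq> a" "b \<preceq> s" using filter_directed[OF F a s] by blast
    have "s \<cdot> (b\<dagger> \<cdot> b) = b"
      by (rule ord_iff_right[THEN iffD1, symmetric]) (use b s M in auto)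
    moreover have "b\<dagger> \<cdot> b \<in> A\<ddagger> \<odot> A" using b M by (intro up_mult_mult star_set_carrier) auto
    ultimately show "a \<in> {s} \<odot> (A\<ddagger> \<odot> A)" using b a M by (intro up_multI[of s "{s}" "b\<dagger> \<cdot> b"]) auto
  qed
qed

text \<open>The hypothesis places the domain idempotent of \<open>s\<close> in the codomain of
  \<open>B\<close>, so multiplying by it stays inside
  \<open>B \<odot> B\<ddagger> \<odot> B = B\<close>. Translation by \<open>s\<close> is therefore
  undone by \<open>s\<dagger>\<close> and leaves the domain unchanged.\<close>

lemma translate_dom:
  assumes F: "proper_filter S B" and s: "s \<in> carrier S" and sB: "s\<dagger> \<cdot> s \<in> B \<odot> B\<ddagger>"
  shows "{s\<dagger>} \<odot> ({s} \<odot> B) = B" and "({s} \<odot> B)\<ddagger> \<odot> ({s} \<odot> B) = B\<ddagger> \<odot> B"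
proof -
  note M = filter_carrier[OF F]
  show 1: "{s\<dagger>} \<odot> ({s} \<odot> B) = B"
  proof
    show "{s\<dagger>} \<odot> ({s} \<odot> B) \<subseteq> B"
    proof
      fix u assume "u \<in> {s\<dagger>} \<odot> ({s} \<odot> B)"
      then obtain v b where vb: "s\<dagger> \<cdot> v \<preceq> u" "u \<in> carrier S" "s \<cdot> b \<preceq> v" "v \<in> carrier S" "b \<in> B"
        by (auto elim!: up_multE)
      have "s\<dagger> \<cdot> (s \<cdot> b) \<preceq> s\<dagger> \<cdot> v" using vb s by (intro mult_mono_ord ord_refl inv_closed)
      then have "s\<dagger> \<cdot> s \<cdot> b \<preceq> u" using vb s M ord_trans by (auto simp: assoc)
      moreover have "s\<dagger> \<cdot> s \<cdot> b \<in> B \<odot> B\<ddagger> \<odot> B" by (intro up_mult_mult vb sB up_mult_carrier M)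
      ultimately show "u \<in> B" using filter_up[OF F] cod_mult_filter[OF F] vb by simp
    qed
    show "B \<subseteq> {s\<dagger>} \<odot> ({s} \<odot> B)"
    proof
      fix b assume b: "b \<in> B"
      then have "s \<cdot> b \<in> {s} \<odot> B" using M s by (intro up_mult_mult) auto
      moreover have "s\<dagger> \<cdot> (s \<cdot> b) \<preceq> b" using ordI_left[of b "s\<dagger> \<cdot> s"] b s M by (auto simp: assoc)
      ultimately show "b \<in> {s\<dagger>} \<odot> ({s} \<odot> B)" using b M by (intro up_multI[of "s\<dagger>" "{s\<dagger>}" "s \<cdot> b"]) auto
    qed
  qed
  have "({s} \<odot> B)\<ddagger> \<odot> ({s} \<odot> B) = B\<ddagger> \<odot> {s\<dagger>} \<odot> ({s} \<odot> B)"
    using star_set_up_mult[of "{s}" B] s M by simp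
  also have "\<dots> = B\<ddagger> \<odot> ({s\<dagger>} \<odot> ({s} \<odot> B))"
    using s M by (intro up_mult_assoc star_set_carrier) auto
  finally show "({s} \<odot> B)\<ddagger> \<odot> ({s} \<odot> B) = B\<ddagger> \<odot> B" using 1 by simp
qed

text \<open>Maximality is transported back along \<open>s\<dagger>\<close>: a filter \<open>F\<close> above \<open>sB\<close> gives the filter
  \<open>s\<dagger>F\<close> above \<open>B\<close>.\<close>

lemma UF_translate:
  assumes B: "B \<in> UF" and s: "s \<in> carrier S" and sB: "s\<dagger> \<cdot> s \<in> B \<odot> B\<ddagger>"
  shows "{s} \<odot> B \<in> UF"
proof (rule UF_I)
  note M = UF_subset[OF B]
  have filt: "proper_filter S ({t} \<odot> F)"
    if F: "proper_filter S F" and t: "t \<in> carrier S" and nz: "\<And>f. f \<in> F \<Longrightarrow> t \<cdot> f \<noteq> \<zero>" for t F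
  proof -
    have "proper_filter S {u \<in> carrier S. \<exists>p\<in>(\<cdot>) t ` F. p \<preceq> u}"
    proof (rule up_filter)
      show "(\<cdot>) t ` F \<subseteq> carrier S" "(\<cdot>) t ` F \<noteq> {}" "\<zero> \<notin> (\<cdot>) t ` F"
        using filter_carrier[OF F] filter_nonempty[OF F] t nz by (auto simp: eq_commute[of \<zero>])
      fix p q assume "p \<in> (\<cdot>) t ` F" "q \<in> (\<cdot>) t ` F"
      then obtain f g where fg: "f \<in> F" "g \<in> F" "p = t \<cdot> f" "q = t \<cdot> g" by auto
      then obtain h where h: "h \<in> F" "h \<preceq> f" "h \<preceq> g" using filter_directed[OF F] by blast
      have "t \<cdot> h \<preceq> p" "t \<cdot> h \<preceq> q"
        using fg h t filter_carrier[OF F] by (auto intro!: mult_mono_ord)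
      then show "\<exists>u\<in>(\<cdot>) t ` F. u \<preceq> p \<and> u \<preceq> q" using h by blast
    qed
    moreover have "{t} \<odot> F = {u \<in> carrier S. \<exists>p\<in>(\<cdot>) t ` F. p \<preceq> u}" by (auto simp: up_mult_def)
    ultimately show ?thesis by simp
  qed
  show "proper_filter S ({s} \<odot> B)"
  proof (rule filt[OF UF_filter[OF B] s])
    fix b assume b: "b \<in> B"
    show "s \<cdot> b \<noteq> \<zero>"
    proof
      assume "s \<cdot> b = \<zero>"
      then have "s\<dagger> \<cdot> s \<cdot> b = \<zero>" using b s M by (auto simp: assoc)
      moreover have "s\<dagger> \<cdot> s \<cdot> b \<in> B \<odot> B\<ddagger> \<odot> B" by (intro up_mult_mult b sB up_mult_carrier M)
      ultimately show False using cod_mult_filter[OF UF_filter[OF B]] UF_zero[OF B] by simp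
    qed
  qed
  fix F assume F: "proper_filter S F" and sub: "{s} \<odot> B \<subseteq> F"
  note MF = filter_carrier[OF F]
  \<comment> \<open>Elements below \<open>s \<cdot> b\<close> are fixed by
    \<open>s \<cdot> s\<dagger>\<close>. As every member of \<open>F\<close> has a lower bound of
    this kind in \<open>F\<close>, passing to \<open>s\<dagger>\<close> and back loses
    nothing.\<close>
  have canc: "s \<cdot> (s\<dagger> \<cdot> h) = h" if h: "h \<preceq> s \<cdot> b" and b: "b \<in> B" for h b
  proof -
    have hM: "h \<in> carrier S" and bM: "b \<in> carrier S" using ord_carrier h b s M by auto
    have h': "h = s \<cdot> b \<cdot> (h\<dagger> \<cdot> h)"
      by (rule ord_iff_right[THEN iffD1]) (use h hM bM s in simp_all)
    have "s \<cdot> (s\<dagger> \<cdot> (s \<cdot> b \<cdot> (h\<dagger> \<cdot> h))) = s \<cdot> b \<cdot> (h\<dagger> \<cdot> h)" using s bM hM by (simp add: assoc)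
    then show ?thesis by (simp only: h'[symmetric])
  qed
  obtain b where b: "b \<in> B" using UF_nonempty[OF B] by blast
  then have sb: "s \<cdot> b \<in> F" using sub M s by (intro subsetD[OF sub] up_mult_mult) auto
  have "proper_filter S ({s\<dagger>} \<odot> F)"
  proof (rule filt[OF F])
    fix f assume f: "f \<in> F"
    obtain h where h: "h \<in> F" "h \<preceq> f" "h \<preceq> s \<cdot> b" using filter_directed[OF F f sb] by blast
    show "s\<dagger> \<cdot> f \<noteq> \<zero>"
    proof
      assume "s\<dagger> \<cdot> f = \<zero>"
      moreover have "s\<dagger> \<cdot> h \<preceq> s\<dagger> \<cdot> f" using h f MF s by (intro mult_mono_ord ord_refl) auto
      ultimately have "s\<dagger> \<cdot> h = \<zero>" using below_zero by simp
      then have "h = \<zero>" using canc[OF h(3) b] s by simp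
      then show False using filter_zero[OF F] h by simp
    qed
  qed (use s in auto)
  moreover have "B \<subseteq> {s\<dagger>} \<odot> F"
    using translate_dom(1)[OF UF_filter[OF B] s sB] up_mult_mono[OF order_refl sub, of "{s\<dagger>}"] by simp
  ultimately have eq: "{s\<dagger>} \<odot> F = B" using UF_max[OF B] by blast
  show "F \<subseteq> {s} \<odot> B"
  proof
    fix f assume f: "f \<in> F"
    obtain h where h: "h \<in> F" "h \<preceq> f" "h \<preceq> s \<cdot> b" using filter_directed[OF F f sb] by blast
    have "s\<dagger> \<cdot> h \<in> B" using h MF s by (subst eq[symmetric], intro up_mult_mult) auto
    then show "f \<in> {s} \<odot> B" using canc[OF h(3) b] h f MF by (intro up_multI) auto
  qed
qed

text \<open>Writing \<open>A\<close> as the translate of its domain by some \<open>s \<in> A\<close>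
  and replacing that domain by the codomain of \<open>B\<close> gives
  \<open>A \<odot> B = {s} \<odot> B\<close>, so the case of translates applies.\<close>

lemma UF_up_mult:
  assumes A: "A \<in> UF" and B: "B \<in> UF" and AB: "A\<ddagger> \<odot> A = B \<odot> B\<ddagger>"
  shows "A \<odot> B \<in> UF"
proof -
  note M = UF_subset[OF A] UF_subset[OF B]
  obtain s where s: "s \<in> A" using UF_nonempty[OF A] by blast
  have "A \<odot> B = {s} \<odot> (A\<ddagger> \<odot> A) \<odot> B" using filter_eq_translate[OF UF_filter[OF A] s] by simp
  also have "\<dots> = {s} \<odot> (B \<odot> B\<ddagger> \<odot> B)"
    using M s unfolding AB by (intro up_mult_assoc) auto
  also have "\<dots> = {s} \<odot> B" using cod_mult_filter[OF UF_filter[OF B]] by simp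
  finally have "A \<odot> B = {s} \<odot> B" .
  moreover have "s\<dagger> \<cdot> s \<in> B \<odot> B\<ddagger>"
    unfolding AB[symmetric] using s M by (intro up_mult_mult star_set_carrier) auto
  ultimately show ?thesis using UF_translate[OF B] s M by auto
qed

section \<open>The etale groupoid structure on the space of ultrafilters\<close>

abbreviation "G \<equiv> ultra_gpd S"

lemma UF_top_space: "\<Union>(ultra_nhd S ` carrier S) = UF"
  using UF_nonempty UF_carrier by (force simp: ultra_nhd_def)

lemma arrows_ultra [simp]: "arrows G = UF"
  using UF_top_space by (simp add: arrows_def ultra_gpd_def)

lemma topspace_ultra [simp]: "topspace (gp_top G) = UF"
  using arrows_ultra by (simp add: arrows_def)

lemma gp_mult_ultra [simp]: "gp_mult G A B = A \<odot> B"
  by (simp add: ultra_gpd_def up_mult_def)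

lemma gp_inv_ultra [simp]: "gp_inv G A = A\<ddagger>"
  by (simp add: ultra_gpd_def)

lemma dom_of_ultra: "dom_of G A = A\<ddagger> \<odot> A"
  and cod_of_ultra: "cod_of G A = A \<odot> A\<ddagger>"
  by (simp_all add: dom_of_def cod_of_def)

lemma composable_ultra: "(A, B) \<in> composable G \<longleftrightarrow> A \<in> UF \<and> B \<in> UF \<and> A\<ddagger> \<odot> A = B \<odot> B\<ddagger>"
  by (simp add: composable_def dom_of_ultra cod_of_ultra)

lemma UF_dom:
  assumes A: "A \<in> UF"
  shows "A\<ddagger> \<odot> A \<in> UF"
  using UF_subset[OF A] by (intro UF_up_mult UF_star A) simp

lemma groupoid_ultra: "groupoid G"
  unfolding groupoid_def
proof (intro conjI)
  show "\<forall>A\<in>arrows G. gp_inv G A \<in> arrows G \<and> gp_inv G (gp_inv G A) = A \<and>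
      gp_mult G A (dom_of G A) = A \<and> gp_mult G (cod_of G A) A = A"
    using UF_star UF_subset UF_filter filter_mult_dom cod_mult_filter
    by (simp add: dom_of_ultra cod_of_ultra)
  have "dom_of G (A \<odot> B) = dom_of G B" if "A \<subseteq> carrier S" "B \<subseteq> carrier S" "proper_filter S B"
      "A\<ddagger> \<odot> A = B \<odot> B\<ddagger>" for A B
  proof -
    have "dom_of G (A \<odot> B) = B\<ddagger> \<odot> ((A\<ddagger> \<odot> A) \<odot> B)"
      using that(1,2) by (simp add: dom_of_ultra star_set_up_mult up_mult_assoc star_set_carrier)
    then show ?thesis using that cod_mult_filter by (simp add: dom_of_ultra)
  qed
  moreover have "cod_of G (A \<odot> B) = cod_of G A" if "A \<subseteq> carrier S" "B \<subseteq> carrier S" "proper_filter S A"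
      "A\<ddagger> \<odot> A = B \<odot> B\<ddagger>" for A B
  proof -
    have "cod_of G (A \<odot> B) = A \<odot> ((B \<odot> B\<ddagger>) \<odot> A\<ddagger>)"
      using that(1,2) by (simp add: cod_of_ultra star_set_up_mult up_mult_assoc star_set_carrier)
    also have "\<dots> = A \<odot> (A\<ddagger> \<odot> A) \<odot> A\<ddagger>"
      using that(1,2) by (simp add: that(4)[symmetric] up_mult_assoc star_set_carrier)
    also have "\<dots> = A \<odot> A\<ddagger>" using filter_mult_dom[OF that(3)] by simp
    finally show ?thesis by (simp add: cod_of_ultra)
  qed
  ultimately show "\<forall>(A, B)\<in>composable G. gp_mult G A B \<in> arrows G \<and>
      dom_of G (gp_mult G A B) = dom_of G B \<and> cod_of G (gp_mult G A B) = cod_of G A"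
    using UF_up_mult UF_subset UF_filter by (auto simp: composable_ultra)
  show "\<forall>A B C. (A, B) \<in> composable G \<and> (B, C) \<in> composable G \<longrightarrow>
      gp_mult G (gp_mult G A B) C = gp_mult G A (gp_mult G B C)"
    by (simp add: composable_ultra up_mult_assoc UF_subset)
qed

text \<open>Below \<open>e\<close>, all members of \<open>A\<close> are idempotent, and an
  idempotent \<open>f\<close> is \<open>f\<dagger> \<cdot> f\<close>; hence \<open>A\<close> is
  contained in its own domain. Both are ultrafilters, so they coincide.\<close>

lemma UF_idem:
  assumes A: "A \<in> UF" and e: "e \<in> A" "e \<in> idems S"
  shows "A\<ddagger> \<odot> A = A" and "A \<odot> A\<ddagger> = A"
proof -
  note M = UF_subset[OF A]
  have "A \<subseteq> A\<ddagger> \<odot> A"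
  proof
    fix a assume a: "a \<in> A"
    obtain f where f: "f \<in> A" "f \<preceq> a" "f \<preceq> e" using UF_directed[OF A a e(1)] by blast
    then have "f \<in> idems S" using ord_idem e by blast
    then have "f\<dagger> \<cdot> f \<preceq> a" using f by simp
    then show "a \<in> A\<ddagger> \<odot> A" using f a M by (intro up_multI[of "f\<dagger>" _ f] imageI) auto
  qed
  then show 1: "A\<ddagger> \<odot> A = A" using UF_max[OF A] UF_dom[OF A] UF_filter by blast
  have "A\<ddagger> = A" using star_set_up_mult[of "A\<ddagger>" A] M by (simp add: star_set_carrier 1)
  then show "A \<odot> A\<ddagger> = A" using 1 by simp
qed

lemma identities_ultra: "identities G = {A \<in> UF. A \<inter> idems S \<noteq> {}}"
proof (intro equalityI subsetI)
  fix A assume "A \<in> identities G"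
  then obtain B where B: "B \<in> UF" "A = B\<ddagger> \<odot> B" by (auto simp: identities_def dom_of_ultra)
  obtain b where "b \<in> B" using UF_nonempty B by blast
  then have "b\<dagger> \<cdot> b \<in> A" "b \<in> carrier S"
    unfolding B(2) using UF_subset[OF B(1)] by (auto intro!: up_mult_mult)
  then show "A \<in> {A \<in> UF. A \<inter> idems S \<noteq> {}}" using UF_dom B by auto
next
  fix A assume "A \<in> {A \<in> UF. A \<inter> idems S \<noteq> {}}"
  then show "A \<in> identities G" using UF_idem by (force simp: identities_def dom_of_ultra)
qed

lemma openin_ultra_nhd: "s \<in> carrier S \<Longrightarrow> openin (gp_top G) (ultra_nhd S s)"
  by (simp add: ultra_gpd_def topology_generated_by_Basis)

text \<open>The sets \<open>ultra_nhd S s\<close> were only declared a subbasis. They form a basis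
  because filters are directed: an ultrafilter in two of them lies in a third one, indexed by a
  common lower bound.\<close>

lemma openin_ultra_iff:
  "openin (gp_top G) W \<longleftrightarrow> W \<subseteq> UF \<and> (\<forall>A\<in>W. \<exists>s\<in>A. ultra_nhd S s \<subseteq> W)"
proof
  assume W: "openin (gp_top G) W"
  then have "generate_topology_on (ultra_nhd S ` carrier S) W"
    by (simp add: ultra_gpd_def openin_topology_generated_by_iff)
  then have "\<forall>A\<in>W. A \<in> UF \<longrightarrow> (\<exists>s\<in>A. ultra_nhd S s \<subseteq> W)"
  proof induction
    case (Int V W)
    show ?case
    proof (intro ballI impI)
      fix A assume A: "A \<in> V \<inter> W" "A \<in> UF"
      then obtain s t where "s \<in> A" "ultra_nhd S s \<subseteq> V" "t \<in> A" "ultra_nhd S t \<subseteq> W"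
        using Int by blast
      moreover obtain u where "u \<in> A" "u \<preceq> s" "u \<preceq> t" using UF_directed A calculation by blast
      ultimately have "ultra_nhd S u \<subseteq> V \<inter> W"
        using UF_up UF_carrier A unfolding ultra_nhd_def by blast
      then show "\<exists>s\<in>A. ultra_nhd S s \<subseteq> V \<inter> W" using \<open>u \<in> A\<close> by blast
    qed
  next
    case (Basis W)
    then show ?case by (auto simp: ultra_nhd_def)
  qed (simp, blast)
  then show "W \<subseteq> UF \<and> (\<forall>A\<in>W. \<exists>s\<in>A. ultra_nhd S s \<subseteq> W)"
    using openin_subset[OF W] by auto
next
  assume W: "W \<subseteq> UF \<and> (\<forall>A\<in>W. \<exists>s\<in>A. ultra_nhd S s \<subseteq> W)"
  show "openin (gp_top G) W"
  proof (subst openin_subopen, intro ballI)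
    fix A assume "A \<in> W"
    then obtain s where "s \<in> A" "ultra_nhd S s \<subseteq> W" "s \<in> carrier S" "A \<in> ultra_nhd S s"
      using W UF_carrier unfolding ultra_nhd_def by blast
    then show "\<exists>T. openin (gp_top G) T \<and> A \<in> T \<and> T \<subseteq> W" using openin_ultra_nhd by blast
  qed
qed

text \<open>An element \<open>s\<close> of \<open>A\<close> outside \<open>B\<close> has zero meet
  with some \<open>t \<in> B\<close>, and no ultrafilter can contain two elements with zero
  meet.\<close>

lemma Hausdorff_ultra: "Hausdorff_space (gp_top G)"
  unfolding Hausdorff_space_def
proof (intro allI impI)
  fix A B assume "A \<in> topspace (gp_top G) \<and> B \<in> topspace (gp_top G) \<and> A \<noteq> B"
  then have AB: "A \<in> UF" "B \<in> UF" "A \<noteq> B" by auto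
  then obtain s where s: "s \<in> A" "s \<notin> B" using UF_max UF_filter by blast
  then obtain t where t: "t \<in> B" "disj s t" using UF_separate AB UF_carrier by blast
  have "disjnt (ultra_nhd S s) (ultra_nhd S t)"
    using UF_not_disj t by (auto simp: ultra_nhd_def disjnt_def)
  then show "\<exists>U V. openin (gp_top G) U \<and> openin (gp_top G) V \<and> A \<in> U \<and> B \<in> V \<and> disjnt U V"
    using openin_ultra_nhd UF_carrier AB s t
    by (intro exI[of _ "ultra_nhd S s"] exI[of _ "ultra_nhd S t"]) (auto simp: ultra_nhd_def)
qed

text \<open>On the basis, continuity says that whenever \<open>s\<close> belongs to the ultrafilter
  \<open>f x\<close>, it still belongs to \<open>f y\<close> for all \<open>y\<close> near
  \<open>x\<close>.\<close>

lemma continuous_map_ultra: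
  assumes "f \<in> topspace X \<rightarrow> UF"
    "\<And>x s. x \<in> topspace X \<Longrightarrow> s \<in> f x \<Longrightarrow> \<exists>W. openin X W \<and> x \<in> W \<and> (\<forall>y\<in>W. s \<in> f y)"
  shows "continuous_map X (gp_top G) f"
  unfolding continuous_map_def
proof (intro conjI allI impI)
  show "f \<in> topspace X \<rightarrow> topspace (gp_top G)" using assms by simp
  fix U assume U: "openin (gp_top G) U"
  show "openin X {x \<in> topspace X. f x \<in> U}"
  proof (subst openin_subopen, intro ballI)
    fix x assume x: "x \<in> {x \<in> topspace X. f x \<in> U}"
    then obtain s where s: "s \<in> f x" "ultra_nhd S s \<subseteq> U" using U openin_ultra_iff by auto
    then obtain W where "openin X W" "x \<in> W" "\<forall>y\<in>W. s \<in> f y" using assms(2)[of x s] x by blast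
    moreover have "W \<subseteq> topspace X" using calculation openin_subset by blast
    ultimately show "\<exists>T. openin X T \<and> x \<in> T \<and> T \<subseteq> {x \<in> topspace X. f x \<in> U}"
      using s assms(1) by (intro exI[of _ W]) (auto simp: ultra_nhd_def Pi_iff)
  qed
qed

lemma ultra_nhdI: "A \<in> UF \<Longrightarrow> s \<in> A \<Longrightarrow> A \<in> ultra_nhd S s"
  by (simp add: ultra_nhd_def)

lemma ultra_nhd_mono: "s \<preceq> t \<Longrightarrow> t \<in> carrier S \<Longrightarrow> ultra_nhd S s \<subseteq> ultra_nhd S t"
  using UF_up by (auto simp: ultra_nhd_def)

lemma topological_groupoid_ultra: "topological_groupoid G"
  unfolding topological_groupoid_def
proof (intro conjI groupoid_ultra)
  show "continuous_map (gp_top G) (gp_top G) (gp_inv G)"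
  proof (rule continuous_map_ultra)
    show "gp_inv G \<in> topspace (gp_top G) \<rightarrow> UF" using UF_star by auto
    fix A s assume A: "A \<in> topspace (gp_top G)" and "s \<in> gp_inv G A"
    then obtain a where a: "a \<in> A" "s = a\<dagger>" by auto
    then show "\<exists>W. openin (gp_top G) W \<and> A \<in> W \<and> (\<forall>y\<in>W. s \<in> gp_inv G y)"
      using A openin_ultra_nhd[of a] UF_carrier[of A a]
      by (intro exI[of _ "ultra_nhd S a"]) (auto simp: ultra_nhd_def)
  qed
  show "continuous_map (subtopology (prod_topology (gp_top G) (gp_top G)) (composable G)) (gp_top G)
     (\<lambda>(x, y). gp_mult G x y)"
  proof (rule continuous_map_ultra)
    show "(\<lambda>(x, y). gp_mult G x y) \<in>
      topspace (subtopology (prod_topology (gp_top G) (gp_top G)) (composable G)) \<rightarrow> UF"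
      using UF_up_mult by (auto simp: composable_ultra)
    fix p s assume p: "p \<in> topspace (subtopology (prod_topology (gp_top G) (gp_top G)) (composable G))"
      and s: "s \<in> (case p of (x, y) \<Rightarrow> gp_mult G x y)"
    obtain A B where AB: "p = (A, B)" by (cases p)
    then have M: "A \<in> UF" "B \<in> UF" "(A, B) \<in> composable G" using p by auto
    obtain a b where ab: "a \<in> A" "b \<in> B" "a \<cdot> b \<preceq> s" "s \<in> carrier S"
      using s AB by (auto elim: up_multE)
    \<comment> \<open>The elements \<open>a\<close> and \<open>b\<close> that witness membership of
      \<open>s\<close> in the product are witnesses for every composable pair of ultrafilters
      containing them.\<close>
    let ?W = "(ultra_nhd S a \<times> ultra_nhd S b) \<inter> composable G"
    have "openin (prod_topology (gp_top G) (gp_top G)) (ultra_nhd S a \<times> ultra_nhd S b)"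
      using openin_ultra_nhd UF_carrier M ab by (auto simp: openin_prod_Times_iff)
    then have "openin (subtopology (prod_topology (gp_top G) (gp_top G)) (composable G)) ?W"
      by (auto simp: openin_subtopology)
    moreover have "p \<in> ?W" using AB M ab by (auto intro: ultra_nhdI)
    moreover have "\<forall>q\<in>?W. s \<in> (case q of (x, y) \<Rightarrow> gp_mult G x y)"
      using ab by (auto simp: ultra_nhd_def intro: up_multI)
    ultimately show "\<exists>W. openin (subtopology (prod_topology (gp_top G) (gp_top G)) (composable G)) W \<and>
        p \<in> W \<and> (\<forall>q\<in>W. s \<in> (case q of (x, y) \<Rightarrow> gp_mult G x y))" by blast
  qed
qed

text \<open>Over an identity \<open>E\<close> containing the domain idempotent of \<open>s\<close>,
  the ultrafilter through \<open>s\<close> with domain \<open>E\<close> is the translate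
  \<open>{s} \<odot> E\<close>.\<close>

lemma dom_image_ultra_nhd:
  assumes s: "s \<in> carrier S"
  shows "dom_of G ` ultra_nhd S s = ultra_nhd S (s\<dagger> \<cdot> s)"
proof (intro equalityI subsetI)
  fix E assume "E \<in> dom_of G ` ultra_nhd S s"
  then obtain A where A: "A \<in> UF" "s \<in> A" "E = A\<ddagger> \<odot> A" by (auto simp: dom_of_ultra ultra_nhd_def)
  then have "s\<dagger> \<cdot> s \<in> E" using UF_subset[OF A(1)] by (auto intro!: up_mult_mult)
  then show "E \<in> ultra_nhd S (s\<dagger> \<cdot> s)" using A UF_dom by (auto intro: ultra_nhdI)
next
  fix E assume "E \<in> ultra_nhd S (s\<dagger> \<cdot> s)"
  then have E: "E \<in> UF" and sE: "s\<dagger> \<cdot> s \<in> E" by (auto simp: ultra_nhd_def)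
  have id: "E\<ddagger> \<odot> E = E" "E \<odot> E\<ddagger> = E" using UF_idem[OF E sE] s by auto
  have "{s} \<odot> E \<in> UF" using UF_translate[OF E s] sE id by simp
  moreover have "dom_of G ({s} \<odot> E) = E"
    using translate_dom(2)[OF UF_filter[OF E] s] sE id by (simp add: dom_of_ultra)
  moreover have "s \<in> {s} \<odot> E" using sE s by (intro up_multI[of s _ "s\<dagger> \<cdot> s"]) auto
  ultimately show "E \<in> dom_of G ` ultra_nhd S s" by (force intro: ultra_nhdI)
qed

text \<open>By \<open>filter_eq_translate\<close> both ultrafilters are the translate by
  \<open>s\<close> of the same domain.\<close>

lemma dom_inj_ultra:
  assumes "A \<in> UF" "B \<in> UF" "s \<in> A" "s \<in> B" "dom_of G A = dom_of G B"
  shows "A = B"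
  using assms filter_eq_translate UF_filter unfolding dom_of_ultra by metis

lemma openin_dom_image:
  assumes W: "openin (gp_top G) W"
  shows "openin (gp_top G) (dom_of G ` W)"
  unfolding openin_ultra_iff
proof (intro conjI ballI)
  show "dom_of G ` W \<subseteq> UF" using W UF_dom by (auto simp: openin_ultra_iff dom_of_ultra)
  fix E assume "E \<in> dom_of G ` W"
  then obtain A where A: "A \<in> W" "A \<in> UF" "E = dom_of G A" using W by (auto simp: openin_ultra_iff)
  then obtain s where s: "s \<in> A" "ultra_nhd S s \<subseteq> W" using W by (auto simp: openin_ultra_iff)
  have sM: "s \<in> carrier S" using A s UF_carrier by blast
  have "E \<in> dom_of G ` ultra_nhd S s" using A s by (auto intro: ultra_nhdI)
  then have "s\<dagger> \<cdot> s \<in> E" using dom_image_ultra_nhd[OF sM] by (auto simp: ultra_nhd_def)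
  then show "\<exists>e\<in>E. ultra_nhd S e \<subseteq> dom_of G ` W"
    using dom_image_ultra_nhd[OF sM] image_mono[OF s(2), of "dom_of G"] by auto
qed

lemma continuous_dom_ultra: "continuous_map (gp_top G) (gp_top G) (dom_of G)"
proof (rule continuous_map_ultra)
  show "dom_of G \<in> topspace (gp_top G) \<rightarrow> UF" using UF_dom by (auto simp: dom_of_ultra)
  fix A s assume A: "A \<in> topspace (gp_top G)" and "s \<in> dom_of G A"
  then obtain a b where ab: "a \<in> A" "b \<in> A" "a\<dagger> \<cdot> b \<preceq> s" "s \<in> carrier S"
    by (auto simp: dom_of_ultra elim!: up_multE)
  have "openin (gp_top G) (ultra_nhd S a \<inter> ultra_nhd S b)"
    using ab A UF_carrier by (intro openin_Int openin_ultra_nhd) auto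
  then show "\<exists>W. openin (gp_top G) W \<and> A \<in> W \<and> (\<forall>y\<in>W. s \<in> dom_of G y)"
    using ab A by (intro exI[of _ "ultra_nhd S a \<inter> ultra_nhd S b"])
      (auto simp: ultra_nhd_def dom_of_ultra intro: up_multI)
qed

lemma ultra_nhd_idem_sub: "e \<in> idems S \<Longrightarrow> ultra_nhd S e \<subseteq> identities G"
  by (auto simp: ultra_nhd_def identities_ultra)

lemma openin_identities_ultra: "openin (gp_top G) (identities G)"
  unfolding openin_ultra_iff
proof (intro conjI ballI)
  fix A assume "A \<in> identities G"
  then obtain e where "e \<in> A" "e \<in> idems S" by (auto simp: identities_ultra)
  then show "\<exists>s\<in>A. ultra_nhd S s \<subseteq> identities G" using ultra_nhd_idem_sub by blast
qed (auto simp: identities_ultra)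

lemma etale_ultra: "etale_groupoid G"
  unfolding etale_groupoid_def local_homeomorphism_def
proof (intro conjI ballI topological_groupoid_ultra)
  fix A assume A: "A \<in> topspace (gp_top G)"
  then obtain s where s: "s \<in> A" "s \<in> carrier S" using UF_nonempty UF_carrier by fastforce
  let ?U = "ultra_nhd S s" and ?V = "ultra_nhd S (s\<dagger> \<cdot> s)"
  have V: "openin (gp_top G) ?V" and sub: "?V \<subseteq> identities G"
    using s openin_ultra_nhd ultra_nhd_idem_sub by auto
  \<comment> \<open>The image consists of identities, so the topology it inherits from the identity
    space is the one it inherits from the whole groupoid.\<close>
  have VI: "subtopology (identity_space G) ?V = subtopology (gp_top G) ?V"
    using sub by (simp add: identity_space_def subtopology_subtopology Int_absorb1)
  have U: "openin (gp_top G) ?U" using s openin_ultra_nhd by blast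
  have "homeomorphic_map (subtopology (gp_top G) ?U) (subtopology (gp_top G) ?V) (dom_of G)"
  proof (rule bijective_open_imp_homeomorphic_map)
    show "continuous_map (subtopology (gp_top G) ?U) (subtopology (gp_top G) ?V) (dom_of G)"
      using continuous_dom_ultra dom_image_ultra_nhd[OF s(2)]
      by (auto simp: continuous_map_in_subtopology intro!: continuous_map_from_subtopology)
    show "open_map (subtopology (gp_top G) ?U) (subtopology (gp_top G) ?V) (dom_of G)"
      using openin_dom_image dom_image_ultra_nhd[OF s(2)]
      unfolding open_map_def openin_open_subtopology[OF U] openin_open_subtopology[OF V] by blast
    show "dom_of G ` topspace (subtopology (gp_top G) ?U) = topspace (subtopology (gp_top G) ?V)"
      using dom_image_ultra_nhd[OF s(2)] openin_subset[OF U] openin_subset[OF V]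
      by (simp add: Int_absorb1)
    show "inj_on (dom_of G) (topspace (subtopology (gp_top G) ?U))"
      by (rule inj_onI, rule dom_inj_ultra) (auto simp: ultra_nhd_def)
  qed
  then show "\<exists>U. openin (gp_top G) U \<and> A \<in> U \<and> openin (identity_space G) (dom_of G ` U) \<and>
      homeomorphic_map (subtopology (gp_top G) U) (subtopology (identity_space G) (dom_of G ` U)) (dom_of G)"
    using U V sub VI dom_image_ultra_nhd[OF s(2)] A s openin_open_subtopology[OF openin_identities_ultra]
    by (intro exI[of _ ?U]) (auto simp: identity_space_def ultra_nhd_def)
qed

text \<open>A composable product of an ultrafilter through \<open>t\<dagger>\<close> and one through
  \<open>t\<close> contains the idempotent \<open>t\<dagger> \<cdot> t\<close>, and ultrafilters
  with an idempotent are the identities. Used with \<open>s\<close> and with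
  \<open>s\<dagger>\<close> for \<open>t\<close>.\<close>

lemma bisection_ultra_nhd:
  assumes s: "s \<in> carrier S"
  shows "bisection G (ultra_nhd S s)"
proof -
  have "A \<odot> B \<in> identities G" if "A \<in> UF" "B \<in> UF" "A\<ddagger> \<odot> A = B \<odot> B\<ddagger>" "t\<dagger> \<in> A" "t \<in> B" "t \<in> carrier S" for A B t
  proof -
    have "t\<dagger> \<cdot> t \<in> A \<odot> B" using that by (intro up_multI) auto
    then show ?thesis using UF_up_mult[OF that(1-3)] that by (auto simp: identities_ultra)
  qed
  note this[of _ _ s] this[of _ _ "s\<dagger>"]
  then show ?thesis using s
    by (auto simp: bisection_def gp_setmult_def composable_ultra ultra_nhd_def)
qed

text \<open>The elements of \<open>s\<^sup>\<down>\<close> whose neighbourhood is finitely covered form an ideal. If it does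
  not contain \<open>s\<close>, the complements of its elements lie in a common ultrafilter, which is not covered.\<close>

lemma compactin_ultra_nhd:
  assumes s: "s \<in> carrier S"
  shows "compactin (gp_top G) (ultra_nhd S s)"
  unfolding compactin_def
proof (intro conjI allI impI)
  show "ultra_nhd S s \<subseteq> topspace (gp_top G)" by (auto simp: ultra_nhd_def)
  fix \<U> assume \<U>: "(\<forall>U\<in>\<U>. openin (gp_top G) U) \<and> ultra_nhd S s \<subseteq> \<Union>\<U>"
  define I where "I = {x \<in> carrier S. x \<preceq> s \<and> (\<exists>\<F>. finite \<F> \<and> \<F> \<subseteq> \<U> \<and> ultra_nhd S x \<subseteq> \<Union>\<F>)}"
  define P where "P = {c \<in> carrier S. \<exists>x\<in>I. c \<preceq> s \<and> disj x c \<and> is_lub (nat_order S) s {x, c}}"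
  have Pcompl: "\<exists>c\<in>P. disj x c" if "x \<in> I" for x
  proof -
    have "x \<preceq> s" using that by (simp add: I_def)
    then show ?thesis using ex_complement[OF s] that unfolding P_def by blast
  qed
  have "s \<in> I"
  proof (rule ccontr)
    assume sI: "s \<notin> I"
    have "ultra_nhd S \<zero> = {}" using UF_zero by (auto simp: ultra_nhd_def)
    then have "\<zero> \<in> I" using s by (auto simp: I_def intro!: exI[of _ "{}"])
    have "\<exists>A\<in>UF. P \<subseteq> A"
    proof (rule ex_UF_containing_base)
      show "P \<subseteq> carrier S" by (auto simp: P_def)
      show "P \<noteq> {}" using Pcompl \<open>\<zero> \<in> I\<close> by blast
      show "\<zero> \<notin> P"
      proof
        assume "\<zero> \<in> P"
        then obtain x where x: "x \<in> I" "is_lub (nat_order S) s {x, \<zero>}" by (auto simp: P_def)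
        have xM: "x \<in> carrier S" "x \<preceq> s" using x by (auto simp: I_def)
        then have "s \<preceq> x" using x is_lub_iff[of "{x, \<zero>}" "nat_order S"] by auto
        then have "s = x" using xM s ord_antisym by blast
        then show False using x sI by simp
      qed
      fix c d assume c: "c \<in> P" and d: "d \<in> P"
      obtain x where x: "x \<in> I" "is_lub (nat_order S) s {x, c}" using c by (auto simp: P_def)
      obtain y where y: "y \<in> I" "is_lub (nat_order S) s {y, d}" using d by (auto simp: P_def)
      have cdM: "c \<in> carrier S" "d \<in> carrier S" "c \<preceq> s" "d \<preceq> s" using c d by (auto simp: P_def)
      have xyM: "x \<in> carrier S" "y \<in> carrier S" "x \<preceq> s" "y \<preceq> s" using x y by (auto simp: I_def)
      have comp: "compatible S x y" by (rule compatible_below[OF xyM(3,4) s])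
      then obtain j where j: "is_lub (nat_order S) j {x, y}"
        using join_exists[of "{x, y}"] compatible_pair xyM by auto
      have jM: "j \<in> carrier S" "x \<preceq> j" "y \<preceq> j" "j \<preceq> s"
        using j xyM s is_lub_iff[of "{x, y}" "nat_order S" j] by auto
      obtain \<F> where \<F>: "finite \<F>" "\<F> \<subseteq> \<U>" "ultra_nhd S x \<subseteq> \<Union>\<F>" using x by (auto simp: I_def)
      obtain \<F>' where \<F>': "finite \<F>'" "\<F>' \<subseteq> \<U>" "ultra_nhd S y \<subseteq> \<Union>\<F>'" using y by (auto simp: I_def)
      \<comment> \<open>Primeness makes \<open>I\<close> closed under joins: two finite subcovers
        together cover the neighbourhood of the join.\<close>
      have "ultra_nhd S j \<subseteq> ultra_nhd S x \<union> ultra_nhd S y"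
        using UF_prime[OF _ xyM(1,2) comp j] by (auto simp: ultra_nhd_def)
      then have "ultra_nhd S j \<subseteq> \<Union>(\<F> \<union> \<F>')" using \<F> \<F>' by auto
      then have "j \<in> I" unfolding I_def using jM \<F> \<F>' by (auto intro!: exI[of _ "\<F> \<union> \<F>'"])
      then obtain b where b: "b \<in> P" "disj j b" using Pcompl by blast
      have bM: "b \<in> carrier S" "b \<preceq> s" using b by (auto simp: P_def)
      \<comment> \<open>The order is checked on ultrafilters. One containing \<open>b\<close>
        contains \<open>s\<close>, hence one of the joinands \<open>x'\<close> and
        \<open>c'\<close>; it cannot be \<open>x'\<close>, since \<open>x' \<preceq> j\<close> and
        \<open>b\<close> has zero meet with \<open>j\<close>.\<close>
      have below: "b \<preceq> c'" if xc: "x' \<in> carrier S" "c' \<in> carrier S" "x' \<preceq> j" "x' \<preceq> s" "c' \<preceq> s"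
        "is_lub (nat_order S) s {x', c'}" for x' c'
      proof (rule UF_subset_imp_ord[OF bM(1) xc(2)])
        fix A assume A: "A \<in> UF" "b \<in> A"
        then have "s \<in> A" using UF_up bM s by blast
        then have "x' \<in> A \<or> c' \<in> A" 
          using UF_prime[OF A(1) xc(1,2) compatible_below[OF xc(4,5) s] xc(6)] by blast
        then show "c' \<in> A" using UF_up[OF A(1) _ xc(3) jM(1)] UF_not_disj[OF A(1) _ A(2)] b(2) by blast
      qed
      show "\<exists>u\<in>P. u \<preceq> c \<and> u \<preceq> d"
        using b(1) below[OF xyM(1) cdM(1) jM(2) xyM(3) cdM(3) x(2)]
          below[OF xyM(2) cdM(2) jM(3) xyM(4) cdM(4) y(2)] by blast
    qed
    then obtain A where A: "A \<in> UF" "P \<subseteq> A" by blast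
    obtain c where c: "c \<in> P" using Pcompl \<open>\<zero> \<in> I\<close> by blast
    then have sA: "s \<in> A" using A UF_up[OF A(1)] s by (auto simp: P_def)
    then obtain W where W: "W \<in> \<U>" "A \<in> W" using \<U> A by (auto simp: ultra_nhd_def)
    have "openin (gp_top G) W" using \<U> W by blast
    then obtain a where a: "a \<in> A" "ultra_nhd S a \<subseteq> W" using W(2) by (auto simp: openin_ultra_iff)
    obtain w where w: "w \<in> A" "w \<preceq> a" "w \<preceq> s" using UF_directed[OF A(1) a(1) sA] by blast
    have wa: "w \<in> carrier S" "a \<in> carrier S" using UF_carrier[OF A(1)] w a by blast+
    have "ultra_nhd S w \<subseteq> \<Union>{W}" using ultra_nhd_mono[OF w(2) wa(2)] a(2) by simp
    \<comment> \<open>A single member of the cover suffices for \<open>w\<close>. Then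
      \<open>P\<close>, and with it \<open>A\<close>, contains a complement of \<open>w\<close>,
      although \<open>w\<close> itself lies in \<open>A\<close>.\<close>
    then have "w \<in> I" unfolding I_def using w(3) wa(1) W(1) by (auto intro!: exI[of _ "{W}"])
    then obtain c' where c': "c' \<in> P" "disj w c'" using Pcompl by blast
    show False using UF_not_disj[OF A(1) w(1) subsetD[OF A(2) c'(1)]] c'(2) by contradiction
  qed
  then show "\<exists>\<F>. finite \<F> \<and> \<F> \<subseteq> \<U> \<and> ultra_nhd S s \<subseteq> \<Union>\<F>" by (auto simp: I_def)
qed

end

lemma compact_open_open_subtopology:
  "openin X U \<Longrightarrow> compact_open (subtopology X U) K \<longleftrightarrow> compact_open X K \<and> K \<subseteq> U"
  by (auto simp: compact_open_def compactin_subtopology openin_open_subtopology)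

text \<open>Because the identities form an open set, a compact-open bisection inside an open set of
  identities is also compact-open in the subspace, so the basis restricts.\<close>

lemma boolean_space_identities:
  assumes "Hausdorff_space (gp_top G)"
    "openin (gp_top G) = arbitrary union_of (\<lambda>B. compact_open (gp_top G) B \<and> bisection G B)"
    and I: "openin (gp_top G) (identities G)"
  shows "boolean_space (identity_space G)"
  unfolding boolean_space_def
proof (intro conjI ext)
  show "Hausdorff_space (identity_space G)"
    using assms by (simp add: identity_space_def Hausdorff_space_subtopology)
  fix W
  show "openin (identity_space G) W = (arbitrary union_of compact_open (identity_space G)) W"
  proof
    assume "openin (identity_space G) W"
    then have W: "openin (gp_top G) W" "W \<subseteq> identities G"
      by (auto simp: identity_space_def openin_open_subtopology[OF I])
    then show "(arbitrary union_of compact_open (identity_space G)) W"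
      unfolding arbitrary_union_of_alt identity_space_def compact_open_open_subtopology[OF I]
      unfolding assms(2) arbitrary_union_of_alt by (meson order_trans)
  next
    assume "(arbitrary union_of compact_open (identity_space G)) W"
    then show "openin (identity_space G) W"
      unfolding arbitrary_union_of_alt by (subst openin_subopen) (auto simp: compact_open_def)
  qed
qed

lemma (in bis) boolean_groupoid_ultra: "boolean_groupoid G"
proof -
  have *: "openin (gp_top G) = arbitrary union_of (\<lambda>B. compact_open (gp_top G) B \<and> bisection G B)"
  proof (intro ext iffI)
    fix W assume W: "openin (gp_top G) W"
    show "(arbitrary union_of (\<lambda>B. compact_open (gp_top G) B \<and> bisection G B)) W"
      unfolding arbitrary_union_of_alt
    proof
      fix A assume A: "A \<in> W"
      then obtain s where s: "s \<in> A" "ultra_nhd S s \<subseteq> W" "A \<in> UF" using W openin_ultra_iff by blast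
      then have "s \<in> carrier S" using UF_carrier by blast
      then show "\<exists>U. (compact_open (gp_top G) U \<and> bisection G U) \<and> A \<in> U \<and> U \<subseteq> W"
        using s openin_ultra_nhd compactin_ultra_nhd bisection_ultra_nhd
        by (intro exI[of _ "ultra_nhd S s"]) (auto simp: compact_open_def ultra_nhd_def)
    qed
  next
    fix W assume "(arbitrary union_of (\<lambda>B. compact_open (gp_top G) B \<and> bisection G B)) W"
    then show "openin (gp_top G) W"
      unfolding arbitrary_union_of_alt by (subst openin_subopen) (auto simp: compact_open_def)
  qed
  then show ?thesis
    unfolding boolean_groupoid_def
    using etale_ultra Hausdorff_ultra boolean_space_identities openin_identities_ultra by blast
qed

section \<open>The semigroup of compact-open bisections\<close>

locale gpd =
  fixes G :: "'a tgpd"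
  assumes groupoid: "groupoid G"
begin

abbreviation comp :: "'a \<Rightarrow> 'a \<Rightarrow> 'a" (infixl \<open>\<star>\<close> 70) where "x \<star> y \<equiv> gp_mult G x y"
abbreviation gi :: "'a \<Rightarrow> 'a" where "gi \<equiv> gp_inv G"
abbreviation D :: "'a \<Rightarrow> 'a" where "D \<equiv> dom_of G"
abbreviation R :: "'a \<Rightarrow> 'a" where "R \<equiv> cod_of G"
abbreviation I :: "'a set" where "I \<equiv> identities G"
abbreviation setmult :: "'a set \<Rightarrow> 'a set \<Rightarrow> 'a set" (infixl \<open>\<diamondop>\<close> 70) where
  "A \<diamondop> B \<equiv> gp_setmult G A B"

lemma gi_arrow [simp]: "x \<in> arrows G \<Longrightarrow> gi x \<in> arrows G"
  and gi_gi [simp]: "x \<in> arrows G \<Longrightarrow> gi (gi x) = x"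
  and comp_D [simp]: "x \<in> arrows G \<Longrightarrow> x \<star> D x = x"
  and R_comp [simp]: "x \<in> arrows G \<Longrightarrow> R x \<star> x = x"
  using groupoid by (auto simp: groupoid_def)

lemma comp_arrow [simp]: "x \<in> arrows G \<Longrightarrow> y \<in> arrows G \<Longrightarrow> D x = R y \<Longrightarrow> x \<star> y \<in> arrows G"
  and D_comp [simp]: "x \<in> arrows G \<Longrightarrow> y \<in> arrows G \<Longrightarrow> D x = R y \<Longrightarrow> D (x \<star> y) = D y"
  and R_comp_eq [simp]: "x \<in> arrows G \<Longrightarrow> y \<in> arrows G \<Longrightarrow> D x = R y \<Longrightarrow> R (x \<star> y) = R x"
  using groupoid by (auto simp: groupoid_def composable_def)

lemma comp_assoc:
  "x \<in> arrows G \<Longrightarrow> y \<in> arrows G \<Longrightarrow> z \<in> arrows G \<Longrightarrow> D x = R y \<Longrightarrow> D y = R z \<Longrightarrow>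
    x \<star> y \<star> z = x \<star> (y \<star> z)"
  using groupoid by (auto simp: groupoid_def composable_def)

lemma D_gi [simp]: "x \<in> arrows G \<Longrightarrow> D (gi x) = R x"
  and R_gi [simp]: "x \<in> arrows G \<Longrightarrow> R (gi x) = D x"
  by (simp_all add: dom_of_def cod_of_def)

lemma gi_comp: "gi x \<star> x = D x" and comp_gi: "x \<star> gi x = R x"
  by (simp_all add: dom_of_def cod_of_def)

lemma D_arrow [simp]: "x \<in> arrows G \<Longrightarrow> D x \<in> arrows G"
  and D_D [simp]: "x \<in> arrows G \<Longrightarrow> D (D x) = D x"
  and R_D [simp]: "x \<in> arrows G \<Longrightarrow> R (D x) = D x"
  using comp_arrow[of "gi x" x] D_comp[of "gi x" x] R_comp_eq[of "gi x" x] by (simp_all add: gi_comp)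

lemma R_arrow [simp]: "x \<in> arrows G \<Longrightarrow> R x \<in> arrows G"
  using D_arrow[of "gi x"] by simp

lemma D_id [simp]: "x \<in> arrows G \<Longrightarrow> D x \<in> I"
  by (simp add: identities_def)

lemma R_id [simp]: "x \<in> arrows G \<Longrightarrow> R x \<in> I"
  using D_id[of "gi x"] by simp

lemma id_arrow: "e \<in> I \<Longrightarrow> e \<in> arrows G"
  and D_of_id: "e \<in> I \<Longrightarrow> D e = e"
  and R_of_id: "e \<in> I \<Longrightarrow> R e = e"
  by (auto simp: identities_def)

lemma id_iff: "e \<in> I \<longleftrightarrow> e \<in> arrows G \<and> D e = e"
  using id_arrow D_of_id D_id by metis

lemma gi_comp_cancel: "x \<in> arrows G \<Longrightarrow> y \<in> arrows G \<Longrightarrow> D x = R y \<Longrightarrow> gi x \<star> (x \<star> y) = y"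
  by (simp add: comp_assoc[symmetric] gi_comp)

lemma comp_gi_cancel: "x \<in> arrows G \<Longrightarrow> y \<in> arrows G \<Longrightarrow> R x = R y \<Longrightarrow> x \<star> (gi x \<star> y) = y"
  by (simp add: comp_assoc[symmetric] comp_gi)

lemma comp_cancel_gi: "x \<in> arrows G \<Longrightarrow> y \<in> arrows G \<Longrightarrow> D y = R x \<Longrightarrow> y \<star> x \<star> gi x = y"
  using comp_D[of y] by (simp add: comp_assoc comp_gi)

lemma gi_cancel_comp: "x \<in> arrows G \<Longrightarrow> y \<in> arrows G \<Longrightarrow> D y = D x \<Longrightarrow> y \<star> gi x \<star> x = y"
  using comp_D[of y] by (simp add: comp_assoc gi_comp)

lemma gi_eqI:
  assumes "x \<in> arrows G" "y \<in> arrows G" "D x = R y" "x \<star> y = R x"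
  shows "gi x = y"
  using gi_comp_cancel[of x y] comp_D[of "gi x"] assms by simp

lemma gi_comp_id_imp_eq:
  assumes "x \<in> arrows G" "y \<in> arrows G" "R x = R y" "gi x \<star> y \<in> I"
  shows "x = y"
proof -
  have "gi x \<star> y = D x" using R_of_id[OF assms(4)] assms by simp
  then show ?thesis using comp_gi_cancel[of x y] assms by simp
qed

lemma comp_gi_id_imp_eq:
  assumes "x \<in> arrows G" "y \<in> arrows G" "D x = D y" "x \<star> gi y \<in> I"
  shows "x = y"
proof -
  have "x \<star> gi y = R y" using D_of_id[OF assms(4)] assms by simp
  then show ?thesis using gi_cancel_comp[of y x] assms by simp
qed

lemma setmultI:
  "x \<in> A \<Longrightarrow> y \<in> B \<Longrightarrow> x \<in> arrows G \<Longrightarrow> y \<in> arrows G \<Longrightarrow> D x = R y \<Longrightarrow> x \<star> y \<in> A \<diamondop> B"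
  unfolding gp_setmult_def composable_def by blast

lemma setmultE:
  assumes "z \<in> A \<diamondop> B"
  obtains x y where "x \<in> A" "y \<in> B" "x \<in> arrows G" "y \<in> arrows G" "D x = R y" "z = x \<star> y"
  using assms unfolding gp_setmult_def composable_def by blast

lemma setmult_arrows: "A \<diamondop> B \<subseteq> arrows G"
  by (auto elim!: setmultE)

lemma setmult_assoc: "A \<diamondop> B \<diamondop> C = A \<diamondop> (B \<diamondop> C)"
proof (intro equalityI subsetI)
  fix z assume "z \<in> A \<diamondop> B \<diamondop> C"
  then obtain v c where v: "v \<in> A \<diamondop> B" "c \<in> C" "c \<in> arrows G" "D v = R c" "z = v \<star> c"
    by (rule setmultE)
  from v(1) obtain a b where "a \<in> A" "b \<in> B" "a \<in> arrows G" "b \<in> arrows G" "D a = R b" "v = a \<star> b"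
    by (rule setmultE)
  moreover have "b \<star> c \<in> B \<diamondop> C" using v calculation by (intro setmultI) auto
  ultimately show "z \<in> A \<diamondop> (B \<diamondop> C)"
    using v setmultI[of a A "b \<star> c" "B \<diamondop> C"] by (simp add: comp_assoc)
next
  fix z assume "z \<in> A \<diamondop> (B \<diamondop> C)"
  then obtain a v where v: "v \<in> B \<diamondop> C" "a \<in> A" "a \<in> arrows G" "D a = R v" "z = a \<star> v"
    by (rule setmultE)
  from v(1) obtain b c where "b \<in> B" "c \<in> C" "b \<in> arrows G" "c \<in> arrows G" "D b = R c" "v = b \<star> c"
    by (rule setmultE)
  moreover have "a \<star> b \<in> A \<diamondop> B" using v calculation by (intro setmultI) auto
  ultimately show "z \<in> A \<diamondop> B \<diamondop> C"
    using v setmultI[of "a \<star> b" "A \<diamondop> B" c C] by (simp add: comp_assoc)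
qed

lemma setmult_mono: "A \<subseteq> A' \<Longrightarrow> B \<subseteq> B' \<Longrightarrow> A \<diamondop> B \<subseteq> A' \<diamondop> B'"
  unfolding gp_setmult_def by blast

lemma setmult_ids_right: "E \<subseteq> I \<Longrightarrow> A \<diamondop> E \<subseteq> A"
  by (auto elim!: setmultE) (metis comp_D R_of_id subsetD)

lemma setmult_ids_left: "E \<subseteq> I \<Longrightarrow> E \<diamondop> A \<subseteq> A"
  by (auto elim!: setmultE) (metis R_comp D_of_id subsetD)

lemma setmult_ids:
  assumes "E \<subseteq> I" "F \<subseteq> I"
  shows "E \<diamondop> F = E \<inter> F"
proof
  show "E \<diamondop> F \<subseteq> E \<inter> F" using setmult_ids_left setmult_ids_right assms by blast
  show "E \<inter> F \<subseteq> E \<diamondop> F"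
  proof
    fix e assume e: "e \<in> E \<inter> F"
    then have "e \<in> I" using assms by blast
    then have "e \<star> e = e" "D e = R e" "e \<in> arrows G" using comp_D[of e] id_arrow D_of_id R_of_id by auto
    then show "e \<in> E \<diamondop> F" using setmultI[of e E e F] e by simp
  qed
qed

text \<open>Elements of the inverse of \<open>A\<close> times \<open>A\<close> have the form
  \<open>gi x \<star> y\<close> with \<open>R x = R y\<close>, and such a product is an identity
  exactly when \<open>x = y\<close>. So being a bisection is injectivity of \<open>D\<close> and
  \<open>R\<close> on \<open>A\<close>, the form used from here on.\<close>

lemma bisection_iff:
  "bisection G A \<longleftrightarrow> A \<subseteq> arrows G \<and> (\<forall>x\<in>A. \<forall>y\<in>A. D x = D y \<longrightarrow> x = y) \<and>
    (\<forall>x\<in>A. \<forall>y\<in>A. R x = R y \<longrightarrow> x = y)"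
proof (cases "A \<subseteq> arrows G")
  case A: True
  have 1: "gi ` A \<diamondop> A \<subseteq> I \<longleftrightarrow> (\<forall>x\<in>A. \<forall>y\<in>A. R x = R y \<longrightarrow> x = y)"
  proof (intro iffI ballI impI subsetI)
    fix x y assume *: "gi ` A \<diamondop> A \<subseteq> I" "x \<in> A" "y \<in> A" "R x = R y"
    then have "gi x \<star> y \<in> I" using A by (intro subsetD[OF *(1)] setmultI) auto
    then show "x = y" using gi_comp_id_imp_eq * A by blast
  next
    fix z assume *: "\<forall>x\<in>A. \<forall>y\<in>A. R x = R y \<longrightarrow> x = y" "z \<in> gi ` A \<diamondop> A"
    then obtain x y where "x \<in> A" "y \<in> A" "D (gi x) = R y" "z = gi x \<star> y"
      by (auto elim!: setmultE)
    moreover from this have "x = y" using * A by auto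
    ultimately show "z \<in> I" using A by (auto simp: gi_comp)
  qed
  have 2: "A \<diamondop> gi ` A \<subseteq> I \<longleftrightarrow> (\<forall>x\<in>A. \<forall>y\<in>A. D x = D y \<longrightarrow> x = y)"
  proof (intro iffI ballI impI subsetI)
    fix x y assume *: "A \<diamondop> gi ` A \<subseteq> I" "x \<in> A" "y \<in> A" "D x = D y"
    then have "x \<star> gi y \<in> I" using A by (intro subsetD[OF *(1)] setmultI) auto
    then show "x = y" using comp_gi_id_imp_eq * A by blast
  next
    fix z assume *: "\<forall>x\<in>A. \<forall>y\<in>A. D x = D y \<longrightarrow> x = y" "z \<in> A \<diamondop> gi ` A"
    then obtain x y where xy: "x \<in> A" "y \<in> A" "D x = R (gi y)" "z = x \<star> gi y"
      by (auto elim!: setmultE)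
    then have "y \<in> arrows G" using A by blast
    then have "x = y" using *(1) xy by simp
    then show "z \<in> I" using xy \<open>y \<in> arrows G\<close> by (simp add: comp_gi)
  qed
  show ?thesis unfolding bisection_def 1 2 using A by (simp add: conj_commute)
qed (auto simp: bisection_def)

lemma bisection_arrows: "bisection G A \<Longrightarrow> A \<subseteq> arrows G"
  and bisection_D: "bisection G A \<Longrightarrow> x \<in> A \<Longrightarrow> y \<in> A \<Longrightarrow> D x = D y \<Longrightarrow> x = y"
  and bisection_R: "bisection G A \<Longrightarrow> x \<in> A \<Longrightarrow> y \<in> A \<Longrightarrow> R x = R y \<Longrightarrow> x = y"
  by (simp_all add: bisection_iff)

lemma bisection_subset: "bisection G A \<Longrightarrow> B \<subseteq> A \<Longrightarrow> bisection G B"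
  unfolding bisection_iff by (simp add: subset_iff)

lemma bisection_setmult:
  assumes A: "bisection G A" and B: "bisection G B"
  shows "bisection G (A \<diamondop> B)"
  unfolding bisection_iff
proof (intro conjI ballI impI setmult_arrows)
  fix z w assume zw: "z \<in> A \<diamondop> B" "w \<in> A \<diamondop> B"
  obtain a b where ab: "a \<in> A" "b \<in> B" "a \<in> arrows G" "b \<in> arrows G" "D a = R b" "z = a \<star> b"
    using zw(1) by (rule setmultE)
  obtain c d where cd: "c \<in> A" "d \<in> B" "c \<in> arrows G" "d \<in> arrows G" "D c = R d" "w = c \<star> d"
    using zw(2) by (rule setmultE)
  {
    assume "D z = D w"
    then have "b = d" using bisection_D[OF B] ab cd by auto
    moreover from this have "a = c" using bisection_D[OF A] ab cd by auto
    ultimately show "z = w" using ab cd by simp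
  }
  {
    assume "R z = R w"
    then have "a = c" using bisection_R[OF A] ab cd by auto
    moreover from this have "b = d" using bisection_R[OF B] ab cd by auto
    ultimately show "z = w" using ab cd by simp
  }
qed

lemma bisection_gi: "bisection G A \<Longrightarrow> bisection G (gi ` A)"
  unfolding bisection_iff by (auto simp: subset_iff)

lemma gi_setmult_bisection:
  assumes A: "bisection G A"
  shows "A \<diamondop> (gi ` A \<diamondop> A) = A"
proof
  show "A \<diamondop> (gi ` A \<diamondop> A) \<subseteq> A" using A by (intro setmult_ids_right) (simp add: bisection_def)
  show "A \<subseteq> A \<diamondop> (gi ` A \<diamondop> A)"
  proof
    fix x assume x: "x \<in> A"
    then have xa: "x \<in> arrows G" using A bisection_arrows by blast
    have "gi x \<star> x \<in> gi ` A \<diamondop> A" using x xa by (intro setmultI) auto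
    then have "x \<star> (gi x \<star> x) \<in> A \<diamondop> (gi ` A \<diamondop> A)" using x xa by (intro setmultI) auto
    then show "x \<in> A \<diamondop> (gi ` A \<diamondop> A)" using xa by (simp add: gi_comp)
  qed
qed

text \<open>Write \<open>z \<in> A\<close> as a product \<open>x \<star> y\<close> of members of
  \<open>A\<close>. It shares its codomain with \<open>x\<close> and its domain with
  \<open>y\<close>, so injectivity of \<open>R\<close> and \<open>D\<close> gives
  \<open>x = z = y\<close>, and an arrow with \<open>z \<star> z = z\<close> is an identity.\<close>

lemma bisection_idem_ids:
  assumes A: "bisection G A" and "A \<diamondop> A = A"
  shows "A \<subseteq> I"
proof
  fix z assume z: "z \<in> A"
  then have "z \<in> A \<diamondop> A" using assms by simp
  then obtain x y where xy: "x \<in> A" "y \<in> A" "x \<in> arrows G" "y \<in> arrows G" "D x = R y" "z = x \<star> y"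
    by (rule setmultE)
  have "z = y" using bisection_D[OF A z xy(2)] xy by simp
  moreover have "z = x" using bisection_R[OF A z xy(1)] xy by simp
  ultimately have "gi z \<star> (z \<star> z) = D z" "z \<in> arrows G" "D z = R z" "z \<star> z = z" 
    using xy by (auto simp: gi_comp)
  then have "z = D z" using gi_comp_cancel[of z z] by simp
  then show "z \<in> I" using \<open>z \<in> arrows G\<close> D_id by metis
qed

end

text \<open>The usual criterion: regular with commuting idempotents. Two inverses \<open>t\<close>
  and \<open>u\<close> of \<open>s\<close> both equal \<open>u \<cdot> s \<cdot> t\<close>, one by
  swapping \<open>t \<cdot> s\<close> with \<open>u \<cdot> s\<close>, the other by swapping
  \<open>s \<cdot> t\<close> with \<open>s \<cdot> u\<close>.\<close>

lemma inverse_semigroupI: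
  fixes S (structure)
  assumes closed: "\<And>s t. s \<in> carrier S \<Longrightarrow> t \<in> carrier S \<Longrightarrow> s \<cdot> t \<in> carrier S"
    and assoc: "\<And>s t u. s \<in> carrier S \<Longrightarrow> t \<in> carrier S \<Longrightarrow> u \<in> carrier S \<Longrightarrow>
      (s \<cdot> t) \<cdot> u = s \<cdot> (t \<cdot> u)"
    and regular: "\<And>s. s \<in> carrier S \<Longrightarrow> \<exists>t\<in>carrier S. s \<cdot> t \<cdot> s = s \<and> t \<cdot> s \<cdot> t = t"
    and commute: "\<And>e f. e \<in> idems S \<Longrightarrow> f \<in> idems S \<Longrightarrow> e \<cdot> f = f \<cdot> e"
  shows "inverse_semigroup S"
proof -
  have "t = u" if M: "s \<in> carrier S" "t \<in> carrier S" "u \<in> carrier S"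
    and t: "s \<cdot> t \<cdot> s = s" "t \<cdot> s \<cdot> t = t" and u: "s \<cdot> u \<cdot> s = s" "u \<cdot> s \<cdot> u = u" for s t u
  proof -
    have idem: "s \<cdot> v \<in> idems S" "v \<cdot> s \<in> idems S"
      if v: "v \<in> carrier S" "s \<cdot> v \<cdot> s = s" "v \<cdot> s \<cdot> v = v" for v
    proof -
      have "s \<cdot> v \<cdot> (s \<cdot> v) = s \<cdot> v \<cdot> s \<cdot> v" using M v(1) by (simp add: assoc closed)
      moreover have "v \<cdot> s \<cdot> (v \<cdot> s) = v \<cdot> s \<cdot> v \<cdot> s" using M v(1) by (simp add: assoc closed)
      ultimately show "s \<cdot> v \<in> idems S" "v \<cdot> s \<in> idems S"
        using M v by (simp_all add: idems_def closed)
    qed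
    have "t = t \<cdot> (s \<cdot> u \<cdot> s) \<cdot> t" using t u by simp
    also have "\<dots> = (t \<cdot> s) \<cdot> (u \<cdot> s) \<cdot> t" using M by (simp add: assoc closed)
    also have "(t \<cdot> s) \<cdot> (u \<cdot> s) = (u \<cdot> s) \<cdot> (t \<cdot> s)" by (intro commute idem M t u)
    also have "\<dots> \<cdot> t = u \<cdot> (s \<cdot> t \<cdot> s) \<cdot> t" using M by (simp add: assoc closed)
    also have "\<dots> = u \<cdot> s \<cdot> t" using t by simp
    finally have 1: "t = u \<cdot> s \<cdot> t" .
    have "u = u \<cdot> (s \<cdot> t \<cdot> s) \<cdot> u" using t u by simp
    also have "\<dots> = u \<cdot> ((s \<cdot> t) \<cdot> (s \<cdot> u))" using M by (simp add: assoc closed)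
    also have "(s \<cdot> t) \<cdot> (s \<cdot> u) = (s \<cdot> u) \<cdot> (s \<cdot> t)" by (intro commute idem M t u)
    also have "u \<cdot> \<dots> = u \<cdot> (s \<cdot> u \<cdot> s) \<cdot> t" using M by (simp add: assoc closed)
    also have "\<dots> = u \<cdot> s \<cdot> t" using u by simp
    finally show "t = u" using 1 by simp
  qed
  then show ?thesis
    unfolding inverse_semigroup_def using closed assoc regular by (intro conjI ballI ex_ex1I) blast+
qed

text \<open>Kept general in \<open>L\<close> because it is applied twice in the next lemma: to the
  whole structure and to each of its principal ideals.\<close>

lemma set_lattice:
  assumes eq: "eq L = (=)"
    and le: "\<And>A B. A \<in> carrier L \<Longrightarrow> B \<in> carrier L \<Longrightarrow> A \<sqsubseteq>\<^bsub>L\<^esub> B \<longleftrightarrow> A \<subseteq> B"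
    and Un: "\<And>A B. A \<in> carrier L \<Longrightarrow> B \<in> carrier L \<Longrightarrow> A \<union> B \<in> carrier L"
    and Int: "\<And>A B. A \<in> carrier L \<Longrightarrow> B \<in> carrier L \<Longrightarrow> A \<inter> B \<in> carrier L"
  shows "lattice L"
    and "A \<in> carrier L \<Longrightarrow> B \<in> carrier L \<Longrightarrow> A \<squnion>\<^bsub>L\<^esub> B = A \<union> B"
    and "A \<in> carrier L \<Longrightarrow> B \<in> carrier L \<Longrightarrow> A \<sqinter>\<^bsub>L\<^esub> B = A \<inter> B"
    and "distributive_lattice L"
proof -
  have lub: "is_lub L (A \<union> B) {A, B}" if "A \<in> carrier L" "B \<in> carrier L" for A B
    using that by (subst is_lub_iff) (auto simp: le Un)
  have glb: "is_glb L (A \<inter> B) {A, B}" if "A \<in> carrier L" "B \<in> carrier L" for A B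
    using that by (subst is_glb_iff) (auto simp: le Int)
  show lat: "lattice L"
  proof unfold_locales
    show "\<exists>s. is_lub L s {A, B}" "\<exists>s. is_glb L s {A, B}"
      if "A \<in> carrier L" "B \<in> carrier L" for A B
      using lub glb that by blast+
  qed (auto simp: eq le)
  then interpret lattice L .
  show un: "A \<squnion>\<^bsub>L\<^esub> B = A \<union> B" if "A \<in> carrier L" "B \<in> carrier L" for A B
    \<comment> \<open>The lattice operations are Hilbert choices of a bound; they are determined
      because least upper bounds are unique when \<open>eq L\<close> is equality.\<close>
    unfolding join_def sup_def by (rule some_equality) (use lub[OF that] least_unique in blast)+
  show int: "A \<sqinter>\<^bsub>L\<^esub> B = A \<inter> B" if "A \<in> carrier L" "B \<in> carrier L" for A B
    unfolding meet_def inf_def by (rule some_equality) (use glb[OF that] greatest_unique in blast)+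
  show "distributive_lattice L"
    unfolding distributive_lattice_def using lat by (auto simp: un int Un Int)
qed

text \<open>For a family of sets ordered by inclusion, the complement of \<open>x\<close> below
  \<open>e\<close> is the set difference \<open>e - x\<close>, so closure under differences replaces
  a top element.\<close>

lemma set_generalized_boolean_algebra:
  assumes eq: "eq L = (=)"
    and le: "\<And>A B. A \<in> carrier L \<Longrightarrow> B \<in> carrier L \<Longrightarrow> A \<sqsubseteq>\<^bsub>L\<^esub> B \<longleftrightarrow> A \<subseteq> B"
    and Un: "\<And>A B. A \<in> carrier L \<Longrightarrow> B \<in> carrier L \<Longrightarrow> A \<union> B \<in> carrier L"
    and Int: "\<And>A B. A \<in> carrier L \<Longrightarrow> B \<in> carrier L \<Longrightarrow> A \<inter> B \<in> carrier L"
    and Diff: "\<And>A B. A \<in> carrier L \<Longrightarrow> B \<in> carrier L \<Longrightarrow> A - B \<in> carrier L"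
    and empty: "{} \<in> carrier L"
  shows "generalized_boolean_algebra L"
  unfolding generalized_boolean_algebra_def
proof (intro conjI ballI)
  note L = set_lattice[OF eq le Un Int]
  show "distributive_lattice L" using L by blast
  interpret lattice L using L(1) by blast
  show "weak_partial_order_bottom L"
    by unfold_locales (use empty in \<open>auto simp: least_def le\<close>)
  fix e assume e: "e \<in> carrier L"
  let ?L = "L\<lparr>carrier := {x \<in> carrier L. x \<sqsubseteq>\<^bsub>L\<^esub> e}\<rparr>"
  have car: "x \<in> carrier ?L \<longleftrightarrow> x \<in> carrier L \<and> x \<subseteq> e" for x using le e by auto
  have eq': "eq ?L = (=)" using eq by simp
  have le': "A \<sqsubseteq>\<^bsub>?L\<^esub> B \<longleftrightarrow> A \<subseteq> B" if "A \<in> carrier ?L" "B \<in> carrier ?L" for A B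
    using that le unfolding car by simp
  note L' = set_lattice[of ?L, OF eq' le']
  have Un': "A \<union> B \<in> carrier ?L" and Int': "A \<inter> B \<in> carrier ?L"
    if "A \<in> carrier ?L" "B \<in> carrier ?L" for A B
    using that unfolding car by (auto simp: Un Int)
  interpret L': lattice ?L by (rule L'(1)[OF _ _ Un' Int'])
  have E: "{} \<in> carrier ?L" "e \<in> carrier ?L" using car empty e by blast+
  have least: "least ?L {} (carrier ?L)"
    unfolding least_def
  proof (intro conjI ballI order_refl E)
    fix x assume x: "x \<in> carrier ?L"
    then show "{} \<sqsubseteq>\<^bsub>?L\<^esub> x" using le'[OF E(1) x] by blast
  qed
  have greatest: "greatest ?L e (carrier ?L)"
    unfolding greatest_def
  proof (intro conjI ballI order_refl E)
    fix x assume x: "x \<in> carrier ?L"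
    then show "x \<sqsubseteq>\<^bsub>?L\<^esub> e" using le'[OF x E(2)] car by blast
  qed
  interpret L': bounded_lattice ?L
    by unfold_locales (use least greatest in blast)+
  have bot: "\<bottom>\<^bsub>?L\<^esub> = {}"
    using L'.bottom_least least L'.least_unique by blast
  have top: "\<top>\<^bsub>?L\<^esub> = e"
    using L'.top_greatest greatest L'.greatest_unique by blast
  show "unital_boolean_algebra ?L"
    unfolding unital_boolean_algebra_def bot top
  proof (intro conjI ballI)
    show "bounded_lattice ?L" ..
    show "distributive_lattice ?L" by (rule L'(4)[OF _ _ Un' Int'])
    fix x assume x: "x \<in> carrier ?L"
    have y: "e - x \<in> carrier ?L" using x Diff e unfolding car by blast
    show "\<exists>y\<in>carrier ?L. x \<sqinter>\<^bsub>?L\<^esub> y = {} \<and> x \<squnion>\<^bsub>?L\<^esub> y = e"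
    proof (rule bexI[OF _ y], intro conjI)
      show "x \<sqinter>\<^bsub>?L\<^esub> (e - x) = {}" by (subst L'(3)[OF _ _ Un' Int' x y]) auto
      show "x \<squnion>\<^bsub>?L\<^esub> (e - x) = e" using x unfolding car by (subst L'(2)[OF _ _ Un' Int' x y]) auto
    qed
  qed
qed

section \<open>Topology of a boolean groupoid and algebra of its compact-open bisections\<close>

locale bgpd = gpd +
  assumes boolean_groupoid: "boolean_groupoid G"

lemma bgpdI: "boolean_groupoid G \<Longrightarrow> bgpd G"
  by unfold_locales
    (auto simp: boolean_groupoid_def etale_groupoid_def topological_groupoid_def)

context bgpd
begin

abbreviation X :: "'a topology" where "X \<equiv> gp_top G"
abbreviation KB :: "'a set sgrp" where "KB \<equiv> bisection_sgrp G"

lemma topspace_X [simp]: "topspace X = arrows G"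
  by (simp add: arrows_def)

lemma Hausdorff: "Hausdorff_space X"
  using boolean_groupoid by (simp add: boolean_groupoid_def)

lemma carrier_KB: "B \<in> carrier KB \<longleftrightarrow> compactin X B \<and> openin X B \<and> bisection G B"
  by (auto simp: bisection_sgrp_def compact_open_def)

lemma mult_KB [simp]: "A \<cdot>\<^bsub>KB\<^esub> B = A \<diamondop> B"
  by (simp add: bisection_sgrp_def)

lemma KB_compact: "B \<in> carrier KB \<Longrightarrow> compactin X B"
  and KB_open: "B \<in> carrier KB \<Longrightarrow> openin X B"
  and KB_bisection: "B \<in> carrier KB \<Longrightarrow> bisection G B"
  by (simp_all add: carrier_KB)

lemma KB_arrows: "B \<in> carrier KB \<Longrightarrow> B \<subseteq> arrows G"
  by (simp add: carrier_KB bisection_arrows)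

lemma KB_closed: "B \<in> carrier KB \<Longrightarrow> closedin X B"
  by (meson KB_compact compactin_imp_closedin Hausdorff)

lemma KB_basis:
  assumes "openin X U" "x \<in> U"
  shows "\<exists>B\<in>carrier KB. x \<in> B \<and> B \<subseteq> U"
proof -
  have "openin X = arbitrary union_of (\<lambda>B. compact_open X B \<and> bisection G B)"
    using boolean_groupoid unfolding boolean_groupoid_def by (elim conjE)
  then have "(arbitrary union_of (\<lambda>B. compact_open X B \<and> bisection G B)) U" using assms by metis
  then obtain B where "compact_open X B \<and> bisection G B" "x \<in> B" "B \<subseteq> U"
    using assms unfolding arbitrary_union_of_alt by blast
  then show ?thesis by (intro bexI[of _ B]) (auto simp: carrier_KB compact_open_def)
qed

lemma continuous_gi: "continuous_map X X gi"
  and continuous_comp: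
    "continuous_map (subtopology (prod_topology X X) (composable G)) X (\<lambda>(x, y). x \<star> y)"
  and local_homeo_D: "local_homeomorphism X (identity_space G) D"
  using boolean_groupoid
  by (auto simp: boolean_groupoid_def etale_groupoid_def topological_groupoid_def)

lemma continuous_compose2:
  assumes f: "continuous_map Y X f" and g: "continuous_map Y X g"
    and c: "\<And>y. y \<in> topspace Y \<Longrightarrow> D (f y) = R (g y)"
  shows "continuous_map Y X (\<lambda>y. f y \<star> g y)"
proof -
  have "continuous_map Y (subtopology (prod_topology X X) (composable G)) (\<lambda>y. (f y, g y))"
    using f g c continuous_map_funspace[OF f] continuous_map_funspace[OF g]
    by (auto simp: continuous_map_in_subtopology continuous_map_pairwise o_def composable_def Pi_iff)
  from continuous_map_compose[OF this continuous_comp] show ?thesis by (simp add: o_def)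
qed

lemma continuous_D: "continuous_map X X D"
proof -
  have "continuous_map X X (\<lambda>x. gi x \<star> x)"
    using continuous_gi by (intro continuous_compose2) (auto simp: id_def[symmetric])
  then show ?thesis by (simp add: gi_comp)
qed

lemma continuous_R: "continuous_map X X R"
proof -
  have "continuous_map X X (\<lambda>x. x \<star> gi x)"
    using continuous_gi by (intro continuous_compose2) (auto simp: id_def[symmetric])
  then show ?thesis by (simp add: comp_gi)
qed

lemma openin_preimage: "continuous_map X X f \<Longrightarrow> openin X U \<Longrightarrow> openin X {x \<in> arrows G. f x \<in> U}"
  using openin_continuous_map_preimage by fastforce

text \<open>Take a bisection \<open>B\<close> around the identity \<open>e\<close>. An arrow
  \<open>x\<close> of \<open>B\<close> whose domain also lies in \<open>B\<close> has the same
  domain as \<open>D x\<close>, so \<open>x = D x\<close>. Such arrows form an open neighbourhood of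
  \<open>e\<close>.\<close>

lemma openin_ids: "openin X I"
proof (subst openin_subopen, intro ballI)
  fix e assume e: "e \<in> I"
  then obtain B where B: "B \<in> carrier KB" "e \<in> B"
    using KB_basis[OF openin_topspace] id_arrow by fastforce
  let ?V = "B \<inter> {x \<in> arrows G. D x \<in> B}"
  have "openin X ?V" using KB_open[OF B(1)] continuous_D by (intro openin_Int openin_preimage)
  moreover have "?V \<subseteq> I"
  proof
    fix x assume x: "x \<in> ?V"
    then have "D x = x" using bisection_D[OF KB_bisection[OF B(1)], of "D x" x] by auto
    then show "x \<in> I" using x by (simp add: id_iff)
  qed
  moreover have "e \<in> ?V" using e B D_of_id id_arrow by auto
  ultimately show "\<exists>T. openin X T \<and> e \<in> T \<and> T \<subseteq> I" by blast
qed

text \<open>Near each arrow \<open>D\<close> is a homeomorphism onto an open part of the identity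
  space, and open sets there are open in the groupoid by \<open>openin_ids\<close>. The local images
  cover \<open>D\<close> followed by \<open>U\<close>, so the openness is global.\<close>

lemma openin_D_image:
  assumes U: "openin X U"
  shows "openin X (D ` U)"
proof (subst openin_subopen, intro ballI)
  fix e assume "e \<in> D ` U"
  then obtain x where x: "x \<in> U" "e = D x" by blast
  then have "x \<in> topspace X" using openin_subset[OF U] by blast
  then obtain V where V: "openin X V" "x \<in> V" "openin (identity_space G) (D ` V)"
    and homeo: "homeomorphic_map (subtopology X V) (subtopology (identity_space G) (D ` V)) D"
    using local_homeo_D unfolding local_homeomorphism_def by blast
  have "openin (subtopology X V) (U \<inter> V)" using U by (auto simp: openin_subtopology)
  then have "openin (subtopology (identity_space G) (D ` V)) (D ` (U \<inter> V))"
    using homeomorphic_imp_open_map[OF homeo] by (auto simp: open_map_def)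
  then have "openin (identity_space G) (D ` (U \<inter> V))" using V openin_trans_full by blast
  then have "openin X (D ` (U \<inter> V))"
    using openin_ids openin_trans_full by (fastforce simp: identity_space_def)
  then show "\<exists>T. openin X T \<and> e \<in> T \<and> T \<subseteq> D ` U" using x V by blast
qed

text \<open>With \<open>\<sigma>\<close> the continuous inverse of \<open>D\<close> on the bisection \<open>B\<close>, an arrow \<open>y\<close> lies in \<open>AB\<close> iff
  \<open>D y \<in> D B\<close> and \<open>y \<sigma>(D y)\<^sup>-\<^sup>1 \<in> A\<close>; both conditions are open.\<close>

lemma openin_setmult:
  assumes A: "openin X A" and B: "B \<in> carrier KB"
  shows "openin X (A \<diamondop> B)"
proof -
  have Bo: "openin X B" and Bb: "bisection G B" and Ba: "B \<subseteq> arrows G"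
    using B KB_open KB_bisection KB_arrows by auto
  have Aa: "A \<subseteq> arrows G" using openin_subset[OF A] by simp
  let ?W = "D ` B"
  have W: "openin X ?W" using Bo by (rule openin_D_image)
  have top: "topspace (subtopology X B) = B" "topspace (subtopology X ?W) = ?W"
    using Ba by auto
  have "homeomorphic_map (subtopology X B) (subtopology X ?W) D"
  proof (rule bijective_open_imp_homeomorphic_map)
    show "continuous_map (subtopology X B) (subtopology X ?W) D"
      using continuous_D Ba by (auto simp: continuous_map_in_subtopology continuous_map_from_subtopology)
    show "open_map (subtopology X B) (subtopology X ?W) D"
      using openin_D_image by (auto simp: open_map_def openin_open_subtopology[OF W] openin_open_subtopology[OF Bo])
    show "D ` topspace (subtopology X B) = topspace (subtopology X ?W)" unfolding top ..
    show "inj_on D (topspace (subtopology X B))"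
      unfolding top by (rule inj_onI) (rule bisection_D[OF Bb])
  qed
  then obtain \<sigma> where "homeomorphic_maps (subtopology X B) (subtopology X ?W) D \<sigma>"
    by (auto simp: homeomorphic_map_maps)
  then have \<sigma>c: "continuous_map (subtopology X ?W) (subtopology X B) \<sigma>"
    and \<sigma>D: "\<And>b. b \<in> B \<Longrightarrow> \<sigma> (D b) = b" 
    unfolding homeomorphic_maps_def top by auto
  have D\<sigma>: "\<sigma> e \<in> B" "D (\<sigma> e) = e" if "e \<in> ?W" for e
    using that \<sigma>D by auto
  let ?V = "{y \<in> arrows G. D y \<in> ?W}"
  have V: "openin X ?V" using W continuous_D by (intro openin_preimage)
  have topV: "topspace (subtopology X ?V) = ?V" by auto
  have "continuous_map (subtopology X ?V) (subtopology X ?W) D"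
    using continuous_D by (auto simp: continuous_map_in_subtopology continuous_map_from_subtopology)
  then have "continuous_map (subtopology X ?V) (subtopology X B) (\<sigma> \<circ> D)"
    using \<sigma>c by (rule continuous_map_compose)
  then have "continuous_map (subtopology X ?V) X (\<sigma> \<circ> D)"
    by (simp add: continuous_map_in_subtopology)
  then have gc: "continuous_map (subtopology X ?V) X (gi \<circ> (\<sigma> \<circ> D))"
    using continuous_gi by (rule continuous_map_compose)
  have c: "continuous_map (subtopology X ?V) X (\<lambda>y. y \<star> (gi \<circ> (\<sigma> \<circ> D)) y)"
  proof (rule continuous_compose2[OF _ gc])
    fix y assume "y \<in> topspace (subtopology X ?V)"
    then have y: "D y \<in> ?W" by auto
    then have "\<sigma> (D y) \<in> arrows G" using D\<sigma> Ba by blast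
    then show "D y = R ((gi \<circ> (\<sigma> \<circ> D)) y)" using D\<sigma>(2)[OF y] by simp
  qed (simp add: continuous_map_from_subtopology)
  let ?f = "\<lambda>y. y \<star> (gi \<circ> (\<sigma> \<circ> D)) y"
  have "openin (subtopology X ?V) {y \<in> ?V. ?f y \<in> A}"
    using openin_continuous_map_preimage[OF c A] topV by simp
  then have "openin X {y \<in> ?V. ?f y \<in> A}" using V openin_trans_full by blast
  moreover have "A \<diamondop> B = {y \<in> ?V. ?f y \<in> A}"
  proof (intro equalityI subsetI)
    fix y assume "y \<in> A \<diamondop> B"
    then obtain a b where ab: "a \<in> A" "b \<in> B" "a \<in> arrows G" "b \<in> arrows G" "D a = R b" "y = a \<star> b"
      by (rule setmultE)
    then show "y \<in> {y \<in> ?V. ?f y \<in> A}" by (simp add: \<sigma>D comp_cancel_gi)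
  next
    fix y assume "y \<in> {y \<in> ?V. ?f y \<in> A}"
    then have y: "y \<in> arrows G" "D y \<in> ?W" "y \<star> gi (\<sigma> (D y)) \<in> A" by auto
    let ?b = "\<sigma> (D y)"
    have b: "?b \<in> B" "D ?b = D y" "?b \<in> arrows G" using D\<sigma> y Ba by auto
    have "y \<star> gi ?b \<star> ?b \<in> A \<diamondop> B" using y b by (intro setmultI) auto
    then show "y \<in> A \<diamondop> B" using gi_cancel_comp[of ?b y] y b by simp
  qed
  ultimately show ?thesis by simp
qed

text \<open>The composable pairs form an equalizer of continuous maps into a Hausdorff space, hence
  a closed set. The product is the continuous image of its intersection with the compact
  rectangle.\<close>

lemma compactin_setmult:
  assumes A: "compactin X A" and B: "compactin X B"
  shows "compactin X (A \<diamondop> B)"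
proof -
  let ?P = "prod_topology X X"
  have "closedin ?P {p \<in> topspace ?P. D (fst p) = R (snd p)}"
    using continuous_map_compose[OF continuous_map_fst continuous_D, of X]
      continuous_map_compose[OF continuous_map_snd continuous_R, of X]
    by (intro closedin_continuous_maps_eq[OF Hausdorff]) (simp_all add: o_def)
  moreover have "{p \<in> topspace ?P. D (fst p) = R (snd p)} = composable G"
    by (auto simp: composable_def)
  ultimately have "closedin ?P (composable G)" by simp
  moreover have "compactin ?P (A \<times> B)" using A B by (simp add: compactin_Times)
  ultimately have "compactin ?P (composable G \<inter> A \<times> B)" by (rule closed_Int_compactin)
  then have "compactin (subtopology ?P (composable G)) (composable G \<inter> A \<times> B)"
    by (simp add: compactin_subtopology)
  then have "compactin X ((\<lambda>(x, y). x \<star> y) ` (composable G \<inter> A \<times> B))"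
    using continuous_comp image_compactin by blast
  moreover have "A \<diamondop> B = (\<lambda>(x, y). x \<star> y) ` (composable G \<inter> A \<times> B)"
    unfolding gp_setmult_def by force
  ultimately show ?thesis by simp
qed

lemma KB_setmult: "A \<in> carrier KB \<Longrightarrow> B \<in> carrier KB \<Longrightarrow> A \<diamondop> B \<in> carrier KB"
  using compactin_setmult openin_setmult bisection_setmult by (simp add: carrier_KB)

lemma KB_gi:
  assumes "A \<in> carrier KB"
  shows "gi ` A \<in> carrier KB"
proof -
  have "gi ` A = {x \<in> arrows G. gi x \<in> A}"
    using KB_arrows[OF assms] by (force simp: image_iff)
  then have "openin X (gi ` A)"
    using openin_preimage[OF continuous_gi KB_open[OF assms]] by simp
  then show ?thesis
    using assms image_compactin continuous_gi bisection_gi by (auto simp: carrier_KB)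
qed

lemma KB_subset:
  assumes "A \<in> carrier KB" "closedin X B" "openin X B" "B \<subseteq> A"
  shows "B \<in> carrier KB"
  using assms closed_compactin bisection_subset by (auto simp: carrier_KB)

lemma KB_Int: "A \<in> carrier KB \<Longrightarrow> B \<in> carrier KB \<Longrightarrow> A \<inter> B \<in> carrier KB"
  by (rule KB_subset[of A]) (auto simp: KB_closed KB_open)

lemma KB_Diff: "A \<in> carrier KB \<Longrightarrow> B \<in> carrier KB \<Longrightarrow> A - B \<in> carrier KB"
  by (rule KB_subset[of A]) (auto simp: KB_closed KB_open closedin_diff openin_diff)

lemma KB_Union:
  "finite \<A> \<Longrightarrow> \<A> \<subseteq> carrier KB \<Longrightarrow> bisection G (\<Union>\<A>) \<Longrightarrow> \<Union>\<A> \<in> carrier KB"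
  unfolding carrier_KB by (intro conjI compactin_Union openin_Union) (auto simp: carrier_KB)

lemma KB_empty: "{} \<in> carrier KB"
  by (simp add: carrier_KB bisection_iff)

lemma idems_KB: "E \<in> idems KB \<longleftrightarrow> E \<in> carrier KB \<and> E \<subseteq> I"
  unfolding idems_def using bisection_idem_ids KB_bisection setmult_ids by auto

lemma inverse_semigroup_KB: "inverse_semigroup KB"
proof (rule inverse_semigroupI)
  fix A assume A: "A \<in> carrier KB"
  have gi2: "gi ` gi ` A = A" using KB_arrows[OF A] by (force simp: image_image)
  show "\<exists>B\<in>carrier KB. A \<cdot>\<^bsub>KB\<^esub> B \<cdot>\<^bsub>KB\<^esub> A = A \<and> B \<cdot>\<^bsub>KB\<^esub> A \<cdot>\<^bsub>KB\<^esub> B = B"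
    using gi_setmult_bisection[OF KB_bisection[OF A]]
      gi_setmult_bisection[OF KB_bisection[OF KB_gi[OF A]]] KB_gi[OF A]
    by (intro bexI[of _ "gi ` A"]) (simp_all add: setmult_assoc gi2)
next
  fix E F assume "E \<in> idems KB" "F \<in> idems KB"
  then show "E \<cdot>\<^bsub>KB\<^esub> F = F \<cdot>\<^bsub>KB\<^esub> E" using setmult_ids by (auto simp: idems_KB)
qed (simp_all add: KB_setmult setmult_assoc)

sublocale K: inv_sgrp KB
  by unfold_locales (rule inverse_semigroup_KB)

lemma inv_KB:
  assumes A: "A \<in> carrier KB"
  shows "sg_inv KB A = gi ` A"
proof -
  have gi2: "gi ` gi ` A = A" using KB_arrows[OF A] by (force simp: image_image)
  show ?thesis
    using gi_setmult_bisection[OF KB_bisection[OF A]]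
      gi_setmult_bisection[OF KB_bisection[OF KB_gi[OF A]]] KB_gi[OF A] A
    by (intro K.inv_unique) (simp_all add: setmult_assoc gi2)
qed

text \<open>For \<open>A \<subseteq> B\<close>, the idempotent that restricts \<open>B\<close> to
  \<open>A\<close> is the set of domains of arrows of \<open>A\<close>: an arrow of \<open>B\<close>
  with the same domain as one of \<open>A\<close> must be that arrow.\<close>

lemma ord_KB:
  assumes A: "A \<in> carrier KB" and B: "B \<in> carrier KB"
  shows "A \<sqsubseteq>\<^bsub>nat_order KB\<^esub> B \<longleftrightarrow> A \<subseteq> B"
proof
  assume "A \<sqsubseteq>\<^bsub>nat_order KB\<^esub> B"
  then obtain E where "E \<subseteq> I" "A = B \<diamondop> E" by (auto simp: le_nat_order idems_KB)
  then show "A \<subseteq> B" using setmult_ids_right by simp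
next
  assume AB: "A \<subseteq> B"
  have Ab: "bisection G A" using KB_bisection[OF A] .
  have E: "gi ` A \<diamondop> A \<in> idems KB"
    using KB_setmult[OF KB_gi[OF A] A] Ab by (simp add: idems_KB bisection_def)
  have "B \<diamondop> (gi ` A \<diamondop> A) \<subseteq> A"
  proof
    fix z assume "z \<in> B \<diamondop> (gi ` A \<diamondop> A)"
    then obtain b e where be: "b \<in> B" "e \<in> gi ` A \<diamondop> A" "b \<in> arrows G" "D b = R e" "z = b \<star> e"
      by (rule setmultE)
    then obtain a c where ac: "a \<in> A" "c \<in> A" "a \<in> arrows G" "c \<in> arrows G" "R a = R c" "e = gi a \<star> c"
      using KB_arrows[OF A] by (auto elim!: setmultE)
    then have "a = c" using bisection_R[OF Ab] by blast
    moreover have "D b = D a" using be ac by simp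
    then have "b = a" using bisection_D[OF KB_bisection[OF B]] be ac AB by blast
    ultimately show "z \<in> A" using be ac by (simp add: gi_comp)
  qed
  moreover have "A \<subseteq> B \<diamondop> (gi ` A \<diamondop> A)"
    using gi_setmult_bisection[OF Ab] setmult_mono[OF AB order_refl] by blast
  ultimately have "A = B \<diamondop> (gi ` A \<diamondop> A)" by blast
  then show "A \<sqsubseteq>\<^bsub>nat_order KB\<^esub> B" using E by (auto simp: le_nat_order)
qed

text \<open>Compatibility is the mixed half of the bisection condition on the union, comparing an
  arrow of \<open>A\<close> with one of \<open>B\<close>. The unmixed half holds since each set is a
  bisection.\<close>

lemma compatible_KB_iff:
  assumes A: "A \<in> carrier KB" and B: "B \<in> carrier KB"
  shows "compatible KB A B \<longleftrightarrow> bisection G (A \<union> B)"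
proof
  have a: "A \<subseteq> arrows G" "B \<subseteq> arrows G" using KB_arrows assms by auto
  {
    assume "compatible KB A B"
    then have sub: "gi ` A \<diamondop> B \<subseteq> I" "A \<diamondop> gi ` B \<subseteq> I"
      using assms by (auto simp: compatible_def inv_KB idems_KB)
    have 1: "x = y" if "x \<in> A" "y \<in> B" "R x = R y" for x y
    proof -
      have "gi x \<star> y \<in> gi ` A \<diamondop> B" using that a by (intro setmultI) auto
      then show ?thesis using gi_comp_id_imp_eq that a sub by blast
    qed
    have 2: "x = y" if "x \<in> A" "y \<in> B" "D x = D y" for x y
    proof -
      have "x \<star> gi y \<in> A \<diamondop> gi ` B" using that a by (intro setmultI) auto
      then show ?thesis using comp_gi_id_imp_eq that a sub by blast
    qed
    have 3: "y = x" if "x \<in> A" "y \<in> B" "R y = R x" for x y using 1 that by metis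
    have 4: "y = x" if "x \<in> A" "y \<in> B" "D y = D x" for x y using 2 that by metis
    show "bisection G (A \<union> B)"
      unfolding bisection_iff
      using a 1 2 3 4 bisection_D[OF KB_bisection[OF A]] bisection_D[OF KB_bisection[OF B]]
        bisection_R[OF KB_bisection[OF A]] bisection_R[OF KB_bisection[OF B]]
      by (intro conjI ballI impI) (auto)
  }
  {
    assume *: "bisection G (A \<union> B)"
    then have "gi ` (A \<union> B) \<diamondop> (A \<union> B) \<subseteq> I" "(A \<union> B) \<diamondop> gi ` (A \<union> B) \<subseteq> I"
      by (simp_all add: bisection_def)
    moreover have "gi ` A \<diamondop> B \<subseteq> gi ` (A \<union> B) \<diamondop> (A \<union> B)" "A \<diamondop> gi ` B \<subseteq> (A \<union> B) \<diamondop> gi ` (A \<union> B)"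
      by (intro setmult_mono; blast)+
    ultimately show "compatible KB A B"
      using assms KB_setmult KB_gi by (auto simp: compatible_def inv_KB idems_KB)
  }
qed

text \<open>Being a bisection is a condition on two arrows at a time, so pairwise unions decide it
  for the whole family.\<close>

lemma compatible_Union:
  assumes "finite \<A>" "compatible_subset KB \<A>"
  shows "\<Union>\<A> \<in> carrier KB"
proof (rule KB_Union)
  have A: "A \<in> carrier KB" if "A \<in> \<A>" for A using that assms by (auto simp: compatible_subset_def)
  have *: "bisection G (A \<union> B)" if "A \<in> \<A>" "B \<in> \<A>" for A B
    using compatible_KB_iff[OF A A] that assms unfolding compatible_subset_def by blast
  show "bisection G (\<Union>\<A>)"
    unfolding bisection_iff
  proof (intro conjI ballI impI)
    show "\<Union>\<A> \<subseteq> arrows G" using A KB_arrows by blast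
    fix x y assume "x \<in> \<Union>\<A>" "y \<in> \<Union>\<A>"
    then obtain A B where AB: "A \<in> \<A>" "B \<in> \<A>" "x \<in> A \<union> B" "y \<in> A \<union> B" by blast
    show "x = y" if "D x = D y" by (rule bisection_D[OF *[OF AB(1,2)] AB(3,4) that])
    show "x = y" if "R x = R y" by (rule bisection_R[OF *[OF AB(1,2)] AB(3,4) that])
  qed
qed (use assms in \<open>auto simp: compatible_subset_def\<close>)

lemma is_lub_KB:
  assumes "\<A> \<subseteq> carrier KB" "\<Union>\<A> \<in> carrier KB"
  shows "is_lub (nat_order KB) (\<Union>\<A>) \<A>"
proof -
  have A: "A \<in> carrier KB" if "A \<in> \<A>" for A using that assms by blast
  show ?thesis using assms by (subst is_lub_iff) (auto simp: ord_KB A Union_upper Union_least)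
qed

lemma is_lub_KB_iff:
  assumes "finite \<A>" "compatible_subset KB \<A>"
  shows "is_lub (nat_order KB) J \<A> \<longleftrightarrow> J = \<Union>\<A>"
  using is_lub_KB[OF _ compatible_Union[OF assms]] K.is_lub_unique assms
  unfolding compatible_subset_def by blast

lemma is_glb_KB_iff:
  assumes "A \<in> carrier KB" "B \<in> carrier KB"
  shows "is_glb (nat_order KB) J {A, B} \<longleftrightarrow> J = A \<inter> B"
proof -
  have "is_glb (nat_order KB) (A \<inter> B) {A, B}"
    using assms by (subst is_glb_iff) (auto simp: ord_KB KB_Int)
  then show ?thesis using K.is_glb_unique by blast
qed

lemma distributive_KB: "distributive_inverse_semigroup KB"
  unfolding distributive_inverse_semigroup_def
proof (intro conjI allI impI ballI inverse_semigroup_KB)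
  show "\<exists>J. is_lub (nat_order KB) J \<A>" if "finite \<A> \<and> compatible_subset KB \<A>" for \<A>
    using is_lub_KB_iff that by blast
  fix \<A> J A
  assume *: "finite \<A> \<and> compatible_subset KB \<A> \<and> is_lub (nat_order KB) J \<A>" and A: "A \<in> carrier KB"
  then have J: "J = \<Union>\<A>" "J \<in> carrier KB" and sub: "\<A> \<subseteq> carrier KB"
    using is_lub_KB_iff compatible_Union by (auto simp: compatible_subset_def)
  have 1: "A \<diamondop> J = \<Union>((\<lambda>B. A \<cdot>\<^bsub>KB\<^esub> B) ` \<A>)" "J \<diamondop> A = \<Union>((\<lambda>B. B \<cdot>\<^bsub>KB\<^esub> A) ` \<A>)"
    unfolding J by (auto simp: gp_setmult_def)
  have 2: "A \<diamondop> J \<in> carrier KB" "J \<diamondop> A \<in> carrier KB" using A J KB_setmult by auto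
  show "is_lub (nat_order KB) (A \<cdot>\<^bsub>KB\<^esub> J) ((\<lambda>B. A \<cdot>\<^bsub>KB\<^esub> B) ` \<A>)"
    using 2 sub A KB_setmult unfolding mult_KB[of A J] 1 by (intro is_lub_KB) auto
  show "is_lub (nat_order KB) (J \<cdot>\<^bsub>KB\<^esub> A) ((\<lambda>B. B \<cdot>\<^bsub>KB\<^esub> A) ` \<A>)"
    using 2 sub A KB_setmult unfolding mult_KB[of J A] 1 by (intro is_lub_KB) auto
qed

lemma boolean_inverse_semigroup_KB: "boolean_inverse_semigroup KB"
  unfolding boolean_inverse_semigroup_def
proof (intro conjI ballI distributive_KB)
  show "generalized_boolean_algebra ((nat_order KB)\<lparr>carrier := idems KB\<rparr>)"
  proof (rule set_generalized_boolean_algebra)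
    fix E F assume *: "E \<in> carrier ((nat_order KB)\<lparr>carrier := idems KB\<rparr>)"
      "F \<in> carrier ((nat_order KB)\<lparr>carrier := idems KB\<rparr>)"
    then have EF: "E \<in> carrier KB" "E \<subseteq> I" "F \<in> carrier KB" "F \<subseteq> I" by (auto simp: idems_KB)
    show "E \<sqsubseteq>\<^bsub>(nat_order KB)\<lparr>carrier := idems KB\<rparr>\<^esub> F \<longleftrightarrow> E \<subseteq> F" using ord_KB EF by simp
    \<comment> \<open>Unions of bisections may fail to be bisections, but sets of identities always
      lie inside the bisection \<open>I\<close>; this is why the idempotents are closed under all
      binary unions.\<close>
    have "bisection G I" using id_arrow D_of_id R_of_id by (auto simp: bisection_iff)
    then have "bisection G (\<Union>{E, F})" using EF by (auto intro: bisection_subset)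
    then have "\<Union>{E, F} \<in> carrier KB" using EF by (intro KB_Union) auto
    then show "E \<union> F \<in> carrier ((nat_order KB)\<lparr>carrier := idems KB\<rparr>)" using EF by (simp add: idems_KB)
    show "E \<inter> F \<in> carrier ((nat_order KB)\<lparr>carrier := idems KB\<rparr>)"
      "E - F \<in> carrier ((nat_order KB)\<lparr>carrier := idems KB\<rparr>)"
      using EF KB_Int KB_Diff by (auto simp: idems_KB)
  qed (simp_all add: idems_KB KB_empty)
  show "\<exists>M. is_glb (nat_order KB) M {A, B}" if "A \<in> carrier KB" "B \<in> carrier KB" for A B
    using is_glb_KB_iff that by blast
qed

sublocale K: bis KB
  by (rule bisI) (rule boolean_inverse_semigroup_KB)

lemma zero_KB: "sg_zero KB = {}"
  by (rule K.sg_zero_eqI) (auto simp: KB_empty gp_setmult_def)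

section \<open>Ultrafilters of compact-open bisections are the arrows\<close>

definition point_filter :: "'a \<Rightarrow> 'a set set" where
  "point_filter g = {B \<in> carrier KB. g \<in> B}"

lemma point_filter_proper:
  assumes "g \<in> arrows G"
  shows "proper_filter KB (point_filter g)"
proof (rule K.proper_filterI)
  show "point_filter g \<noteq> {}"
    using KB_basis[OF openin_topspace] assms by (auto simp: point_filter_def)
  show "B \<in> point_filter g" if "A \<in> point_filter g" "A \<sqsubseteq>\<^bsub>nat_order KB\<^esub> B" "B \<in> carrier KB" for A B
    using that ord_KB by (auto simp: point_filter_def)
  fix A B assume "A \<in> point_filter g" "B \<in> point_filter g"
  then show "\<exists>C\<in>point_filter g. C \<sqsubseteq>\<^bsub>nat_order KB\<^esub> A \<and> C \<sqsubseteq>\<^bsub>nat_order KB\<^esub> B"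
    using KB_Int ord_KB by (intro bexI[of _ "A \<inter> B"]) (auto simp: point_filter_def)
qed (auto simp: point_filter_def zero_KB)

text \<open>Members of \<open>F\<close> are compact in a Hausdorff space, hence closed. Inside one
  compact member \<open>B\<close> they have the finite intersection property, and a common point
  \<open>g\<close> has all of \<open>F\<close> among its bisections.\<close>

lemma filter_subset_point_filter:
  assumes F: "proper_filter KB F"
  shows "\<exists>g\<in>arrows G. F \<subseteq> point_filter g"
proof -
  have FK: "F \<subseteq> carrier KB" using K.filter_carrier[OF F] .
  obtain B where B: "B \<in> F" using K.filter_nonempty[OF F] by blast
  \<comment> \<open>Directedness places a single member of \<open>F\<close> inside every finite
    intersection, and members of \<open>F\<close> are nonempty because the zero of \<open>KB\<close>
    is the empty set.\<close>
  have fin: "\<exists>C\<in>F. C \<subseteq> B \<inter> \<Inter>\<F>" if "finite \<F>" "\<F> \<subseteq> F" for \<F>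
    using that
  proof (induction \<F>)
    case empty
    then show ?case using B by auto
  next
    case (insert A \<F>)
    then obtain C where C: "C \<in> F" "C \<subseteq> B \<inter> \<Inter>\<F>" by auto
    obtain C' where "C' \<in> F" "C' \<sqsubseteq>\<^bsub>nat_order KB\<^esub> A" "C' \<sqsubseteq>\<^bsub>nat_order KB\<^esub> C"
      using K.filter_directed[OF F, of A C] insert.prems C(1) by blast
    moreover have "A \<in> carrier KB" "C \<in> carrier KB" "C' \<in> carrier KB"
      using FK insert.prems C(1) calculation by blast+
    ultimately have C': "C' \<in> F" "C' \<subseteq> A" "C' \<subseteq> C" by (simp_all add: ord_KB)
    have "C' \<subseteq> B \<inter> \<Inter>\<F>" using C'(3) C(2) by (rule subset_trans)
    then have "C' \<subseteq> B \<inter> \<Inter>(insert A \<F>)" using C'(2) by (simp add: le_inf_iff)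
    then show ?case using C'(1) by (rule bexI)
  qed
  have "B \<inter> \<Inter>F \<noteq> {}"
  proof -
    have "compactin X B" using KB_compact B FK by blast
    moreover have "\<forall>C\<in>F. closedin X C" using KB_closed FK by blast
    moreover have "B \<inter> \<Inter>\<F> \<noteq> {}" if \<F>: "finite \<F>" "\<F> \<subseteq> F" for \<F>
    proof -
      obtain C where C: "C \<in> F" "C \<subseteq> B \<inter> \<Inter>\<F>" using fin[OF \<F>] by (rule bexE)
      have "C \<noteq> {}" using C(1) K.filter_zero[OF F] unfolding zero_KB by metis
      then show ?thesis using C(2) by force
    qed
    ultimately show ?thesis unfolding compactin_fip by simp
  qed
  then obtain g where "g \<in> B" "\<And>C. C \<in> F \<Longrightarrow> g \<in> C" by blast
  then show ?thesis using FK KB_arrows B by (intro bexI[of _ g]) (auto simp: point_filter_def)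
qed

text \<open>Hausdorffness and the basis give a compact-open bisection through \<open>g\<close> that
  avoids \<open>h\<close>. Inclusion in one direction is enough for this, which yields maximality of
  \<open>point_filter g\<close> and not only injectivity.\<close>

lemma point_filter_inj:
  assumes "g \<in> arrows G" "h \<in> arrows G" "point_filter g \<subseteq> point_filter h"
  shows "g = h"
proof (rule ccontr)
  assume "g \<noteq> h"
  then obtain U V where UV: "openin X U" "openin X V" "g \<in> U" "h \<in> V" "disjnt U V"
    using Hausdorff assms(1,2) unfolding Hausdorff_space_def topspace_X by blast
  then obtain B where "B \<in> carrier KB" "g \<in> B" "B \<subseteq> U" using KB_basis by blast
  then show False using assms(3) UV by (auto simp: point_filter_def disjnt_def)
qed

text \<open>Every proper filter lies under a point filter. For an ultrafilter this is equality;
  conversely a filter above \<open>point_filter g\<close> lies under some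
  \<open>point_filter h\<close>, and then \<open>g = h\<close>.\<close>

lemma ultrafilters_KB: "ultrafilters KB = point_filter ` arrows G"
proof (intro equalityI subsetI)
  fix F assume F: "F \<in> ultrafilters KB"
  then obtain g where "g \<in> arrows G" "F \<subseteq> point_filter g"
    using filter_subset_point_filter K.UF_filter by blast
  then show "F \<in> point_filter ` arrows G" using K.UF_max[OF F] point_filter_proper by blast
next
  fix F assume "F \<in> point_filter ` arrows G"
  then obtain g where g: "g \<in> arrows G" "F = point_filter g" by blast
  show "F \<in> ultrafilters KB"
    unfolding g(2)
  proof (rule K.UF_I[OF point_filter_proper[OF g(1)]])
    fix F' assume F': "proper_filter KB F'" "point_filter g \<subseteq> F'"
    then obtain h where "h \<in> arrows G" "F' \<subseteq> point_filter h"
      using filter_subset_point_filter by blast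
    moreover from this have "g = h" using point_filter_inj g F' by blast
    ultimately show "F' \<subseteq> point_filter g" by simp
  qed
qed

end

section \<open>Callitic morphisms\<close>

lemma bis_hom_closed: "\<theta> \<in> bis_hom S T \<Longrightarrow> s \<in> carrier S \<Longrightarrow> \<theta> s \<in> carrier T"
  and bis_hom_mult: "\<theta> \<in> bis_hom S T \<Longrightarrow> s \<in> carrier S \<Longrightarrow> t \<in> carrier S \<Longrightarrow>
    \<theta> (s \<cdot>\<^bsub>S\<^esub> t) = \<theta> s \<cdot>\<^bsub>T\<^esub> \<theta> t"
  and bis_hom_glb: "\<theta> \<in> bis_hom S T \<Longrightarrow> s \<in> carrier S \<Longrightarrow> t \<in> carrier S \<Longrightarrow>
    is_glb (nat_order S) m {s, t} \<Longrightarrow> is_glb (nat_order T) (\<theta> m) {\<theta> s, \<theta> t}"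
  and bis_hom_lub: "\<theta> \<in> bis_hom S T \<Longrightarrow> s \<in> carrier S \<Longrightarrow> t \<in> carrier S \<Longrightarrow> compatible S s t \<Longrightarrow>
    is_lub (nat_order S) j {s, t} \<Longrightarrow> is_lub (nat_order T) (\<theta> j) {\<theta> s, \<theta> t}"
  by (auto simp: bis_hom_def)

text \<open>This and the following transfer lemmas assume only multiplicativity, since
  \<open>hom_ord\<close> is later applied to a bijection not yet known to preserve meets and
  joins.\<close>

lemma hom_idem:
  assumes "\<theta> \<in> carrier S \<rightarrow> carrier T"
    and "\<And>s t. s \<in> carrier S \<Longrightarrow> t \<in> carrier S \<Longrightarrow> \<theta> (s \<cdot>\<^bsub>S\<^esub> t) = \<theta> s \<cdot>\<^bsub>T\<^esub> \<theta> t"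
    and "e \<in> idems S"
  shows "\<theta> e \<in> idems T"
  using assms by (force simp: idems_def)

lemma hom_inv:
  assumes S: "inv_sgrp S" and T: "inv_sgrp T" and c: "\<theta> \<in> carrier S \<rightarrow> carrier T"
    and m: "\<And>s t. s \<in> carrier S \<Longrightarrow> t \<in> carrier S \<Longrightarrow> \<theta> (s \<cdot>\<^bsub>S\<^esub> t) = \<theta> s \<cdot>\<^bsub>T\<^esub> \<theta> t"
    and s: "s \<in> carrier S"
  shows "\<theta> (sg_inv S s) = sg_inv T (\<theta> s)"
proof (rule inv_sgrp.inv_unique[OF T, symmetric])
  interpret S: inv_sgrp S by (rule S)
  show "\<theta> s \<in> carrier T" "\<theta> (sg_inv S s) \<in> carrier T" using c s by auto
  have "\<theta> s \<cdot>\<^bsub>T\<^esub> \<theta> (sg_inv S s) \<cdot>\<^bsub>T\<^esub> \<theta> s = \<theta> (s \<cdot>\<^bsub>S\<^esub> sg_inv S s \<cdot>\<^bsub>S\<^esub> s)" using s by (simp add: m)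
  then show "\<theta> s \<cdot>\<^bsub>T\<^esub> \<theta> (sg_inv S s) \<cdot>\<^bsub>T\<^esub> \<theta> s = \<theta> s" using S.sg_inv_props[OF s] by simp
  have "\<theta> (sg_inv S s) \<cdot>\<^bsub>T\<^esub> \<theta> s \<cdot>\<^bsub>T\<^esub> \<theta> (sg_inv S s) = \<theta> (sg_inv S s \<cdot>\<^bsub>S\<^esub> s \<cdot>\<^bsub>S\<^esub> sg_inv S s)"
    using s by (simp add: m)
  then show "\<theta> (sg_inv S s) \<cdot>\<^bsub>T\<^esub> \<theta> s \<cdot>\<^bsub>T\<^esub> \<theta> (sg_inv S s) = \<theta> (sg_inv S s)"
    using S.sg_inv_props[OF s] by simp
qed

lemma hom_ord:
  assumes "\<theta> \<in> carrier S \<rightarrow> carrier T"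
    and "\<And>s t. s \<in> carrier S \<Longrightarrow> t \<in> carrier S \<Longrightarrow> \<theta> (s \<cdot>\<^bsub>S\<^esub> t) = \<theta> s \<cdot>\<^bsub>T\<^esub> \<theta> t"
    and "t \<in> carrier S" "s \<sqsubseteq>\<^bsub>nat_order S\<^esub> t"
  shows "\<theta> s \<sqsubseteq>\<^bsub>nat_order T\<^esub> \<theta> t"
proof -
  obtain e where e: "e \<in> idems S" "s = t \<cdot>\<^bsub>S\<^esub> e" using assms(4) by (auto simp: le_nat_order)
  then have "\<theta> s = \<theta> t \<cdot>\<^bsub>T\<^esub> \<theta> e" using assms(2)[OF assms(3), of e] by (simp add: idems_def)
  then show ?thesis unfolding le_nat_order using hom_idem[OF assms(1,2) e(1)] by blast
qed

lemma hom_compatible: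
  assumes S: "inv_sgrp S" and T: "inv_sgrp T" and c: "\<theta> \<in> carrier S \<rightarrow> carrier T"
    and m: "\<And>s t. s \<in> carrier S \<Longrightarrow> t \<in> carrier S \<Longrightarrow> \<theta> (s \<cdot>\<^bsub>S\<^esub> t) = \<theta> s \<cdot>\<^bsub>T\<^esub> \<theta> t"
    and s: "s \<in> carrier S" "t \<in> carrier S" and st: "compatible S s t"
  shows "compatible T (\<theta> s) (\<theta> t)"
proof -
  interpret S: inv_sgrp S by (rule S)
  have "\<theta> (sg_inv S s \<cdot>\<^bsub>S\<^esub> t) \<in> idems T" "\<theta> (s \<cdot>\<^bsub>S\<^esub> sg_inv S t) \<in> idems T"
    using hom_idem[OF c m] st by (auto simp: compatible_def)
  then show ?thesis using s by (simp add: compatible_def m hom_inv[OF S T c m])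
qed

lemma (in inv_sgrp) id_callitic: "(\<lambda>s\<in>carrier S. s) \<in> callitic_hom S S"
proof -
  have "(\<lambda>s\<in>carrier S. s) \<in> bis_hom S S"
    by (auto simp: bis_hom_def least_def greatest_def Upper_def Lower_def)
  moreover have "{s \<in> carrier S. (\<lambda>s\<in>carrier S. s) s \<in> F} = F" if "F \<in> ultrafilters S" for F
    using that by (auto simp: ultrafilters_def proper_filter_def)
  ultimately show ?thesis by (simp add: callitic_hom_def)
qed

lemma compose_callitic:
  assumes S: "inv_sgrp S" and T: "inv_sgrp T"
    and \<theta>: "\<theta> \<in> callitic_hom S T" and \<phi>: "\<phi> \<in> callitic_hom T U"
  shows "compose (carrier S) \<phi> \<theta> \<in> callitic_hom S U"
proof -
  interpret S: inv_sgrp S by (rule S)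
  let ?c = "compose (carrier S) \<phi> \<theta>"
  have h: "\<theta> \<in> bis_hom S T" "\<phi> \<in> bis_hom T U" using assms by (auto simp: callitic_hom_def)
  note c1 = bis_hom_closed[OF h(1)] and c2 = bis_hom_closed[OF h(2)]
  have "?c \<in> bis_hom S U"
    unfolding bis_hom_def
  proof (intro CollectI conjI ballI allI impI)
    show "?c \<in> carrier S \<rightarrow>\<^sub>E carrier U" using c1 c2 by (auto simp: compose_def)
    fix s t assume st: "s \<in> carrier S" "t \<in> carrier S"
    show "?c (s \<cdot>\<^bsub>S\<^esub> t) = ?c s \<cdot>\<^bsub>U\<^esub> ?c t"
      using st c1 by (simp add: compose_def bis_hom_mult[OF h(1)] bis_hom_mult[OF h(2)])
    show "is_glb (nat_order U) (?c m) {?c s, ?c t}"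
      if m: "is_glb (nat_order S) m {s, t}" for m
    proof -
      have "m \<in> carrier S" using m by (auto simp: greatest_def Lower_def)
      then show ?thesis
        using bis_hom_glb[OF h(2) c1 c1 bis_hom_glb[OF h(1) st m]] st by (simp add: compose_def)
    qed
    show "is_lub (nat_order U) (?c j) {?c s, ?c t}"
      if j: "compatible S s t \<and> is_lub (nat_order S) j {s, t}" for j
    proof -
      have "j \<in> carrier S" using j by (auto simp: least_def Upper_def)
      \<comment> \<open>The second morphism preserves only joins of compatible pairs, so
        compatibility has to be carried along the first one.\<close>
      moreover have "compatible T (\<theta> s) (\<theta> t)"
        using hom_compatible[OF S T _ bis_hom_mult[OF h(1)]] c1 st j by blast
      ultimately show ?thesis
        using bis_hom_lub[OF h(2) c1 c1 _ bis_hom_lub[OF h(1) st, of j]] st j by (simp add: compose_def)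
    qed
  qed
  moreover have "{s \<in> carrier S. ?c s \<in> F} \<in> ultrafilters S" if F: "F \<in> ultrafilters U" for F
  proof -
    have "{t \<in> carrier T. \<phi> t \<in> F} \<in> ultrafilters T" using \<phi> F by (auto simp: callitic_hom_def)
    then have "{s \<in> carrier S. \<theta> s \<in> {t \<in> carrier T. \<phi> t \<in> F}} \<in> ultrafilters S"
      using \<theta> by (auto simp: callitic_hom_def)
    moreover have "{s \<in> carrier S. \<theta> s \<in> {t \<in> carrier T. \<phi> t \<in> F}} = {s \<in> carrier S. ?c s \<in> F}"
      using c1 by (auto simp: compose_def)
    ultimately show ?thesis by simp
  qed
  ultimately show ?thesis by (simp add: callitic_hom_def)
qed

text \<open>The natural order, compatibility and zero are all defined from the multiplication, so a
  multiplicative bijection transports meets, joins and ultrafilters. For the unit of the duality it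
  therefore suffices to check bijectivity and products.\<close>

lemma bij_hom_callitic:
  assumes S: "bis S" and T: "bis T" and ext: "\<theta> \<in> extensional (carrier S)"
    and bij: "bij_betw \<theta> (carrier S) (carrier T)"
    and m: "\<And>s t. s \<in> carrier S \<Longrightarrow> t \<in> carrier S \<Longrightarrow> \<theta> (s \<cdot>\<^bsub>S\<^esub> t) = \<theta> s \<cdot>\<^bsub>T\<^esub> \<theta> t"
  shows "\<theta> \<in> callitic_hom S T"
proof -
  interpret S: bis S by (rule S)
  interpret T: bis T by (rule T)
  have c: "\<theta> \<in> carrier S \<rightarrow> carrier T" and inj: "inj_on \<theta> (carrier S)" and im: "\<theta> ` carrier S = carrier T"
    using bij by (auto simp: bij_betw_def)
  \<comment> \<open>Reflecting the order needs the idempotent in \<open>T\<close> to come from one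
    in \<open>S\<close>: its preimage \<open>e\<close> is idempotent by injectivity.\<close>
  have ord: "\<theta> s \<sqsubseteq>\<^bsub>nat_order T\<^esub> \<theta> t \<longleftrightarrow> s \<sqsubseteq>\<^bsub>nat_order S\<^esub> t" if st: "s \<in> carrier S" "t \<in> carrier S" for s t
  proof
    assume "\<theta> s \<sqsubseteq>\<^bsub>nat_order T\<^esub> \<theta> t"
    then obtain f where f: "f \<in> idems T" "\<theta> s = \<theta> t \<cdot>\<^bsub>T\<^esub> f" by (auto simp: le_nat_order)
    then obtain e where e: "e \<in> carrier S" "f = \<theta> e" using im T.idem_carrier by blast
    have "\<theta> (e \<cdot>\<^bsub>S\<^esub> e) = \<theta> e" using T.idem_mult[OF f(1)] e m by simp
    then have "e \<cdot>\<^bsub>S\<^esub> e = e" using inj_onD[OF inj] e by blast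
    then have "e \<in> idems S" using e S.idemI by blast
    moreover have "\<theta> s = \<theta> (t \<cdot>\<^bsub>S\<^esub> e)" using f e m st by simp
    then have "s = t \<cdot>\<^bsub>S\<^esub> e" using inj_onD[OF inj] e st by blast
    ultimately show "s \<sqsubseteq>\<^bsub>nat_order S\<^esub> t" by (auto simp: le_nat_order)
  qed (use hom_ord[OF c m] st in blast)
  have "\<theta> \<in> bis_hom S T"
    unfolding bis_hom_def
  proof (intro CollectI conjI ballI allI impI)
    show "\<theta> \<in> carrier S \<rightarrow>\<^sub>E carrier T" using c ext by (auto simp: PiE_def)
    fix s t assume st: "s \<in> carrier S" "t \<in> carrier S"
    then have \<theta>st: "\<theta> s \<in> carrier T" "\<theta> t \<in> carrier T" using c by auto
    show "is_glb (nat_order T) (\<theta> x) {\<theta> s, \<theta> t}" if "is_glb (nat_order S) x {s, t}" for x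
      using that st \<theta>st c unfolding im[symmetric] by (simp add: is_glb_iff im[symmetric] ord)
    show "is_lub (nat_order T) (\<theta> x) {\<theta> s, \<theta> t}" if "compatible S s t \<and> is_lub (nat_order S) x {s, t}" for x
      using that st \<theta>st c by (simp add: is_lub_iff im[symmetric] ord)
  qed (rule m)
  moreover have "{s \<in> carrier S. \<theta> s \<in> F} \<in> ultrafilters S" if F: "F \<in> ultrafilters T" for F
  proof (rule S.UF_I)
    let ?P = "{s \<in> carrier S. \<theta> s \<in> F}"
    have zero: "sg_zero T = \<theta> (sg_zero S)"
    proof (rule T.sg_zero_eqI)
      fix t assume "t \<in> carrier T"
      then obtain s where "s \<in> carrier S" "t = \<theta> s" using im by blast
      then show "\<theta> (sg_zero S) \<cdot>\<^bsub>T\<^esub> t = \<theta> (sg_zero S)" "t \<cdot>\<^bsub>T\<^esub> \<theta> (sg_zero S) = \<theta> (sg_zero S)"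
        by (simp_all add: m[symmetric])
    qed (use c in auto)
    have Fim: "F = \<theta> ` ?P" using T.UF_subset[OF F] im by auto
    show "proper_filter S ?P"
    proof (rule S.proper_filterI)
      show "?P \<noteq> {}" using Fim T.UF_nonempty[OF F] by blast
      show "t \<in> ?P" if "s \<in> ?P" "s \<sqsubseteq>\<^bsub>nat_order S\<^esub> t" "t \<in> carrier S" for s t
        using that T.UF_up[OF F, of "\<theta> s" "\<theta> t"] c ord by auto
      show "\<exists>u\<in>?P. u \<sqsubseteq>\<^bsub>nat_order S\<^esub> s \<and> u \<sqsubseteq>\<^bsub>nat_order S\<^esub> t" if st: "s \<in> ?P" "t \<in> ?P" for s t
      proof -
        obtain v where "v \<in> F" "v \<sqsubseteq>\<^bsub>nat_order T\<^esub> \<theta> s" "v \<sqsubseteq>\<^bsub>nat_order T\<^esub> \<theta> t"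
          using T.UF_directed[OF F, of "\<theta> s" "\<theta> t"] st by blast
        moreover from this obtain u where "u \<in> ?P" "v = \<theta> u" using Fim by blast
        ultimately show ?thesis using st ord by (intro bexI[of _ u]) auto
      qed
      show "sg_zero S \<notin> ?P" using T.UF_zero[OF F] zero by simp
    qed auto
    fix F' assume F': "proper_filter S F'" "?P \<subseteq> F'"
    have F'c: "F' \<subseteq> carrier S" using S.filter_carrier[OF F'(1)] .
    have "proper_filter T (\<theta> ` F')"
    proof (rule T.proper_filterI)
      show "\<theta> ` F' \<subseteq> carrier T" "\<theta> ` F' \<noteq> {}" using c F'c S.filter_nonempty[OF F'(1)] by auto
      show "t \<in> \<theta> ` F'" if st: "s \<in> \<theta> ` F'" "s \<sqsubseteq>\<^bsub>nat_order T\<^esub> t" "t \<in> carrier T" for s t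
      proof -
        obtain x y where xy: "x \<in> F'" "s = \<theta> x" "y \<in> carrier S" "t = \<theta> y" using st im by blast
        then have "x \<sqsubseteq>\<^bsub>nat_order S\<^esub> y" using ord st F'c by blast
        then show ?thesis using S.filter_up[OF F'(1)] xy by blast
      qed
      show "\<exists>u\<in>\<theta> ` F'. u \<sqsubseteq>\<^bsub>nat_order T\<^esub> s \<and> u \<sqsubseteq>\<^bsub>nat_order T\<^esub> t" if st: "s \<in> \<theta> ` F'" "t \<in> \<theta> ` F'" for s t
      proof -
        obtain x y where xy: "x \<in> F'" "s = \<theta> x" "y \<in> F'" "t = \<theta> y" using st by blast
        then obtain u where "u \<in> F'" "u \<sqsubseteq>\<^bsub>nat_order S\<^esub> x" "u \<sqsubseteq>\<^bsub>nat_order S\<^esub> y"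
          using S.filter_directed[OF F'(1)] by blast
        then show ?thesis using ord xy F'c by blast
      qed
      show "sg_zero T \<notin> \<theta> ` F'"
      proof
        assume "sg_zero T \<in> \<theta> ` F'"
        then obtain x where "x \<in> F'" "\<theta> (sg_zero S) = \<theta> x" using zero by auto
        then have "sg_zero S = x" using inj_onD[OF inj, of "sg_zero S" x] F'c by auto
        then show False using S.filter_zero[OF F'(1)] \<open>x \<in> F'\<close> by simp
      qed
    qed
    moreover have "F \<subseteq> \<theta> ` F'" using Fim F'(2) by blast
    ultimately have "\<theta> ` F' = F" using T.UF_max[OF F] by blast
    then show "F' \<subseteq> ?P" using F'c by blast
  qed
  ultimately show ?thesis by (simp add: callitic_hom_def)
qed

lemma bij_hom_callitic_iso:
  assumes S: "bis S" and T: "bis T" and ext: "\<theta> \<in> extensional (carrier S)"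
    and bij: "bij_betw \<theta> (carrier S) (carrier T)"
    and m: "\<And>s t. s \<in> carrier S \<Longrightarrow> t \<in> carrier S \<Longrightarrow> \<theta> (s \<cdot>\<^bsub>S\<^esub> t) = \<theta> s \<cdot>\<^bsub>T\<^esub> \<theta> t"
  shows "\<theta> \<in> callitic_iso S T"
proof -
  interpret S: bis S by (rule S)
  let ?\<phi> = "restrict (inv_into (carrier S) \<theta>) (carrier T)"
  have bij': "bij_betw ?\<phi> (carrier T) (carrier S)"
    using bij_betw_inv_into[OF bij] by (simp add: bij_betw_restrict_eq)
  have r: "\<theta> (?\<phi> t) = t" "?\<phi> t \<in> carrier S" if "t \<in> carrier T" for t
    using that bij bij_betw_inv_into_right[OF bij] inv_into_into[of t \<theta> "carrier S"]
    by (auto simp: bij_betw_def)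
  have l: "?\<phi> (\<theta> s) = s" "\<theta> s \<in> carrier T" if "s \<in> carrier S" for s
    using that bij bij_betw_inv_into_left[OF bij] by (auto simp: bij_betw_def)
  have "?\<phi> \<in> callitic_hom T S"
  proof (rule bij_hom_callitic[OF T S _ bij'])
    fix t u assume tu: "t \<in> carrier T" "u \<in> carrier T"
    have "t \<cdot>\<^bsub>T\<^esub> u = \<theta> (?\<phi> t \<cdot>\<^bsub>S\<^esub> ?\<phi> u)" using m r tu by metis
    then show "?\<phi> (t \<cdot>\<^bsub>T\<^esub> u) = ?\<phi> t \<cdot>\<^bsub>S\<^esub> ?\<phi> u" using l r tu S.mult_closed by metis
  qed simp
  moreover have "compose (carrier S) ?\<phi> \<theta> = (\<lambda>s\<in>carrier S. s)" "compose (carrier T) \<theta> ?\<phi> = (\<lambda>t\<in>carrier T. t)"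
    using l r by (auto simp: compose_def restrict_def fun_eq_iff)
  ultimately show ?thesis
    using bij_hom_callitic[OF assms] unfolding callitic_iso_def by blast
qed

section \<open>Covering functors\<close>

lemma
  assumes "\<alpha> \<in> covering_hom G H"
  shows covering_closed: "x \<in> arrows G \<Longrightarrow> \<alpha> x \<in> arrows H"
    and covering_D: "x \<in> arrows G \<Longrightarrow> \<alpha> (dom_of G x) = dom_of H (\<alpha> x)"
    and covering_R: "x \<in> arrows G \<Longrightarrow> \<alpha> (cod_of G x) = cod_of H (\<alpha> x)"
    and covering_mult: "(x, y) \<in> composable G \<Longrightarrow> \<alpha> (gp_mult G x y) = gp_mult H (\<alpha> x) (\<alpha> y)"
    and covering_inj: "x \<in> arrows G \<Longrightarrow> y \<in> arrows G \<Longrightarrow> dom_of G x = dom_of G y \<Longrightarrow> \<alpha> x = \<alpha> y \<Longrightarrow> x = y"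
    and covering_lift: "e \<in> identities G \<Longrightarrow> h \<in> arrows H \<Longrightarrow> \<alpha> e = dom_of H h \<Longrightarrow>
      \<exists>g\<in>arrows G. dom_of G g = e \<and> \<alpha> g = h"
    and covering_continuous: "continuous_map (gp_top G) (gp_top H) \<alpha>"
    and covering_proper: "compactin (gp_top H) C \<Longrightarrow> compactin (gp_top G) {x \<in> arrows G. \<alpha> x \<in> C}"
  using assms
  by (auto simp: covering_hom_def covering_functor_def gp_functor_def PiE_def Pi_iff)

lemma covering_homI:
  assumes "gp_functor G H \<alpha>" "\<alpha> \<in> extensional (arrows G)"
    and "\<And>x y. x \<in> arrows G \<Longrightarrow> y \<in> arrows G \<Longrightarrow> dom_of G x = dom_of G y \<Longrightarrow> \<alpha> x = \<alpha> y \<Longrightarrow> x = y"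
    and "\<And>e h. e \<in> identities G \<Longrightarrow> h \<in> arrows H \<Longrightarrow> \<alpha> e = dom_of H h \<Longrightarrow>
      \<exists>g\<in>arrows G. dom_of G g = e \<and> \<alpha> g = h"
    and "continuous_map (gp_top G) (gp_top H) \<alpha>"
    and "\<And>C. compactin (gp_top H) C \<Longrightarrow> compactin (gp_top G) {x \<in> arrows G. \<alpha> x \<in> C}"
  shows "\<alpha> \<in> covering_hom G H"
proof -
  have "\<alpha> \<in> arrows G \<rightarrow>\<^sub>E arrows H" using assms(1,2) by (simp add: gp_functor_def PiE_def)
  then show ?thesis
    unfolding covering_hom_def covering_functor_def
  proof (intro CollectI conjI ballI allI impI)
    show "x = y" if "x \<in> arrows G" "y \<in> arrows G" "dom_of G x = dom_of G y \<and> \<alpha> x = \<alpha> y" for x y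
      using assms(3)[OF that(1,2)] that(3) by simp
  qed (use assms in simp_all)
qed

lemma id_covering:
  assumes "groupoid G"
  shows "(\<lambda>g\<in>arrows G. g) \<in> covering_hom G G"
proof -
  interpret gpd G by unfold_locales (rule assms)
  have "continuous_map (gp_top G) (gp_top G) (\<lambda>g\<in>arrows G. g)"
    by (rule continuous_map_eq[OF continuous_map_id]) (simp add: arrows_def)
  moreover have "{x \<in> arrows G. (\<lambda>g\<in>arrows G. g) x \<in> C} = C" if "compactin (gp_top G) C" for C
    using compactin_subset_topspace[OF that] by (auto simp: arrows_def)
  ultimately show ?thesis
    by (auto simp: covering_hom_def covering_functor_def gp_functor_def composable_def id_arrow D_of_id)
qed

lemma compose_covering:
  assumes G: "groupoid G" and H: "groupoid H"
    and \<alpha>: "\<alpha> \<in> covering_hom G H" and \<beta>: "\<beta> \<in> covering_hom H K"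
  shows "compose (arrows G) \<beta> \<alpha> \<in> covering_hom G K"
proof -
  interpret G: gpd G by unfold_locales (rule G)
  interpret H: gpd H by unfold_locales (rule H)
  let ?c = "compose (arrows G) \<beta> \<alpha>"
  note c = covering_closed[OF \<alpha>] covering_closed[OF \<beta>]
  have comp: "(\<alpha> x, \<alpha> y) \<in> composable H" if "(x, y) \<in> composable G" for x y
  proof -
    have xy: "x \<in> arrows G" "y \<in> arrows G" "dom_of G x = cod_of G y"
      using that by (auto simp: composable_def)
    then have "dom_of H (\<alpha> x) = cod_of H (\<alpha> y)"
      using covering_D[OF \<alpha>, of x] covering_R[OF \<alpha>, of y] by simp
    then show ?thesis using c xy by (simp add: composable_def)
  qed
  have func: "gp_functor G K (?c)"
    unfolding gp_functor_def
  proof (intro conjI ballI)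
    show "?c \<in> arrows G \<rightarrow> arrows K" using c by (auto simp: compose_def)
    fix x assume "x \<in> arrows G"
    then show "?c (dom_of G x) = dom_of K (?c x)"
      "?c (cod_of G x) = cod_of K (?c x)"
      using c by (simp_all add: compose_def covering_D[OF \<alpha>] covering_D[OF \<beta>] covering_R[OF \<alpha>] covering_R[OF \<beta>])
  next
    fix p assume p: "p \<in> composable G"
    obtain x y where xy: "p = (x, y)" by (cases p)
    then have "x \<in> arrows G" "y \<in> arrows G" "gp_mult G x y \<in> arrows G"
      using p by (auto simp: composable_def)
    then show "case p of (x, y) \<Rightarrow> ?c (gp_mult G x y) =
        gp_mult K (?c x) (?c y)"
      using p comp unfolding xy by (simp add: compose_def covering_mult[OF \<alpha>] covering_mult[OF \<beta>])
  qed
  have inj: "x = y" if "x \<in> arrows G" "y \<in> arrows G" "dom_of G x = dom_of G y"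
    "?c x = ?c y" for x y
  proof -
    have "dom_of H (\<alpha> x) = dom_of H (\<alpha> y)" using covering_D[OF \<alpha>] that by metis
    moreover have "\<beta> (\<alpha> x) = \<beta> (\<alpha> y)" using that by (simp add: compose_def)
    ultimately have "\<alpha> x = \<alpha> y" by (rule covering_inj[OF \<beta> c(1)[OF that(1)] c(1)[OF that(2)]])
    then show ?thesis using covering_inj[OF \<alpha>] that by blast
  qed
  have lift: "\<exists>g\<in>arrows G. dom_of G g = e \<and> ?c g = k"
    if e: "e \<in> identities G" and k: "k \<in> arrows K" "?c e = dom_of K k" for e k
  proof -
    have ea: "e \<in> arrows G" "dom_of G e = e" using e G.id_arrow G.D_of_id by auto
    \<comment> \<open>Lifting goes in two stages, along \<open>\<beta>\<close> and then along
      \<open>\<alpha>\<close>; the first stage starts at \<open>\<alpha> e\<close>, which must be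
      known to be an identity.\<close>
    then have "\<alpha> e \<in> identities H" using covering_D[OF \<alpha>, of e] c by (auto simp: H.id_iff)
    moreover have "\<beta> (\<alpha> e) = dom_of K k" using k ea by (simp add: compose_def)
    ultimately obtain h where h: "h \<in> arrows H" "dom_of H h = \<alpha> e" "\<beta> h = k"
      using covering_lift[OF \<beta>] k by blast
    then obtain g where "g \<in> arrows G" "dom_of G g = e" "\<alpha> g = h"
      using covering_lift[OF \<alpha> e, of h] by auto
    then show ?thesis using h by (auto simp: compose_def)
  qed
  have cont: "continuous_map (gp_top G) (gp_top K) (?c)"
    by (rule continuous_map_eq[OF continuous_map_compose[OF covering_continuous[OF \<alpha>] covering_continuous[OF \<beta>]]])
      (simp add: compose_def arrows_def)
  have proper: "compactin (gp_top G) {x \<in> arrows G. ?c x \<in> C}"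
    if C: "compactin (gp_top K) C" for C
  proof -
    have "{x \<in> arrows G. ?c x \<in> C} = {x \<in> arrows G. \<alpha> x \<in> {y \<in> arrows H. \<beta> y \<in> C}}"
      using c by (auto simp: compose_def)
    then show ?thesis using covering_proper[OF \<alpha> covering_proper[OF \<beta> C]] by simp
  qed
  show ?thesis by (rule covering_homI[OF func _ inj lift cont proper]) (rule compose_extensional)
qed

text \<open>With the inverse map at hand, the lift of \<open>h\<close> is \<open>\<beta> h\<close>,
  and the preimage of a compact set is its image under the continuous map
  \<open>\<beta>\<close>.\<close>

lemma homeomorphic_functor_covering:
  assumes G: "groupoid G" and H: "groupoid H" and ext: "\<alpha> \<in> extensional (arrows G)"
    and f: "gp_functor G H \<alpha>" and hm: "homeomorphic_maps (gp_top G) (gp_top H) \<alpha> \<beta>"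
  shows "\<alpha> \<in> covering_hom G H"
proof -
  interpret G: gpd G by unfold_locales (rule G)
  interpret H: gpd H by unfold_locales (rule H)
  have cont: "continuous_map (gp_top G) (gp_top H) \<alpha>" "continuous_map (gp_top H) (gp_top G) \<beta>"
    and l: "\<And>x. x \<in> arrows G \<Longrightarrow> \<beta> (\<alpha> x) = x" and r: "\<And>y. y \<in> arrows H \<Longrightarrow> \<alpha> (\<beta> y) = y"
    using hm by (auto simp: homeomorphic_maps_def arrows_def)
  have c: "\<And>x. x \<in> arrows G \<Longrightarrow> \<alpha> x \<in> arrows H" "\<And>y. y \<in> arrows H \<Longrightarrow> \<beta> y \<in> arrows G"
    using continuous_map_funspace[OF cont(1)] continuous_map_funspace[OF cont(2)]
    by (auto simp: arrows_def)
  have inj: "x = y" if "x \<in> arrows G" "y \<in> arrows G" "\<alpha> x = \<alpha> y" for x y using l that by metis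
  have lift: "\<exists>g\<in>arrows G. dom_of G g = e \<and> \<alpha> g = h"
    if e: "e \<in> identities G" and h: "h \<in> arrows H" "\<alpha> e = dom_of H h" for e h
  proof -
    have "\<alpha> (dom_of G (\<beta> h)) = \<alpha> e" using f h c r by (simp add: gp_functor_def)
    then have "dom_of G (\<beta> h) = e" using inj e h c G.id_arrow by simp
    then show ?thesis using h c r by blast
  qed
  have proper: "compactin (gp_top G) {x \<in> arrows G. \<alpha> x \<in> C}" if C: "compactin (gp_top H) C" for C
  proof -
    have "{x \<in> arrows G. \<alpha> x \<in> C} = \<beta> ` C"
      using compactin_subset_topspace[OF C] l r c by (force simp: arrows_def image_iff)
    then show ?thesis using image_compactin[OF C cont(2)] by simp
  qed
  show ?thesis by (rule covering_homI[OF f ext _ lift cont(1) proper]) (rule inj)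
qed

lemma homeomorphic_functor_covering_iso:
  assumes G: "groupoid G" and H: "groupoid H" and ext: "\<alpha> \<in> extensional (arrows G)"
    and f: "gp_functor G H \<alpha>" and hm: "homeomorphic_map (gp_top G) (gp_top H) \<alpha>"
  shows "\<alpha> \<in> covering_iso G H"
proof -
  interpret G: gpd G by unfold_locales (rule G)
  interpret H: gpd H by unfold_locales (rule H)
  obtain \<beta>0 where hm0: "homeomorphic_maps (gp_top G) (gp_top H) \<alpha> \<beta>0"
    using hm by (auto simp: homeomorphic_map_maps)
  \<comment> \<open>Hom-sets contain extensional functions only, so the inverse is made undefined
    outside the arrows of \<open>H\<close>.\<close>
  define \<beta> where "\<beta> = restrict \<beta>0 (arrows H)"
  have hm1: "homeomorphic_maps (gp_top G) (gp_top H) \<alpha> \<beta>"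
    by (rule homeomorphic_maps_eq[OF hm0]) (auto simp: \<beta>_def arrows_def)
  then have l: "\<And>x. x \<in> arrows G \<Longrightarrow> \<beta> (\<alpha> x) = x" and r: "\<And>y. y \<in> arrows H \<Longrightarrow> \<alpha> (\<beta> y) = y"
    and cont: "continuous_map (gp_top G) (gp_top H) \<alpha>" "continuous_map (gp_top H) (gp_top G) \<beta>"
    by (auto simp: homeomorphic_maps_def arrows_def)
  have c: "\<And>x. x \<in> arrows G \<Longrightarrow> \<alpha> x \<in> arrows H" "\<And>y. y \<in> arrows H \<Longrightarrow> \<beta> y \<in> arrows G"
    using continuous_map_funspace[OF cont(1)] continuous_map_funspace[OF cont(2)]
    by (auto simp: arrows_def)
  have fD: "\<alpha> (dom_of G x) = dom_of H (\<alpha> x)" "\<alpha> (cod_of G x) = cod_of H (\<alpha> x)" if "x \<in> arrows G" for x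
    using f that by (auto simp: gp_functor_def)
  have D: "\<beta> (dom_of H y) = dom_of G (\<beta> y)" if "y \<in> arrows H" for y
    using fD(1)[of "\<beta> y"] l[of "dom_of G (\<beta> y)"] r c that by simp
  have R: "\<beta> (cod_of H y) = cod_of G (\<beta> y)" if "y \<in> arrows H" for y
    using fD(2)[of "\<beta> y"] l[of "cod_of G (\<beta> y)"] r c that by simp
  have "gp_functor H G \<beta>"
    unfolding gp_functor_def
  proof (intro conjI ballI)
    show "\<beta> \<in> arrows H \<rightarrow> arrows G" using c by auto
    fix p assume "p \<in> composable H"
    then obtain x y where p: "p = (x, y)" "x \<in> arrows H" "y \<in> arrows H" "dom_of H x = cod_of H y"
      by (auto simp: composable_def)
    have "dom_of G (\<beta> x) = cod_of G (\<beta> y)" using D[OF p(2)] R[OF p(3)] p(4) by simp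
    then have cc: "(\<beta> x, \<beta> y) \<in> composable G" and a: "gp_mult G (\<beta> x) (\<beta> y) \<in> arrows G"
      using c p by (simp_all add: composable_def)
    have "\<alpha> (gp_mult G (\<beta> x) (\<beta> y)) = gp_mult H x y"
      using f cc r p by (auto simp: gp_functor_def)
    then show "case p of (x, y) \<Rightarrow> \<beta> (gp_mult H x y) = gp_mult G (\<beta> x) (\<beta> y)"
      using l[OF a] p by simp
  qed (simp_all add: D R)
  moreover have "homeomorphic_maps (gp_top H) (gp_top G) \<beta> \<alpha>"
    using hm1 homeomorphic_maps_sym by blast
  ultimately have "\<beta> \<in> covering_hom H G"
    using homeomorphic_functor_covering[OF H G] by (simp add: \<beta>_def)
  moreover have "compose (arrows G) \<beta> \<alpha> = (\<lambda>g\<in>arrows G. g)" "compose (arrows H) \<alpha> \<beta> = (\<lambda>h\<in>arrows H. h)"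
    using l r by (auto simp: compose_def restrict_def fun_eq_iff)
  ultimately show ?thesis
    using homeomorphic_functor_covering[OF G H ext f hm1] unfolding covering_iso_def by blast
qed

section \<open>The ultrafilter functor on morphisms\<close>

text \<open>Only the inclusion of \<open>p A\<close> times \<open>p B\<close> in \<open>p\<close> of
  the product is immediate for the inverse image map \<open>p\<close>. Equality follows from
  maximality, because both sides are ultrafilters whenever the products are defined.\<close>

lemma ultra_map_covering:
  assumes S: "boolean_inverse_semigroup S" and T: "boolean_inverse_semigroup T"
    and \<theta>: "\<theta> \<in> callitic_hom S T"
  shows "ultra_map S T \<theta> \<in> covering_hom (ultra_gpd T) (ultra_gpd S)"
proof -
  interpret S: bis S by (rule bisI[OF S])
  interpret T: bis T by (rule bisI[OF T])
  have h: "\<theta> \<in> bis_hom S T" using \<theta> by (simp add: callitic_hom_def)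
  have c: "\<theta> \<in> carrier S \<rightarrow> carrier T" using bis_hom_closed[OF h] by blast
  note m = bis_hom_mult[OF h]
  have inv: "\<theta> (sg_inv S s) = sg_inv T (\<theta> s)" if "s \<in> carrier S" for s
    by (rule hom_inv[OF S.inv_sgrp_axioms T.inv_sgrp_axioms c m that])
  define p where "p A = {s \<in> carrier S. \<theta> s \<in> A}" for A
  let ?f = "ultra_map S T \<theta>"
  have f: "?f A = p A" if "A \<in> T.UF" for A using that by (simp add: ultra_map_def p_def)
  have pUF: "p A \<in> S.UF" if "A \<in> T.UF" for A
    using \<theta> that by (simp add: p_def callitic_hom_def)
  have pstar: "p (sg_inv T ` A) = sg_inv S ` p A" if A: "A \<subseteq> carrier T" for A
  proof (intro equalityI subsetI)
    fix s assume "s \<in> p (sg_inv T ` A)"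
    then obtain a where s: "s \<in> carrier S" "\<theta> s = sg_inv T a" "a \<in> A" by (auto simp: p_def)
    then have "\<theta> (sg_inv S s) = a" using inv A by auto
    then have "sg_inv S s \<in> p A" using s by (simp add: p_def)
    then show "s \<in> sg_inv S ` p A" using S.inv_inv[OF s(1)] by (metis imageI)
  qed (use inv in \<open>auto simp: p_def\<close>)
  have sub: "S.up_mult (p A) (p B) \<subseteq> p (T.up_mult A B)" for A B
  proof
    fix u assume "u \<in> S.up_mult (p A) (p B)"
    then obtain a b where ab: "a \<in> p A" "b \<in> p B" "a \<cdot>\<^bsub>S\<^esub> b \<sqsubseteq>\<^bsub>nat_order S\<^esub> u" "u \<in> carrier S"
      using S.up_multD by blast
    then have "\<theta> (a \<cdot>\<^bsub>S\<^esub> b) \<sqsubseteq>\<^bsub>nat_order T\<^esub> \<theta> u" using hom_ord[OF c m] by blast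
    moreover have "\<theta> (a \<cdot>\<^bsub>S\<^esub> b) = \<theta> a \<cdot>\<^bsub>T\<^esub> \<theta> b" using ab m by (simp add: p_def)
    ultimately show "u \<in> p (T.up_mult A B)" using ab c by (auto simp: p_def intro!: T.up_multI)
  qed
  have eq: "S.up_mult (p A) (p B) = p (T.up_mult A B)"
    if "S.up_mult (p A) (p B) \<in> S.UF" "T.up_mult A B \<in> T.UF" for A B
    using S.UF_max[OF that(1) S.UF_filter[OF pUF[OF that(2)]] sub] by simp
  have pdom: "dom_of S.G (p A) = p (dom_of T.G A)" if A: "A \<in> T.UF" for A
    using eq[of "sg_inv T ` A" A] S.UF_dom[OF pUF[OF A]] T.UF_dom[OF A]
    by (simp add: S.dom_of_ultra T.dom_of_ultra pstar T.UF_subset[OF A])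
  have star2: "sg_inv S ` sg_inv S ` B = B" if "B \<in> S.UF" for B
    using S.star_set_star_set S.UF_subset that by blast
  have star2': "sg_inv T ` sg_inv T ` B = B" if "B \<in> T.UF" for B
    using T.star_set_star_set T.UF_subset that by blast
  \<comment> \<open>The codomain of \<open>A\<close> is the domain of the inverse ultrafilter, so
    its being an ultrafilter comes from the domain case.\<close>
  have pcod: "cod_of S.G (p A) = p (cod_of T.G A)" if A: "A \<in> T.UF" for A
    using eq[of A "sg_inv T ` A"] S.UF_dom[OF S.UF_star[OF pUF[OF A]]] T.UF_dom[OF T.UF_star[OF A]]
    by (simp add: S.cod_of_ultra T.cod_of_ultra pstar T.UF_subset[OF A] star2[OF pUF[OF A]] star2'[OF A])
  have domUF: "dom_of T.G A \<in> T.UF" "cod_of T.G A \<in> T.UF"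
    if "A \<in> T.UF" for A
    using T.UF_dom[OF that] T.UF_dom[OF T.UF_star[OF that]]
    by (simp_all add: T.dom_of_ultra T.cod_of_ultra star2'[OF that])
  have func: "gp_functor T.G S.G ?f"
    unfolding gp_functor_def
  proof (intro conjI ballI)
    show "?f \<in> arrows T.G \<rightarrow> arrows S.G" using f pUF by simp
    fix A assume "A \<in> arrows T.G"
    then show "?f (dom_of T.G A) = dom_of S.G (?f A)"
      "?f (cod_of T.G A) = cod_of S.G (?f A)"
      using f pdom pcod domUF by simp_all
  next
    fix q assume "q \<in> composable T.G"
    then obtain A B where q: "q = (A, B)" "A \<in> T.UF" "B \<in> T.UF"
      "dom_of T.G A = cod_of T.G B" by (auto simp: composable_def)
    have "dom_of S.G (p A) = cod_of S.G (p B)" using pdom pcod q by simp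
    then have "S.up_mult (p A) (p B) \<in> S.UF"
      using S.UF_up_mult[OF pUF[OF q(2)] pUF[OF q(3)]] by (simp add: S.dom_of_ultra S.cod_of_ultra)
    moreover have "T.up_mult A B \<in> T.UF"
      using T.UF_up_mult[OF q(2,3)] q(4) by (simp add: T.dom_of_ultra T.cod_of_ultra)
    ultimately show "case q of (A, B) \<Rightarrow>
        ?f (gp_mult T.G A B) = gp_mult S.G (?f A) (?f B)"
      using eq f q by simp
  qed
  \<comment> \<open>If \<open>s\<close> lies in the common inverse image, then \<open>A\<close> and
    \<open>B\<close> share the element \<open>\<theta> s\<close> as well as their domain, and these
    two data determine an ultrafilter.\<close>
  have inj: "A = B" if AB: "A \<in> arrows T.G" "B \<in> arrows T.G"
    "dom_of T.G A = dom_of T.G B" "?f A = ?f B" for A B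
  proof -
    have UF: "A \<in> T.UF" "B \<in> T.UF" using AB by auto
    then have "p A = p B" using f AB by simp
    moreover obtain s where "s \<in> p A" using S.UF_nonempty[OF pUF[OF UF(1)]] by blast
    ultimately have "\<theta> s \<in> A" "\<theta> s \<in> B" by (auto simp: p_def)
    then show ?thesis using T.dom_inj_ultra[OF UF] AB by blast
  qed
  \<comment> \<open>Pick any \<open>b \<in> B\<close>. The hypothesis puts the domain idempotent of
    \<open>\<theta> b\<close> into \<open>E\<close>, so some ultrafilter \<open>A\<close> through
    \<open>\<theta> b\<close> has domain \<open>E\<close>. Its inverse image shares \<open>b\<close>
    and the domain with \<open>B\<close>, hence equals \<open>B\<close>.\<close>
  have lift: "\<exists>A\<in>arrows T.G. dom_of T.G A = E \<and> ?f A = B"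
    if E: "E \<in> identities T.G" and B: "B \<in> arrows S.G" "?f E = dom_of S.G B" for E B
  proof -
    have EU: "E \<in> T.UF" and BU: "B \<in> S.UF" using E B by (auto simp: T.identities_ultra)
    obtain b where b: "b \<in> B" "b \<in> carrier S" using S.UF_nonempty[OF BU] S.UF_carrier[OF BU] by blast
    have "dom_of S.G B \<in> ultra_nhd S (sg_inv S b \<cdot>\<^bsub>S\<^esub> b)"
      using S.dom_image_ultra_nhd[OF b(2)] S.ultra_nhdI[OF BU b(1)] by blast
    then have "sg_inv S b \<cdot>\<^bsub>S\<^esub> b \<in> p E" using B f[OF EU] by (simp add: ultra_nhd_def)
    then have "sg_inv T (\<theta> b) \<cdot>\<^bsub>T\<^esub> \<theta> b \<in> E" using b m inv by (simp add: p_def)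
    then have "E \<in> dom_of T.G ` ultra_nhd T (\<theta> b)"
      using T.dom_image_ultra_nhd[of "\<theta> b"] EU bis_hom_closed[OF h b(2)] by (simp add: T.ultra_nhdI)
    then obtain A where A: "A \<in> T.UF" "\<theta> b \<in> A" "dom_of T.G A = E"
      by (auto simp: ultra_nhd_def)
    have "p A = B"
    proof (rule S.dom_inj_ultra[OF pUF[OF A(1)] BU _ b(1)])
      show "b \<in> p A" using A b by (simp add: p_def)
      show "dom_of S.G (p A) = dom_of S.G B" using pdom[OF A(1)] A B f EU by simp
    qed
    then show ?thesis using A f by auto
  qed
  have cont: "continuous_map (gp_top T.G) (gp_top S.G) ?f"
  proof (rule S.continuous_map_ultra)
    show "?f \<in> topspace (gp_top T.G) \<rightarrow> S.UF" using f pUF by simp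
    fix A s assume "A \<in> topspace (gp_top T.G)" "s \<in> ?f A"
    then have s: "A \<in> T.UF" "s \<in> carrier S" "\<theta> s \<in> A" using f by (auto simp: p_def)
    then show "\<exists>W. openin (gp_top T.G) W \<and> A \<in> W \<and> (\<forall>y\<in>W. s \<in> ?f y)"
      using T.openin_ultra_nhd[OF bis_hom_closed[OF h s(2)]] f
      by (intro exI[of _ "ultra_nhd T (\<theta> s)"]) (auto simp: ultra_nhd_def p_def)
  qed
  \<comment> \<open>Finitely many \<open>ultra_nhd S s\<close> cover \<open>C\<close>, and the
    preimage of each lies in the compact set \<open>ultra_nhd T (\<theta> s)\<close>. The preimage
    of \<open>C\<close> is thus a closed subset of a compact set.\<close>
  have proper: "compactin (gp_top T.G) {A \<in> arrows T.G. ?f A \<in> C}"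
    if C: "compactin (gp_top S.G) C" for C
  proof -
    have CU: "C \<subseteq> S.UF" using compactin_subset_topspace[OF C] by simp
    have "C \<subseteq> \<Union>(ultra_nhd S ` carrier S)" using CU S.UF_top_space by simp
    then obtain \<F> where \<F>: "finite \<F>" "\<F> \<subseteq> ultra_nhd S ` carrier S" "C \<subseteq> \<Union>\<F>"
      using C S.openin_ultra_nhd unfolding compactin_def by (metis imageE)
    then obtain N where N: "finite N" "N \<subseteq> carrier S" "\<F> = ultra_nhd S ` N" using finite_subset_image by metis
    have "compactin (gp_top T.G) (\<Union>s\<in>N. ultra_nhd T (\<theta> s))"
      using N bis_hom_closed[OF h] by (intro compactin_Union) (auto intro!: T.compactin_ultra_nhd)
    moreover have "closedin (gp_top T.G) {A \<in> topspace (gp_top T.G). ?f A \<in> C}"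
      by (rule closedin_continuous_map_preimage[OF cont compactin_imp_closedin[OF S.Hausdorff_ultra C]])
    moreover have "{A \<in> topspace (gp_top T.G). ?f A \<in> C} \<subseteq> (\<Union>s\<in>N. ultra_nhd T (\<theta> s))"
    proof
      fix A assume "A \<in> {A \<in> topspace (gp_top T.G). ?f A \<in> C}"
      then have A: "A \<in> T.UF" "p A \<in> C" using f by auto
      then obtain s where "s \<in> N" "p A \<in> ultra_nhd S s" using \<F> N by blast
      then show "A \<in> (\<Union>s\<in>N. ultra_nhd T (\<theta> s))" using A by (auto simp: ultra_nhd_def p_def)
    qed
    ultimately show ?thesis using closed_compactin by simp
  qed
  show ?thesis by (rule covering_homI[OF func _ inj lift cont proper]) (simp add: ultra_map_def del: restrict_apply)
qed

section \<open>The bisection functor on morphisms\<close>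

text \<open>The map is callitic because ultrafilters of bisections are points: the inverse image of
  the ultrafilter at \<open>g\<close> is the ultrafilter at \<open>\<alpha> g\<close>. Meets and
  compatible joins are intersections and unions, which preimages preserve.\<close>

lemma bisection_map_callitic:
  assumes G: "boolean_groupoid G" and H: "boolean_groupoid H" and \<alpha>: "\<alpha> \<in> covering_hom G H"
  shows "bisection_map G H \<alpha> \<in> callitic_hom (bisection_sgrp H) (bisection_sgrp G)"
proof -
  interpret G: bgpd G by (rule bgpdI[OF G])
  interpret H: bgpd H by (rule bgpdI[OF H])
  let ?f = "bisection_map G H \<alpha>"
  define p where "p B = {g \<in> arrows G. \<alpha> g \<in> B}" for B
  have f: "?f B = p B" if "B \<in> carrier H.KB" for B
    using that by (simp add: bisection_map_def p_def)
  note c = covering_closed[OF \<alpha>]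
  have pK: "p B \<in> carrier G.KB" if B: "B \<in> carrier H.KB" for B
    unfolding G.carrier_KB
  proof (intro conjI)
    show "compactin (gp_top G) (p B)" using covering_proper[OF \<alpha> H.KB_compact[OF B]] by (simp add: p_def)
    show "openin (gp_top G) (p B)"
      using openin_continuous_map_preimage[OF covering_continuous[OF \<alpha>] H.KB_open[OF B]] by (simp add: p_def)
    have D: "x = y" if "x \<in> p B" "y \<in> p B" "dom_of G x = dom_of G y" for x y
    proof -
      have xy: "x \<in> arrows G" "y \<in> arrows G" "\<alpha> x \<in> B" "\<alpha> y \<in> B" using that by (auto simp: p_def)
      have "dom_of H (\<alpha> x) = dom_of H (\<alpha> y)" using covering_D[OF \<alpha>] xy that by metis
      then have "\<alpha> x = \<alpha> y" using H.bisection_D[OF H.KB_bisection[OF B]] xy by blast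
      then show ?thesis using covering_inj[OF \<alpha>] xy that by blast
    qed
    \<comment> \<open>Uniqueness of lifts speaks of arrows with equal domains, so for equal
      codomains it is applied to the product of the inverse of \<open>x\<close> with
      \<open>y\<close>. Its image is an identity, so it agrees with the domain of \<open>y\<close>,
      and this forces \<open>x = y\<close>.\<close>
    have R: "x = y" if "x \<in> p B" "y \<in> p B" "cod_of G x = cod_of G y" for x y
    proof -
      have xy: "x \<in> arrows G" "y \<in> arrows G" "\<alpha> x \<in> B" "\<alpha> y \<in> B" using that by (auto simp: p_def)
      have "cod_of H (\<alpha> x) = cod_of H (\<alpha> y)" using covering_R[OF \<alpha>] xy that by metis
      then have eq: "\<alpha> x = \<alpha> y" using H.bisection_R[OF H.KB_bisection[OF B]] xy by blast
      have "gp_mult G (gp_inv G x) y \<in> arrows G" "dom_of G (gp_mult G (gp_inv G x) y) = dom_of G y"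
        using xy that by auto
      moreover have "\<alpha> (gp_mult G (gp_inv G x) y) = dom_of H (\<alpha> y)"
      proof -
        have 1: "\<alpha> (gp_mult G x (gp_inv G x)) = gp_mult H (\<alpha> x) (\<alpha> (gp_inv G x))"
          using xy by (intro covering_mult[OF \<alpha>]) (simp add: composable_def)
        have ai: "\<alpha> (gp_inv G x) = gp_inv H (\<alpha> x)"
        proof (rule H.gi_eqI[symmetric])
          show "dom_of H (\<alpha> x) = cod_of H (\<alpha> (gp_inv G x))"
            using covering_D[OF \<alpha> xy(1)] covering_R[OF \<alpha>, of "gp_inv G x"] xy by simp
          show "gp_mult H (\<alpha> x) (\<alpha> (gp_inv G x)) = cod_of H (\<alpha> x)"
            using 1 covering_R[OF \<alpha> xy(1)] by (simp add: G.comp_gi)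
        qed (use c xy in auto)
        have "\<alpha> (gp_mult G (gp_inv G x) y) = gp_mult H (\<alpha> (gp_inv G x)) (\<alpha> y)"
          using xy that by (intro covering_mult[OF \<alpha>]) (simp add: composable_def)
        then show ?thesis by (simp add: ai eq H.gi_comp)
      qed
      ultimately have "gp_mult G (gp_inv G x) y = dom_of G y"
        using covering_inj[OF \<alpha>, of "gp_mult G (gp_inv G x) y" "dom_of G y"] covering_D[OF \<alpha>] xy by simp
      then show ?thesis using G.gi_comp_id_imp_eq[of x y] xy that by simp
    qed
    show "bisection G (p B)" unfolding G.bisection_iff using D R by (auto simp: p_def)
  qed
  \<comment> \<open>The inclusion from left to right uses existence of lifts: the right factor
    \<open>b\<close> of \<open>\<alpha> g\<close> lifts to an arrow \<open>y\<close> with the domain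
    of \<open>g\<close>, and \<open>g\<close> times the inverse of \<open>y\<close> is then a lift
    of the left factor \<open>a\<close>.\<close>
  have pmult: "p (gp_setmult H A B) = gp_setmult G (p A) (p B)" for A B
  proof (intro equalityI subsetI)
    fix g assume "g \<in> p (gp_setmult H A B)"
    then have g: "g \<in> arrows G" "\<alpha> g \<in> gp_setmult H A B" by (auto simp: p_def)
    then obtain a b where ab: "a \<in> A" "b \<in> B" "a \<in> arrows H" "b \<in> arrows H"
      "dom_of H a = cod_of H b" "\<alpha> g = gp_mult H a b" by (auto elim!: H.setmultE)
    have "\<alpha> (dom_of G g) = dom_of H b" using covering_D[OF \<alpha> g(1)] ab by simp
    then obtain y where y: "y \<in> arrows G" "dom_of G y = dom_of G g" "\<alpha> y = b"
      using covering_lift[OF \<alpha> G.D_id[OF g(1)] ab(4)] by blast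
    let ?x = "gp_mult G g (gp_inv G y)"
    have x: "?x \<in> arrows G" "dom_of G ?x = cod_of G y" "gp_mult G ?x y = g"
      using y g by (simp_all add: G.gi_cancel_comp)
    have "gp_mult H (\<alpha> ?x) b = gp_mult H a b"
      using covering_mult[OF \<alpha>, of ?x y] x y ab by (simp add: composable_def)
    moreover have "dom_of H (\<alpha> ?x) = cod_of H b"
      using covering_D[OF \<alpha> x(1)] covering_R[OF \<alpha> y(1)] x y by simp
    ultimately have "\<alpha> ?x = gp_mult H (gp_mult H a b) (gp_inv H b)"
      using H.comp_cancel_gi[OF ab(4) c(1)[OF x(1)]] by simp
    also have "\<dots> = a" by (rule H.comp_cancel_gi[OF ab(4,3,5)])
    finally have "\<alpha> ?x = a" .
    then have "?x \<in> p A" "y \<in> p B" using x y ab by (auto simp: p_def)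
    then show "g \<in> gp_setmult G (p A) (p B)" using G.setmultI[of ?x "p A" y "p B"] x y by simp
  next
    fix g assume "g \<in> gp_setmult G (p A) (p B)"
    then obtain x y where xy: "x \<in> p A" "y \<in> p B" "x \<in> arrows G" "y \<in> arrows G"
      "dom_of G x = cod_of G y" "g = gp_mult G x y" by (rule G.setmultE)
    have "dom_of H (\<alpha> x) = cod_of H (\<alpha> y)" using covering_D[OF \<alpha> xy(3)] covering_R[OF \<alpha> xy(4)] xy by simp
    moreover have "\<alpha> g = gp_mult H (\<alpha> x) (\<alpha> y)"
      using covering_mult[OF \<alpha>, of x y] xy by (simp add: composable_def)
    ultimately have "\<alpha> g \<in> gp_setmult H A B" using xy c by (auto simp: p_def intro: H.setmultI)
    then show "g \<in> p (gp_setmult H A B)" using xy by (simp add: p_def)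
  qed
  have fm: "?f (A \<cdot>\<^bsub>H.KB\<^esub> B) = ?f A \<cdot>\<^bsub>G.KB\<^esub> ?f B"
    if "A \<in> carrier H.KB" "B \<in> carrier H.KB" for A B
    using that f pmult H.KB_setmult by simp
  have fc: "?f \<in> carrier H.KB \<rightarrow> carrier G.KB" using f pK by simp
  have "?f \<in> bis_hom H.KB G.KB"
    unfolding bis_hom_def
  proof (intro CollectI conjI ballI allI impI)
    show "?f \<in> carrier H.KB \<rightarrow>\<^sub>E carrier G.KB"
      using fc by (auto simp: bisection_map_def PiE_def)
    fix A B assume AB: "A \<in> carrier H.KB" "B \<in> carrier H.KB"
    show "is_glb (nat_order G.KB) (?f M) {?f A, ?f B}"
      if "is_glb (nat_order H.KB) M {A, B}" for M
    proof -
      have "M = A \<inter> B" using that H.is_glb_KB_iff[OF AB] by simp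
      moreover have "p (A \<inter> B) = p A \<inter> p B" by (auto simp: p_def)
      ultimately show ?thesis using f AB H.KB_Int pK G.is_glb_KB_iff by simp
    qed
    show "is_lub (nat_order G.KB) (?f J) {?f A, ?f B}"
      if J: "compatible H.KB A B \<and> is_lub (nat_order H.KB) J {A, B}" for J
    proof -
      have cp: "compatible_subset H.KB {A, B}"
        using H.K.compatible_pair J AB by blast
      have "J = \<Union>{A, B}" using J H.is_lub_KB_iff[OF _ cp] by blast
      moreover have "\<Union>{A, B} \<in> carrier H.KB" using H.compatible_Union[OF _ cp] by blast
      moreover have "p (\<Union>{A, B}) = \<Union>{p A, p B}" by (auto simp: p_def)
      ultimately show ?thesis
        using f AB pK G.is_lub_KB[of "{p A, p B}"] by (metis empty_subsetI insert_subset)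
    qed
  qed (rule fm)
  moreover have "{B \<in> carrier H.KB. ?f B \<in> F} \<in> ultrafilters H.KB"
    if F: "F \<in> ultrafilters G.KB" for F
  proof -
    obtain g where g: "g \<in> arrows G" "F = G.point_filter g" using F G.ultrafilters_KB by blast
    then have "{B \<in> carrier H.KB. ?f B \<in> F} = H.point_filter (\<alpha> g)"
      using f pK by (auto simp: G.point_filter_def H.point_filter_def p_def)
    then show ?thesis using H.ultrafilters_KB c g by simp
  qed
  ultimately show ?thesis by (simp add: callitic_hom_def)
qed

section \<open>The units\<close>

context bis
begin

lemma ultra_nhd_KB: "s \<in> carrier S \<Longrightarrow> ultra_nhd S s \<in> carrier (bisection_sgrp G)"
  using compactin_ultra_nhd openin_ultra_nhd bisection_ultra_nhd
  by (simp add: bisection_sgrp_def compact_open_def)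

text \<open>To factor an ultrafilter \<open>C\<close> through \<open>s \<cdot> t\<close>, choose
  \<open>B\<close> through \<open>t\<close> with the domain of \<open>C\<close>; it exists because
  the domain of \<open>s \<cdot> t\<close> lies below that of \<open>t\<close>. The other factor is
  \<open>C\<close> times the inverse of \<open>B\<close>, which contains \<open>s\<close> since
  \<open>s \<cdot> t \<cdot> t\<dagger> \<preceq> s\<close>.\<close>

lemma ultra_nhd_mult:
  assumes s: "s \<in> carrier S" and t: "t \<in> carrier S"
  shows "ultra_nhd S (s \<cdot> t) = gp_setmult G (ultra_nhd S s) (ultra_nhd S t)"
proof (intro equalityI subsetI)
  interpret G: gpd G by unfold_locales (rule groupoid_ultra)
  fix C assume "C \<in> ultra_nhd S (s \<cdot> t)"
  then have C: "C \<in> UF" "s \<cdot> t \<in> C" by (auto simp: ultra_nhd_def)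
  have st: "s \<cdot> t \<in> carrier S" using s t by simp
  have DC: "dom_of G C \<in> ultra_nhd S ((s \<cdot> t)\<dagger> \<cdot> (s \<cdot> t))"
    using dom_image_ultra_nhd[OF st] ultra_nhdI[OF C] by blast
  have "s\<dagger> \<cdot> s \<cdot> t \<preceq> t" using s t by (intro ordI_left) auto
  then have "t\<dagger> \<cdot> (s\<dagger> \<cdot> s \<cdot> t) \<preceq> t\<dagger> \<cdot> t" using s t by (intro mult_mono_ord) auto
  then have "(s \<cdot> t)\<dagger> \<cdot> (s \<cdot> t) \<preceq> t\<dagger> \<cdot> t" using s t by (simp add: mult_inv assoc)
  then have "dom_of G C \<in> dom_of G ` ultra_nhd S t"
    using DC ultra_nhd_mono dom_image_ultra_nhd[OF t] t by blast
  then obtain B where B: "B \<in> UF" "t \<in> B" "dom_of G C = dom_of G B" by (auto simp: ultra_nhd_def)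
  let ?A = "gp_mult G C (gp_inv G B)"
  have A: "?A \<in> UF" "dom_of G ?A = cod_of G B" "gp_mult G ?A B = C"
    using B C G.comp_arrow[of C "gp_inv G B"] G.D_comp[of C "gp_inv G B"] G.gi_cancel_comp[of B C]
      G.gi_arrow[of B] G.R_gi[of B] G.D_gi[of B] by (simp_all del: gp_mult_ultra gp_inv_ultra)
  have "s \<cdot> t \<cdot> t\<dagger> \<preceq> s" using ordI_right[of s "t \<cdot> t\<dagger>"] s t by (simp add: assoc)
  then have "s \<in> ?A" using B C s by (auto intro!: up_multI[of "s \<cdot> t" C "t\<dagger>"])
  then have "gp_mult G ?A B \<in> gp_setmult G (ultra_nhd S s) (ultra_nhd S t)"
    using A B by (intro G.setmultI ultra_nhdI) (simp_all del: gp_mult_ultra gp_inv_ultra)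
  then show "C \<in> gp_setmult G (ultra_nhd S s) (ultra_nhd S t)" unfolding A(3) .
next
  fix C assume "C \<in> gp_setmult G (ultra_nhd S s) (ultra_nhd S t)"
  then obtain A B where AB: "A \<in> UF" "B \<in> UF" "A\<ddagger> \<odot> A = B \<odot> B\<ddagger>" "s \<in> A" "t \<in> B" "C = A \<odot> B"
    by (auto simp: gp_setmult_def composable_ultra ultra_nhd_def)
  then have "s \<cdot> t \<in> C" using UF_subset by (auto intro!: up_mult_mult)
  then show "C \<in> ultra_nhd S (s \<cdot> t)" using UF_up_mult AB by (auto intro: ultra_nhdI)
qed

lemma ultra_nhd_inj:
  assumes "s \<in> carrier S" "t \<in> carrier S" "ultra_nhd S s = ultra_nhd S t"
  shows "s = t"
proof (rule ord_antisym)
  show "s \<preceq> t" using assms by (intro UF_subset_imp_ord) (auto simp: ultra_nhd_def)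
  show "t \<preceq> s" using assms by (intro UF_subset_imp_ord) (auto simp: ultra_nhd_def)
qed (use assms in auto)

text \<open>The domain map fixes identities, yet sends the neighbourhood of \<open>s\<close> onto
  that of \<open>s\<dagger> \<cdot> s\<close>. Injectivity of \<open>ultra_nhd\<close> gives
  \<open>s = s\<dagger> \<cdot> s\<close>.\<close>

lemma ultra_nhd_ids_imp_idem:
  assumes s: "s \<in> carrier S" and sub: "ultra_nhd S s \<subseteq> identities G"
  shows "s \<in> idems S"
proof -
  interpret G: gpd G by unfold_locales (rule groupoid_ultra)
  have "dom_of G ` ultra_nhd S s = ultra_nhd S s" using sub G.D_of_id by force
  then have "s = s\<dagger> \<cdot> s" using dom_image_ultra_nhd[OF s] ultra_nhd_inj s by simp
  then show ?thesis using inv_mult_idem[OF s] by simp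
qed

lemma ultra_nhd_star: "s \<in> carrier S \<Longrightarrow> ultra_nhd S (s\<dagger>) = gp_inv G ` ultra_nhd S s"
proof (intro equalityI subsetI)
  fix A assume s: "s \<in> carrier S" and "A \<in> ultra_nhd S (s\<dagger>)"
  then have A: "A \<in> UF" "s\<dagger> \<in> A" by (auto simp: ultra_nhd_def)
  then have "A\<ddagger> \<in> ultra_nhd S s" using UF_star s by (metis imageI inv_inv ultra_nhdI)
  then have "gp_inv G (A\<ddagger>) \<in> gp_inv G ` ultra_nhd S s" by (rule imageI)
  then show "A \<in> gp_inv G ` ultra_nhd S s" using UF_subset[OF A(1)] by simp
qed (use UF_star in \<open>auto simp: ultra_nhd_def\<close>)

text \<open>The neighbourhoods of \<open>s\<dagger> \<cdot> t\<close> and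
  \<open>s \<cdot> t\<dagger>\<close> lie in the products of \<open>B\<close> with its inverse,
  which consist of identities; hence both elements are idempotent.\<close>

lemma ultra_nhd_compatible:
  assumes s: "s \<in> carrier S" and t: "t \<in> carrier S"
    and B: "bisection G B" "ultra_nhd S s \<subseteq> B" "ultra_nhd S t \<subseteq> B"
  shows "compatible S s t"
proof -
  interpret G: gpd G by unfold_locales (rule groupoid_ultra)
  have "ultra_nhd S (s\<dagger> \<cdot> t) \<subseteq> gp_setmult G (gp_inv G ` B) B"
    "ultra_nhd S (s \<cdot> t\<dagger>) \<subseteq> gp_setmult G B (gp_inv G ` B)"
    unfolding ultra_nhd_mult[OF inv_closed[OF s] t] ultra_nhd_mult[OF s inv_closed[OF t]]
      ultra_nhd_star[OF s] ultra_nhd_star[OF t]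
    by (intro G.setmult_mono image_mono B)+
  then show ?thesis
    using B(1) s t unfolding bisection_def compatible_def
    by (intro conjI ultra_nhd_ids_imp_idem) auto
qed

lemma ultra_nhd_join:
  assumes s: "s \<in> carrier S" and t: "t \<in> carrier S" and c: "compatible S s t"
    and j: "is_lub (nat_order S) j {s, t}"
  shows "ultra_nhd S j = ultra_nhd S s \<union> ultra_nhd S t"
proof
  have "j \<in> carrier S" "s \<preceq> j" "t \<preceq> j" using j s t is_lub_iff[of "{s, t}" "nat_order S"] by auto
  then show "ultra_nhd S s \<union> ultra_nhd S t \<subseteq> ultra_nhd S j" using ultra_nhd_mono by blast
  show "ultra_nhd S j \<subseteq> ultra_nhd S s \<union> ultra_nhd S t"
    using UF_prime[OF _ s t c j] by (auto simp: ultra_nhd_def)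
qed

text \<open>Compactness covers \<open>B\<close> by finitely many basic sets inside \<open>B\<close>.
  Their indices are compatible because \<open>B\<close> is a bisection, so they can be joined one by
  one, and primeness turns each join into a union.\<close>

lemma ultra_nhd_surj:
  assumes B: "B \<in> carrier (bisection_sgrp G)"
  shows "B \<in> ultra_nhd S ` carrier S"
proof -
  have Bb: "bisection G B" and Bc: "compactin (gp_top G) B" and Bo: "openin (gp_top G) B"
    using B by (auto simp: bisection_sgrp_def compact_open_def)
  let ?\<U> = "ultra_nhd S ` {s \<in> carrier S. ultra_nhd S s \<subseteq> B}"
  have cover: "B \<subseteq> \<Union>?\<U>"
  proof
    fix A assume A: "A \<in> B"
    then have AU: "A \<in> UF" using Bo openin_ultra_iff by blast
    obtain s where "s \<in> A" "ultra_nhd S s \<subseteq> B" using A Bo unfolding openin_ultra_iff by blast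
    then show "A \<in> \<Union>?\<U>" using AU UF_carrier by (auto intro!: ultra_nhdI)
  qed
  have "\<forall>U\<in>?\<U>. openin (gp_top G) U" using openin_ultra_nhd by auto
  then obtain \<F> where \<F>: "finite \<F>" "\<F> \<subseteq> ?\<U>" "B \<subseteq> \<Union>\<F>"
    using Bc cover unfolding compactin_def by meson
  have "\<exists>j\<in>carrier S. ultra_nhd S j = \<Union>\<F>"
    using \<F>(1,2)
  proof (induction \<F>)
    case empty
    have "ultra_nhd S \<zero> = {}" using UF_zero by (auto simp: ultra_nhd_def)
    then show ?case by auto
  next
    case (insert V \<F>)
    then obtain j where j: "j \<in> carrier S" "ultra_nhd S j = \<Union>\<F>" by auto
    obtain s where s: "s \<in> carrier S" "ultra_nhd S s \<subseteq> B" "V = ultra_nhd S s" using insert by auto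
    have "ultra_nhd S j \<subseteq> B" unfolding j(2) using insert.prems by auto
    then have c: "compatible S s j" using ultra_nhd_compatible s j Bb by blast
    then obtain k where k: "is_lub (nat_order S) k {s, j}"
      using join_exists[of "{s, j}"] compatible_pair s j by blast
    then have "k \<in> carrier S" by (auto simp: least_def Upper_def)
    then show ?case using ultra_nhd_join[OF s(1) j(1) c k] s j by (intro bexI[of _ k]) auto
  qed
  then obtain j where "j \<in> carrier S" "ultra_nhd S j = \<Union>\<F>" by blast
  moreover have "\<Union>\<F> = B" using \<F> by blast
  ultimately show ?thesis by blast
qed

lemma bis_unit_iso: "bis_unit S \<in> callitic_iso S (bisection_sgrp G)"
proof -
  interpret G: bgpd G by (rule bgpdI[OF boolean_groupoid_ultra])
  show ?thesis
  proof (rule bij_hom_callitic_iso)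
    show "bis S" "bis (bisection_sgrp G)" by unfold_locales
    show "bij_betw (bis_unit S) (carrier S) (carrier (bisection_sgrp G))"
      unfolding bij_betw_def inj_on_def bis_unit_def
      using ultra_nhd_inj ultra_nhd_surj ultra_nhd_KB by auto
  qed (simp_all add: bis_unit_def ultra_nhd_mult)
qed

end

context bgpd
begin

text \<open>For a bisection \<open>U\<close> through \<open>g \<star> h\<close> and any
  \<open>A\<close> through \<open>g\<close>, the second factor can be taken as the inverse of
  \<open>A\<close> times \<open>U\<close>. It contains \<open>h\<close>, and multiplying it by
  \<open>A\<close> stays inside \<open>U\<close> because \<open>A\<close> times its inverse consists
  of identities.\<close>

lemma point_filter_comp:
  assumes gh: "g \<in> arrows G" "h \<in> arrows G" "D g = R h"
  shows "K.up_mult (point_filter g) (point_filter h) = point_filter (g \<star> h)"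
proof (intro equalityI subsetI)
  fix U assume "U \<in> K.up_mult (point_filter g) (point_filter h)"
  then obtain A B where AB: "A \<in> point_filter g" "B \<in> point_filter h"
    "A \<diamondop> B \<sqsubseteq>\<^bsub>nat_order KB\<^esub> U" "U \<in> carrier KB" using K.up_multD by (metis mult_KB)
  then have "A \<in> carrier KB" "B \<in> carrier KB" "g \<in> A" "h \<in> B" by (auto simp: point_filter_def)
  moreover from this have "g \<star> h \<in> A \<diamondop> B" using gh by (intro setmultI)
  ultimately show "U \<in> point_filter (g \<star> h)"
    using AB ord_KB[OF KB_setmult, of A B U] by (auto simp: point_filter_def)
next
  fix U assume "U \<in> point_filter (g \<star> h)"
  then have U: "U \<in> carrier KB" "g \<star> h \<in> U" by (auto simp: point_filter_def)
  obtain A where A: "A \<in> carrier KB" "g \<in> A" using KB_basis[OF openin_topspace, of g] gh by auto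
  let ?B = "gi ` A \<diamondop> U"
  have B: "?B \<in> carrier KB" using KB_setmult KB_gi A U by blast
  have "gi g \<star> (g \<star> h) \<in> ?B" using A U gh by (intro setmultI) auto
  then have hB: "h \<in> ?B" using gh by (simp add: gi_comp_cancel)
  have "A \<diamondop> gi ` A \<subseteq> I" using KB_bisection[OF A(1)] by (simp add: bisection_def)
  then have "A \<diamondop> ?B \<subseteq> U" using setmult_ids_left by (simp add: setmult_assoc[symmetric])
  then have "A \<cdot>\<^bsub>KB\<^esub> ?B \<sqsubseteq>\<^bsub>nat_order KB\<^esub> U" using ord_KB[OF KB_setmult[OF A(1) B] U(1)] by simp
  then show "U \<in> K.up_mult (point_filter g) (point_filter h)"
    using A B hB U by (intro K.up_multI[of A _ ?B]) (auto simp: point_filter_def)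
qed

lemma point_filter_gi:
  assumes g: "g \<in> arrows G"
  shows "sg_inv KB ` point_filter g = point_filter (gi g)"
proof (intro equalityI subsetI)
  fix U assume "U \<in> sg_inv KB ` point_filter g"
  then obtain A where "A \<in> carrier KB" "g \<in> A" "U = gi ` A" by (auto simp: point_filter_def inv_KB)
  then show "U \<in> point_filter (gi g)" using KB_gi by (auto simp: point_filter_def)
next
  fix U assume "U \<in> point_filter (gi g)"
  then have U: "U \<in> carrier KB" "gi g \<in> U" by (auto simp: point_filter_def)
  then have "gi (gi g) \<in> gi ` U" by blast
  then have "gi ` U \<in> point_filter g" using KB_gi U g by (simp add: point_filter_def)
  moreover have "U = sg_inv KB (gi ` U)" using K.inv_inv[OF U(1)] inv_KB[OF U(1)] by simp
  ultimately show "U \<in> sg_inv KB ` point_filter g" by blast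
qed

lemma gpd_unit_eq: "g \<in> arrows G \<Longrightarrow> gpd_unit G g = point_filter g"
  by (simp add: gpd_unit_def point_filter_def)

lemma point_filter_UF: "g \<in> arrows G \<Longrightarrow> point_filter g \<in> ultrafilters KB"
  using ultrafilters_KB by blast

lemma gpd_unit_functor: "gp_functor G (ultra_gpd KB) (gpd_unit G)"
  unfolding gp_functor_def
proof (intro conjI ballI)
  show "gpd_unit G \<in> arrows G \<rightarrow> arrows (ultra_gpd KB)" using point_filter_UF by (simp add: gpd_unit_eq)
  fix x assume x: "x \<in> arrows G"
  show "gpd_unit G (D x) = dom_of (ultra_gpd KB) (gpd_unit G x)"
    using point_filter_comp[of "gi x" x] x by (simp add: gpd_unit_eq K.dom_of_ultra point_filter_gi gi_comp)
  show "gpd_unit G (R x) = cod_of (ultra_gpd KB) (gpd_unit G x)"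
    using point_filter_comp[of x "gi x"] x by (simp add: gpd_unit_eq K.cod_of_ultra point_filter_gi comp_gi)
next
  fix p assume "p \<in> composable G"
  then obtain x y where "p = (x, y)" "x \<in> arrows G" "y \<in> arrows G" "D x = R y"
    by (auto simp: composable_def)
  then show "case p of (x, y) \<Rightarrow> gpd_unit G (x \<star> y) =
      gp_mult (ultra_gpd KB) (gpd_unit G x) (gpd_unit G y)"
    using point_filter_comp by (simp add: gpd_unit_eq)
qed

lemma gpd_unit_homeomorphic: "homeomorphic_map X (gp_top (ultra_gpd KB)) (gpd_unit G)"
proof (rule bijective_open_imp_homeomorphic_map)
  show "continuous_map X (gp_top (ultra_gpd KB)) (gpd_unit G)"
  proof (rule K.continuous_map_ultra)
    show "gpd_unit G \<in> topspace X \<rightarrow> ultrafilters KB" using point_filter_UF by (simp add: gpd_unit_eq)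
    fix x B assume "x \<in> topspace X" "B \<in> gpd_unit G x"
    then have B: "B \<in> carrier KB" "x \<in> B" by (auto simp: gpd_unit_eq point_filter_def)
    moreover have "B \<in> gpd_unit G y" if "y \<in> B" for y
      using that B KB_arrows[OF B(1)] by (auto simp: gpd_unit_eq point_filter_def)
    ultimately show "\<exists>W. openin X W \<and> x \<in> W \<and> (\<forall>y\<in>W. B \<in> gpd_unit G y)" using KB_open by blast
  qed
  show "open_map X (gp_top (ultra_gpd KB)) (gpd_unit G)"
    unfolding open_map_def K.openin_ultra_iff
  proof (intro allI impI conjI ballI)
    fix W assume W: "openin X W"
    then have Wa: "W \<subseteq> arrows G" using openin_subset by fastforce
    show "gpd_unit G ` W \<subseteq> ultrafilters KB" using Wa point_filter_UF by (auto simp: gpd_unit_eq)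
    fix F assume "F \<in> gpd_unit G ` W"
    then obtain g where g: "g \<in> W" "F = point_filter g" using Wa by (auto simp: gpd_unit_eq)
    then obtain B where B: "B \<in> carrier KB" "g \<in> B" "B \<subseteq> W" using KB_basis[OF W] by blast
    \<comment> \<open>Every ultrafilter of \<open>KB\<close> is a point filter, so the basic
      neighbourhood of \<open>B\<close> contains exactly the point filters of arrows in
      \<open>B\<close>.\<close>
    have "ultra_nhd KB B \<subseteq> gpd_unit G ` W"
    proof
      fix F assume "F \<in> ultra_nhd KB B"
      then obtain h where h: "h \<in> arrows G" "F = point_filter h" "B \<in> F"
        using ultrafilters_KB by (auto simp: ultra_nhd_def)
      then have "h \<in> W" using B by (auto simp: point_filter_def)
      then show "F \<in> gpd_unit G ` W" using h gpd_unit_eq by blast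
    qed
    moreover have "B \<in> F" using g B by (simp add: point_filter_def)
    ultimately show "\<exists>s\<in>F. ultra_nhd KB s \<subseteq> gpd_unit G ` W" by blast
  qed
  show "gpd_unit G ` topspace X = topspace (gp_top (ultra_gpd KB))"
    using ultrafilters_KB by (simp add: gpd_unit_eq)
  show "inj_on (gpd_unit G) (topspace X)"
    using point_filter_inj by (auto simp: inj_on_def gpd_unit_eq)
qed

lemma gpd_unit_iso: "gpd_unit G \<in> covering_iso G (ultra_gpd KB)"
  using groupoid K.groupoid_ultra gpd_unit_functor gpd_unit_homeomorphic
  by (intro homeomorphic_functor_covering_iso) (simp_all add: gpd_unit_def)

end

theorem theorem3p25:
  fixes S :: "'a sgrp" and T :: "'b sgrp" and U :: "'c sgrp"
    and G :: "'d tgpd" and H :: "'e tgpd" and K :: "'f tgpd"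
  assumes "boolean_inverse_semigroup S" and "boolean_inverse_semigroup T"
    and "boolean_inverse_semigroup U"
    and "boolean_groupoid G" and "boolean_groupoid H" and "boolean_groupoid K"
  shows
    "((\<lambda>s\<in>carrier S. s) \<in> callitic_hom S S \<and>
      (\<forall>\<theta>\<in>callitic_hom S T. \<forall>\<phi>\<in>callitic_hom T U. compose (carrier S) \<phi> \<theta> \<in> callitic_hom S U))
     \<and>
     ((\<lambda>g\<in>arrows G. g) \<in> covering_hom G G \<and>
      (\<forall>\<alpha>\<in>covering_hom G H. \<forall>\<beta>\<in>covering_hom H K. compose (arrows G) \<beta> \<alpha> \<in> covering_hom G K))
     \<and>
     (boolean_groupoid (ultra_gpd S) \<and>
      (\<forall>\<theta>\<in>callitic_hom S T. ultra_map S T \<theta> \<in> covering_hom (ultra_gpd T) (ultra_gpd S)) \<and>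
      ultra_map S S (\<lambda>s\<in>carrier S. s) = (\<lambda>A\<in>arrows (ultra_gpd S). A) \<and>
      (\<forall>\<theta>\<in>callitic_hom S T. \<forall>\<phi>\<in>callitic_hom T U.
         ultra_map S U (compose (carrier S) \<phi> \<theta>) =
         compose (arrows (ultra_gpd U)) (ultra_map S T \<theta>) (ultra_map T U \<phi>)))
     \<and>
     (boolean_inverse_semigroup (bisection_sgrp G) \<and>
      (\<forall>\<alpha>\<in>covering_hom G H.
         bisection_map G H \<alpha> \<in> callitic_hom (bisection_sgrp H) (bisection_sgrp G)) \<and>
      bisection_map G G (\<lambda>g\<in>arrows G. g) = (\<lambda>B\<in>carrier (bisection_sgrp G). B) \<and>
      (\<forall>\<alpha>\<in>covering_hom G H. \<forall>\<beta>\<in>covering_hom H K.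
         bisection_map G K (compose (arrows G) \<beta> \<alpha>) =
         compose (carrier (bisection_sgrp K)) (bisection_map G H \<alpha>) (bisection_map H K \<beta>)))
     \<and>
     (bis_unit S \<in> callitic_iso S (bisection_sgrp (ultra_gpd S)) \<and>
      (\<forall>\<theta>\<in>callitic_hom S T.
         compose (carrier S) (bis_unit T) \<theta> =
         compose (carrier S)
           (bisection_map (ultra_gpd T) (ultra_gpd S) (ultra_map S T \<theta>)) (bis_unit S)))
     \<and>
     (gpd_unit G \<in> covering_iso G (ultra_gpd (bisection_sgrp G)) \<and>
      (\<forall>\<alpha>\<in>covering_hom G H.
         compose (arrows G) (gpd_unit H) \<alpha> =
         compose (arrows G)
           (ultra_map (bisection_sgrp H) (bisection_sgrp G) (bisection_map G H \<alpha>)) (gpd_unit G)))"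
proof -
  interpret S: bis S by (rule bisI) fact
  interpret T: bis T by (rule bisI) fact
  interpret U: bis U by (rule bisI) fact
  interpret G: bgpd G by (rule bgpdI) fact
  interpret H: bgpd H by (rule bgpdI) fact
  interpret K: bgpd K by (rule bgpdI) fact
  \<comment> \<open>The functor laws and the naturality squares are pointwise identities between
    inverse images. The closure facts collected here guarantee that intermediate values lie where
    the restricted functions are defined, so that the two sides agree as extensional
    functions.\<close>
  have closed: "\<theta> s \<in> carrier T" if "\<theta> \<in> callitic_hom S T" "s \<in> carrier S" for \<theta> s
    using that bis_hom_closed by (auto simp: callitic_hom_def)
  have pre: "{t \<in> carrier T. \<phi> t \<in> F} \<in> ultrafilters T" if "\<phi> \<in> callitic_hom T U" "F \<in> ultrafilters U" for \<phi> F
    using that by (auto simp: callitic_hom_def)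
  have pre': "{s \<in> carrier S. \<theta> s \<in> F} \<in> ultrafilters S" if "\<theta> \<in> callitic_hom S T" "F \<in> ultrafilters T" for \<theta> F
    using that by (auto simp: callitic_hom_def)
  have bpre: "{h \<in> arrows H. \<beta> h \<in> B} \<in> carrier (bisection_sgrp H)"
    if "\<beta> \<in> covering_hom H K" "B \<in> carrier (bisection_sgrp K)" for \<beta> B
  proof -
    have "bisection_map H K \<beta> \<in> bis_hom (bisection_sgrp K) (bisection_sgrp H)"
      using bisection_map_callitic[OF assms(5,6) that(1)] by (simp add: callitic_hom_def)
    from bis_hom_closed[OF this that(2)] show ?thesis using that(2) by (simp add: bisection_map_def)
  qed
  have gpre: "{g \<in> arrows G. \<alpha> g \<in> B} \<in> carrier (bisection_sgrp G)"
    if "\<alpha> \<in> covering_hom G H" "B \<in> carrier (bisection_sgrp H)" for \<alpha> B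
  proof -
    have "bisection_map G H \<alpha> \<in> bis_hom (bisection_sgrp H) (bisection_sgrp G)"
      using bisection_map_callitic[OF assms(4,5) that(1)] by (simp add: callitic_hom_def)
    from bis_hom_closed[OF this that(2)] show ?thesis using that(2) by (simp add: bisection_map_def)
  qed
  show ?thesis
  proof (intro conjI ballI)
    show "(\<lambda>s\<in>carrier S. s) \<in> callitic_hom S S" by (rule S.id_callitic)
    show "compose (carrier S) \<phi> \<theta> \<in> callitic_hom S U"
      if "\<theta> \<in> callitic_hom S T" "\<phi> \<in> callitic_hom T U" for \<theta> \<phi>
      by (rule compose_callitic[OF S.inv_sgrp_axioms T.inv_sgrp_axioms that])
    show "(\<lambda>g\<in>arrows G. g) \<in> covering_hom G G" by (rule id_covering[OF G.groupoid])
    show "compose (arrows G) \<beta> \<alpha> \<in> covering_hom G K"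
      if "\<alpha> \<in> covering_hom G H" "\<beta> \<in> covering_hom H K" for \<alpha> \<beta>
      by (rule compose_covering[OF G.groupoid H.groupoid that])
    show "boolean_groupoid (ultra_gpd S)" by (rule S.boolean_groupoid_ultra)
    show "ultra_map S T \<theta> \<in> covering_hom (ultra_gpd T) (ultra_gpd S)" if "\<theta> \<in> callitic_hom S T" for \<theta>
      by (rule ultra_map_covering[OF assms(1,2) that])
    show "ultra_map S S (\<lambda>s\<in>carrier S. s) = (\<lambda>A\<in>arrows (ultra_gpd S). A)"
      using S.UF_subset by (auto simp: ultra_map_def restrict_def fun_eq_iff)
    show "ultra_map S U (compose (carrier S) \<phi> \<theta>) =
         compose (arrows (ultra_gpd U)) (ultra_map S T \<theta>) (ultra_map T U \<phi>)"
      if "\<theta> \<in> callitic_hom S T" "\<phi> \<in> callitic_hom T U" for \<theta> \<phi>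
      using closed[OF that(1)] pre[OF that(2)]
      by (auto simp: ultra_map_def compose_def restrict_def fun_eq_iff)
    show "boolean_inverse_semigroup (bisection_sgrp G)" by (rule G.boolean_inverse_semigroup_KB)
    show "bisection_map G H \<alpha> \<in> callitic_hom (bisection_sgrp H) (bisection_sgrp G)"
      if "\<alpha> \<in> covering_hom G H" for \<alpha>
      by (rule bisection_map_callitic[OF assms(4,5) that])
    show "bisection_map G G (\<lambda>g\<in>arrows G. g) = (\<lambda>B\<in>carrier (bisection_sgrp G). B)"
      using G.KB_arrows by (auto simp: bisection_map_def restrict_def fun_eq_iff)
    show "bisection_map G K (compose (arrows G) \<beta> \<alpha>) =
         compose (carrier (bisection_sgrp K)) (bisection_map G H \<alpha>) (bisection_map H K \<beta>)"
      if "\<alpha> \<in> covering_hom G H" "\<beta> \<in> covering_hom H K" for \<alpha> \<beta>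
      using covering_closed[OF that(1)] bpre[OF that(2)]
      by (auto simp: bisection_map_def compose_def restrict_def fun_eq_iff)
    show "bis_unit S \<in> callitic_iso S (bisection_sgrp (ultra_gpd S))" by (rule S.bis_unit_iso)
    show "compose (carrier S) (bis_unit T) \<theta> =
         compose (carrier S) (bisection_map (ultra_gpd T) (ultra_gpd S) (ultra_map S T \<theta>)) (bis_unit S)"
      if "\<theta> \<in> callitic_hom S T" for \<theta>
      using closed[OF that] pre'[OF that] S.ultra_nhd_KB
      by (auto simp: bis_unit_def bisection_map_def ultra_map_def compose_def restrict_def fun_eq_iff ultra_nhd_def)
    show "gpd_unit G \<in> covering_iso G (ultra_gpd (bisection_sgrp G))" by (rule G.gpd_unit_iso)
    show "compose (arrows G) (gpd_unit H) \<alpha> =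
         compose (arrows G)
           (ultra_map (bisection_sgrp H) (bisection_sgrp G) (bisection_map G H \<alpha>)) (gpd_unit G)"
      if "\<alpha> \<in> covering_hom G H" for \<alpha>
      using covering_closed[OF that] gpre[OF that] G.point_filter_UF
      by (auto simp: gpd_unit_def bisection_map_def ultra_map_def compose_def restrict_def fun_eq_iff
          G.point_filter_def)
  qed
qed

end
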